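(* Let $c,d>0$ and let $T=(T_1,T_2)$ be a 2-tuple of commuting 3-isometries on a complex Hilbert space $H$ belonging to the class $\mathfrak{F}_{c,d}$. Then $T$ lifts to a 2-tuple $J=(J_1,J_2)$ in the class $\mathfrak{J}_{c,d}$ if and only if the quadratic pencil $\hat{Q}_T(\alpha,\beta)$ factors in the form $$\hat{Q}_{T}(\alpha,\beta)=(V_0+\alpha V_1+\beta V_2)^*(V_0+\alpha V_1+\beta V_2)\qquad ((\alpha,\beta)\in\mathbb{R}^2)$$ for some bounded operators $V_0,V_1,V_2$ on $H$.
   Context: All operators are bounded. A commuting pair $T=(T_1,T_2)$ of operators on a complex Hilbert space $H$ is a 2-tuple of 3-isometries if there exist bounded operators $B_{i,j}$ on $H$ ($i,j\ge 0$, $i+j\le 2$) such that $$Q_T(n,m)=T_2^{*m}T_1^{*n}T_1^nT_2^m=\sum_{0\le i+j\le 2} n^i m^j B_{i,j}$$ for all $n,m\in\mathbb{N}=\{0,1,2,\dots\}$ (so $B_{0,0}=I$). For $(\alpha,\beta)\in\mathbb{R}^2$ put $Q_T(\alpha,\beta)=\sum_{0\le i+j\le2}\alpha^i\beta^jB_{i,j}$ and $$\hat{Q}_T(\alpha,\beta)=Q_T(\alpha,\beta)-\frac1{c^2}B_{2,0}-\frac1{d^2}B_{0,2}.$$ The 2-tuple $T$ is in the class $\mathfrak{F}_{c,d}$ if $\hat{Q}_T(\alpha,\beta)\succeq0$ (positive semidefinite) for all $(\alpha,\beta)\in\mathbb{R}^2$. A 2-tuple $J=(J_1,J_2)$ is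 in the class $\mathfrak{J}_{c,d}$ if there are commuting unitary operators $U_1,U_2$ on some Hilbert space $F$ such that, on $F\oplus F\oplus F$, $$J_1=\begin{pmatrix}U_1&cU_1&0\\0&U_1&0\\0&0&U_1\end{pmatrix},\qquad J_2=\begin{pmatrix}U_2&0&dU_2\\0&U_2&0\\0&0&U_2\end{pmatrix}.$$ $T$ on $H$ lifts to $J$ on $K$ if there is an isometry $V:H\to K$ with $VT_i=J_iV$ for $i=1,2$. *)

theory Defs
  imports
    "HOL-Analysis.Analysis"
    "HOL-Algebra.Algebraic_Closure_Type"
begin

section \<open>Complex Hilbert spaces with an explicit carrier\<close>

text \<open>
  A Hilbert space is a record with an explicit carrier rather than a type class instance, because
  the class \<open>class_J\<close> below asserts the existence of a Hilbert space. The vector space part is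
  a module over the field of complex numbers in the sense of HOL-Algebra, whose record type also has
  the fields \<open>mult\<close> and \<open>one\<close>; these carry no meaning here.
  The inner product is linear in its first argument.
\<close>

record 'a hilbert = "(complex, 'a) Module.module" +
  inner_prod :: "'a \<Rightarrow> 'a \<Rightarrow> complex"

definition hnorm :: "'a hilbert \<Rightarrow> 'a \<Rightarrow> real" where
  "hnorm H x = sqrt (Re (inner_prod H x x))"

definition hdist :: "'a hilbert \<Rightarrow> 'a \<Rightarrow> 'a \<Rightarrow> real" where
  "hdist H x y = hnorm H (x \<ominus>\<^bsub>H\<^esub> y)"

text \<open>
  \<open>hdist\<close> is only well-behaved on the carrier, whereas the locale \<open>Metric_space\<close> asks for
  symmetry and non-negativity on the whole type; hence the cut-off in the completeness axiom.
\<close>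

locale complex_hilbert_space =
  Module.module "ring_of_type_algebra :: complex ring" H for H :: "'a hilbert" (structure) +
  assumes inner_prod_add:
      "\<lbrakk>x \<in> carrier H; y \<in> carrier H; z \<in> carrier H\<rbrakk> \<Longrightarrow>
        inner_prod H (x \<oplus> y) z = inner_prod H x z + inner_prod H y z"
    and inner_prod_smult:
      "\<lbrakk>x \<in> carrier H; y \<in> carrier H\<rbrakk> \<Longrightarrow>
        inner_prod H (a \<odot> x) y = a * inner_prod H x y"
    and inner_prod_commute:
      "\<lbrakk>x \<in> carrier H; y \<in> carrier H\<rbrakk> \<Longrightarrow>
        inner_prod H x y = cnj (inner_prod H y x)"
    and inner_prod_nonneg:
      "x \<in> carrier H \<Longrightarrow> inner_prod H x x \<in> \<real>\<^sub>\<ge>\<^sub>0"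
    and inner_prod_definite:
      "\<lbrakk>x \<in> carrier H; inner_prod H x x = 0\<rbrakk> \<Longrightarrow> x = \<zero>"
    and complete:
      "Metric_space.mcomplete (carrier H)
        (\<lambda>x y. if x \<in> carrier H \<and> y \<in> carrier H then hdist H x y else 0)"

definition hilbert_sum :: "'a hilbert \<Rightarrow> 'b hilbert \<Rightarrow> ('a \<times> 'b) hilbert"  (infixr "\<oplus>\<^sub>H" 65) where
  "F \<oplus>\<^sub>H G =
    \<lparr>carrier = carrier F \<times> carrier G,
     mult = (\<lambda>p q. (fst p \<otimes>\<^bsub>F\<^esub> fst q, snd p \<otimes>\<^bsub>G\<^esub> snd q)),
     one = (\<one>\<^bsub>F\<^esub>, \<one>\<^bsub>G\<^esub>),
     zero = (\<zero>\<^bsub>F\<^esub>, \<zero>\<^bsub>G\<^esub>),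
     add = (\<lambda>p q. (fst p \<oplus>\<^bsub>F\<^esub> fst q, snd p \<oplus>\<^bsub>G\<^esub> snd q)),
     smult = (\<lambda>a p. (a \<odot>\<^bsub>F\<^esub> fst p, a \<odot>\<^bsub>G\<^esub> snd p)),
     inner_prod = (\<lambda>p q. inner_prod F (fst p) (fst q) + inner_prod G (snd p) (snd q))\<rparr>"


section \<open>Operators\<close>

text \<open>
  Operators are functions on the underlying type of which only the values on the carrier matter;
  accordingly, operator identities are always stated pointwise on the carrier.
\<close>

definition bounded_op :: "'a hilbert \<Rightarrow> 'b hilbert \<Rightarrow> ('a \<Rightarrow> 'b) \<Rightarrow> bool" where
  "bounded_op H K A \<longleftrightarrow>
    A \<in> carrier H \<rightarrow> carrier K \<and>
    (\<forall>x\<in>carrier H. \<forall>y\<in>carrier H. A (x \<oplus>\<^bsub>H\<^esub> y) = A x \<oplus>\<^bsub>K\<^esub> A y) \<and>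
    (\<forall>a. \<forall>x\<in>carrier H. A (a \<odot>\<^bsub>H\<^esub> x) = a \<odot>\<^bsub>K\<^esub> A x) \<and>
    (\<exists>M. \<forall>x\<in>carrier H. hnorm K (A x) \<le> M * hnorm H x)"

definition adj :: "'a hilbert \<Rightarrow> 'b hilbert \<Rightarrow> ('a \<Rightarrow> 'b) \<Rightarrow> 'b \<Rightarrow> 'a" where
  "adj H K A y =
    (THE z. z \<in> carrier H \<and> (\<forall>x\<in>carrier H. inner_prod K (A x) y = inner_prod H x z))"

definition isometry_op :: "'a hilbert \<Rightarrow> 'b hilbert \<Rightarrow> ('a \<Rightarrow> 'b) \<Rightarrow> bool" where
  "isometry_op H K V \<longleftrightarrow>
    bounded_op H K V \<and> (\<forall>x\<in>carrier H. hnorm K (V x) = hnorm H x)"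

definition unitary_op :: "'a hilbert \<Rightarrow> ('a \<Rightarrow> 'a) \<Rightarrow> bool" where
  "unitary_op H U \<longleftrightarrow> isometry_op H H U \<and> U ` carrier H = carrier H"

definition positive_op :: "'a hilbert \<Rightarrow> ('a \<Rightarrow> 'a) \<Rightarrow> bool" where
  "positive_op H A \<longleftrightarrow>
    bounded_op H H A \<and> (\<forall>x\<in>carrier H. inner_prod H (A x) x \<in> \<real>\<^sub>\<ge>\<^sub>0)"

definition commute_on :: "'a hilbert \<Rightarrow> ('a \<Rightarrow> 'a) \<Rightarrow> ('a \<Rightarrow> 'a) \<Rightarrow> bool" where
  "commute_on H A B \<longleftrightarrow> (\<forall>x\<in>carrier H. A (B x) = B (A x))"


section \<open>Pairs of 3-isometries and the class F\<close>

definition pencil ::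
    "'a hilbert \<Rightarrow> (nat \<Rightarrow> nat \<Rightarrow> 'a \<Rightarrow> 'a) \<Rightarrow> real \<Rightarrow> real \<Rightarrow> 'a \<Rightarrow> 'a" where
  "pencil H B \<alpha> \<beta> x =
    (\<Oplus>\<^bsub>H\<^esub>i\<in>{..2}. \<Oplus>\<^bsub>H\<^esub>j\<in>{..2 - i}. complex_of_real (\<alpha> ^ i * \<beta> ^ j) \<odot>\<^bsub>H\<^esub> B i j x)"

definition pencil_coeffs ::
    "'a hilbert \<Rightarrow> ('a \<Rightarrow> 'a) \<Rightarrow> ('a \<Rightarrow> 'a) \<Rightarrow> (nat \<Rightarrow> nat \<Rightarrow> 'a \<Rightarrow> 'a) \<Rightarrow> bool" where
  "pencil_coeffs H T1 T2 B \<longleftrightarrow>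
    (\<forall>i j. i + j \<le> 2 \<longrightarrow> bounded_op H H (B i j)) \<and>
    (\<forall>n m. \<forall>x\<in>carrier H.
      (adj H H T2 ^^ m) ((adj H H T1 ^^ n) ((T1 ^^ n) ((T2 ^^ m) x))) =
      pencil H B (real n) (real m) x)"

definition three_isometric_pair :: "'a hilbert \<Rightarrow> ('a \<Rightarrow> 'a) \<Rightarrow> ('a \<Rightarrow> 'a) \<Rightarrow> bool" where
  "three_isometric_pair H T1 T2 \<longleftrightarrow>
    bounded_op H H T1 \<and> bounded_op H H T2 \<and> commute_on H T1 T2 \<and>
    (\<exists>B. pencil_coeffs H T1 T2 B)"

text \<open>
  The coefficients of a pair of 3-isometries are unique on the carrier, since a polynomial in two
  variables is determined by its values on pairs of natural numbers; so it does not matter which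
  family the choice operator picks.
\<close>

definition coeff_op ::
    "'a hilbert \<Rightarrow> ('a \<Rightarrow> 'a) \<Rightarrow> ('a \<Rightarrow> 'a) \<Rightarrow> nat \<Rightarrow> nat \<Rightarrow> 'a \<Rightarrow> 'a" where
  "coeff_op H T1 T2 = (SOME B. pencil_coeffs H T1 T2 B)"

definition Q_pencil ::
    "'a hilbert \<Rightarrow> ('a \<Rightarrow> 'a) \<Rightarrow> ('a \<Rightarrow> 'a) \<Rightarrow> real \<Rightarrow> real \<Rightarrow> 'a \<Rightarrow> 'a" where
  "Q_pencil H T1 T2 = pencil H (coeff_op H T1 T2)"

definition Q_hat ::
    "real \<Rightarrow> real \<Rightarrow> 'a hilbert \<Rightarrow> ('a \<Rightarrow> 'a) \<Rightarrow> ('a \<Rightarrow> 'a) \<Rightarrow> real \<Rightarrow> real \<Rightarrow> 'a \<Rightarrow> 'a" where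
  "Q_hat c d H T1 T2 \<alpha> \<beta> x =
    Q_pencil H T1 T2 \<alpha> \<beta> x
      \<ominus>\<^bsub>H\<^esub> complex_of_real (1 / c\<^sup>2) \<odot>\<^bsub>H\<^esub> coeff_op H T1 T2 2 0 x
      \<ominus>\<^bsub>H\<^esub> complex_of_real (1 / d\<^sup>2) \<odot>\<^bsub>H\<^esub> coeff_op H T1 T2 0 2 x"

definition class_F :: "real \<Rightarrow> real \<Rightarrow> 'a hilbert \<Rightarrow> ('a \<Rightarrow> 'a) \<Rightarrow> ('a \<Rightarrow> 'a) \<Rightarrow> bool" where
  "class_F c d H T1 T2 \<longleftrightarrow>
    three_isometric_pair H T1 T2 \<and> (\<forall>\<alpha> \<beta>. positive_op H (Q_hat c d H T1 T2 \<alpha> \<beta>))"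


section \<open>The class J and liftings\<close>

definition class_J ::
    "real \<Rightarrow> real \<Rightarrow> ('f \<times> 'f \<times> 'f) hilbert \<Rightarrow>
      ('f \<times> 'f \<times> 'f \<Rightarrow> 'f \<times> 'f \<times> 'f) \<Rightarrow> ('f \<times> 'f \<times> 'f \<Rightarrow> 'f \<times> 'f \<times> 'f) \<Rightarrow> bool" where
  "class_J c d K J1 J2 \<longleftrightarrow>
    (\<exists>F U1 U2.
      complex_hilbert_space F \<and> K = F \<oplus>\<^sub>H F \<oplus>\<^sub>H F \<and>
      unitary_op F U1 \<and> unitary_op F U2 \<and> commute_on F U1 U2 \<and>
      (\<forall>x\<in>carrier F. \<forall>y\<in>carrier F. \<forall>z\<in>carrier F.
        J1 (x, y, z) = (U1 x \<oplus>\<^bsub>F\<^esub> complex_of_real c \<odot>\<^bsub>F\<^esub> U1 y, U1 y, U1 z) \<and>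
        J2 (x, y, z) = (U2 x \<oplus>\<^bsub>F\<^esub> complex_of_real d \<odot>\<^bsub>F\<^esub> U2 z, U2 y, U2 z)))"

definition lifts_to ::
    "'a hilbert \<Rightarrow> ('a \<Rightarrow> 'a) \<Rightarrow> ('a \<Rightarrow> 'a) \<Rightarrow>
      'b hilbert \<Rightarrow> ('b \<Rightarrow> 'b) \<Rightarrow> ('b \<Rightarrow> 'b) \<Rightarrow> bool" where
  "lifts_to H T1 T2 K J1 J2 \<longleftrightarrow>
    (\<exists>V. isometry_op H K V \<and>
      (\<forall>x\<in>carrier H. V (T1 x) = J1 (V x) \<and> V (T2 x) = J2 (V x)))"

text \<open>
  Quantification over all Hilbert spaces \<open>F\<close> is quantification over all Hilbert spaces whose
  carrier is a set of elements of a given type. The type below serves for liftings of operators on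
  spaces with vectors in \<open>'h\<close>: its first summand \<open>'f\<close> is an arbitrary type variable, so every
  Hilbert space is, up to isomorphism, admitted; its second summand makes sure that the type
  is never too small, as it holds isomorphic copies of all Hilbert spaces whose dimension is at most
  the cardinality of \<open>nat \<times> 'h\<close> (realised as square-summable families).
\<close>

type_synonym ('f, 'h) universe = "'f + (nat \<times> 'h \<Rightarrow> complex)"

end

theory Submission
  imports Defs
begin

text \<open>
From a lifting to a factorization. The three components of the isometry \<open>V : H \<rightarrow> F \<oplus> F \<oplus> F\<close> are
operators \<open>A0, A1, A2 : H \<rightarrow> F\<close>, and the shape of \<open>J1, J2\<close> says that \<open>A0 T1 = U1 (A0 + c A1)\<close>,
that \<open>A1\<close> and \<open>A2\<close> intertwine \<open>T1\<close> with \<open>U1\<close>, and symmetrically for \<open>T2\<close>. Since the \<open>Ui\<close> are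
isometric, comparing coefficients gives \<open>B20 = c\<^sup>2 A1* A1\<close> and \<open>B02 = d\<^sup>2 A2* A2\<close>, and the
modified pencil is \<open>W* W\<close> with \<open>W = A0 + \<alpha> c A1 + \<beta> d A2\<close>. These operators map into \<open>F\<close>, whereas
the factors have to act on \<open>H\<close>, so it remains to embed the closed span of the three ranges
isometrically into \<open>H\<close>. For infinite-dimensional \<open>H\<close> this is a comparison of cardinalities of
orthonormal sets. For finite-dimensional \<open>H\<close> the three ranges could a priori have three times
the dimension of \<open>H\<close>; but there the ranges of \<open>A1\<close> and \<open>A2\<close> are contained in the range of \<open>A0\<close>.
Indeed, if \<open>z\<close> is orthogonal to the range of \<open>A0\<close>, then \<open>A0 T1\<^sup>k x - k c A1 T1\<^sup>k x\<close> has constant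
norm, so \<open>\<langle>z, A1 T1\<^sup>k x\<rangle>\<close> is of order \<open>1/k\<close>; but \<open>A1 T1\<^sup>k x = U1\<^sup>k A1 x\<close> is an isometric orbit
in a finite-dimensional space and returns arbitrarily close to its starting point \<open>A1 x\<close>, so
\<open>\<langle>z, A1 x\<rangle> = 0\<close> (\<open>orthogonal_to_constant_term_finite_dim\<close>).

From a factorization to a lifting. A factorization \<open>W(\<alpha>, \<beta>)* W(\<alpha>, \<beta>)\<close> of the modified pencil
does not by itself yield the operators \<open>Ui\<close>: the pencil, having real arguments, determines only
the real part of \<open>V0* V1\<close>, and it is this product that would have to be compatible with \<open>T\<close>. The
remedy is to average. The pencil satisfies \<open>T1* Q(\<alpha>, \<beta>) T1 = Q(\<alpha> + 1, \<beta>)\<close>, so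
\<open>W(\<alpha> - a, \<beta> - b) T1\<^sup>a T2\<^sup>b\<close> is a factorization of the same pencil for each \<open>(a, b)\<close>; passing
from \<open>x\<close> to \<open>T1 x\<close> amounts to a shift of \<open>a\<close>. Replacing the Gram kernel of the coefficients of
these factorizations by a shift-invariant mean over \<open>(a, b)\<close> (\<open>ex_invariant_mean_kernel\<close>) gives
a positive kernel, indexed by translates of the coefficients by the integer lattice, on which
the two shifts act by kernel-preserving bijections. On the Hilbert space of this kernel
(\<open>kernel_space_hilbert\<close>) the shifts are commuting unitary operators (\<open>unitary_shift_op\<close>), and
the coefficients at the origin of the lattice are the components of the lifting. The mean leaves
\<open>V0* V0\<close>, \<open>V1* V1\<close> and \<open>V2* V2\<close> unchanged because these are determined by the pencil, and they
are all that the norm identity needs.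

All identities between vectors are checked by pairing them with an arbitrary vector
(\<open>inner_ext\<close>), which turns them into identities between complex numbers.
\<close>

unbundle cardinal_syntax

abbreviation ip :: "'a hilbert \<Rightarrow> 'a \<Rightarrow> 'a \<Rightarrow> complex" where
  "ip \<equiv> inner_prod"

section \<open>Inner products, completeness and the Riesz representation\<close>

lemma ring_of_type_algebra_simps [simp]:
  "carrier (ring_of_type_algebra :: complex ring) = UNIV"
  "mult (ring_of_type_algebra :: complex ring) = (*)"
  "one (ring_of_type_algebra :: complex ring) = 1"
  "zero (ring_of_type_algebra :: complex ring) = 0"
  "add (ring_of_type_algebra :: complex ring) = (+)"
  by (simp_all add: ring_of_type_algebra_def)

text \<open>
The discriminant argument behind the Cauchy-Schwarz inequality, isolated because it is needed
for inner products, for semidefinite kernel forms, and for the Euler equation in the Riesz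
representation theorem (there with \<open>a = 0\<close>).
\<close>

lemma quadratic_form_imp_cmod_le:
  fixes w :: complex and a b :: real
  assumes "\<And>z. 0 \<le> a + 2 * Re (z * w) + (cmod z)\<^sup>2 * b" and "0 \<le> a" and "0 \<le> b"
  shows "cmod w \<le> sqrt a * sqrt b"
proof (cases "b = 0")
  case True
  have "w = 0"
  proof (rule ccontr)
    assume "w \<noteq> 0"
    then have pos: "(cmod w)\<^sup>2 > 0" by simp
    have "Re (complex_of_real (- (a + 1) / (cmod w)\<^sup>2) * cnj w * w) = - (a + 1)"
      using \<open>w \<noteq> 0\<close> by (simp add: mult.assoc complex_norm_square[symmetric] mult.commute[of "cnj w"]
        power2_eq_square)
    from assms(1)[of "complex_of_real (- (a + 1) / (cmod w)\<^sup>2) * cnj w", unfolded this True]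
    show False using \<open>0 \<le> a\<close> by simp
  qed
  with assms show ?thesis by simp
next
  case False
  with assms have b: "b > 0" by simp
  let ?z = "complex_of_real (- 1 / b) * cnj w"
  have "?z * w = complex_of_real (- 1 / b * (cmod w)\<^sup>2)"
    by (simp add: complex_norm_square[symmetric] mult.commute[of _ w])
  then have 1: "Re (?z * w) = - ((cmod w)\<^sup>2 / b)" 
    by (metis Re_complex_of_real minus_divide_left mult_minus1 times_divide_eq_left)
  have 2: "(cmod ?z)\<^sup>2 * b = (cmod w)\<^sup>2 / b"
    using b by (simp add: norm_mult norm_divide power_divide power2_eq_square)
  from assms(1)[of ?z] have "(cmod w)\<^sup>2 / b \<le> a" unfolding 1 2 by simp
  then have "(cmod w)\<^sup>2 \<le> a * b" using b by (simp add: field_simps)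
  then have "cmod w \<le> sqrt (a * b)" by (simp add: real_le_rsqrt)
  then show ?thesis by (simp add: real_sqrt_mult)
qed

text \<open>
The axioms of a Hilbert space without completeness. They are separated so that the metric facts
below are available while the completeness of a newly constructed space is being proved.
\<close>

locale complex_pre_hilbert_space =
  Module.module "ring_of_type_algebra :: complex ring" H for H :: "'a hilbert" (structure) +
  assumes inner_prod_add:
      "\<lbrakk>x \<in> carrier H; y \<in> carrier H; z \<in> carrier H\<rbrakk> \<Longrightarrow>
        ip H (x \<oplus> y) z = ip H x z + ip H y z"
    and inner_prod_smult:
      "\<lbrakk>x \<in> carrier H; y \<in> carrier H\<rbrakk> \<Longrightarrow>
        ip H (a \<odot> x) y = a * ip H x y"
    and inner_prod_commute:
      "\<lbrakk>x \<in> carrier H; y \<in> carrier H\<rbrakk> \<Longrightarrow>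
        ip H x y = cnj (ip H y x)"
    and inner_prod_nonneg:
      "x \<in> carrier H \<Longrightarrow> ip H x x \<in> \<real>\<^sub>\<ge>\<^sub>0"
    and inner_prod_definite:
      "\<lbrakk>x \<in> carrier H; ip H x x = 0\<rbrakk> \<Longrightarrow> x = \<zero>"
begin

lemma smult_carrier [simp, intro]: "x \<in> carrier H \<Longrightarrow> a \<odot> x \<in> carrier H"
  by (rule smult_closed) simp_all

lemma inner_zero_left [simp]: "y \<in> carrier H \<Longrightarrow> ip H \<zero> y = 0"
  using inner_prod_add[of \<zero> \<zero> y] by simp

lemma inner_zero_right [simp]: "y \<in> carrier H \<Longrightarrow> ip H y \<zero> = 0"
  using inner_prod_commute[of y \<zero>] by simp

lemma inner_add_right:
  "\<lbrakk>x \<in> carrier H; y \<in> carrier H; z \<in> carrier H\<rbrakk> \<Longrightarrow>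
    ip H x (y \<oplus> z) = ip H x y + ip H x z"
  using inner_prod_commute[of x "y \<oplus> z"] inner_prod_add[of y z x] inner_prod_commute[of x y]
    inner_prod_commute[of x z] by simp

lemma inner_smult_right:
  "\<lbrakk>x \<in> carrier H; y \<in> carrier H\<rbrakk> \<Longrightarrow> ip H x (a \<odot> y) = cnj a * ip H x y"
  using inner_prod_commute[of x "a \<odot> y"] inner_prod_smult[of y x a] inner_prod_commute[of x y]
  by simp

lemma inner_uminus_left:
  "\<lbrakk>x \<in> carrier H; y \<in> carrier H\<rbrakk> \<Longrightarrow> ip H (\<ominus> x) y = - ip H x y"
  using inner_prod_add[of "\<ominus> x" x y] by (simp add: l_neg add_eq_0_iff)

lemma inner_uminus_right:
  "\<lbrakk>x \<in> carrier H; y \<in> carrier H\<rbrakk> \<Longrightarrow> ip H x (\<ominus> y) = - ip H x y"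
  using inner_add_right[of x "\<ominus> y" y] by (simp add: l_neg add_eq_0_iff)

lemma inner_diff_left:
  "\<lbrakk>x \<in> carrier H; y \<in> carrier H; z \<in> carrier H\<rbrakk> \<Longrightarrow>
    ip H (x \<ominus> y) z = ip H x z - ip H y z"
  by (simp add: a_minus_def inner_prod_add inner_uminus_left)

lemma inner_diff_right:
  "\<lbrakk>x \<in> carrier H; y \<in> carrier H; z \<in> carrier H\<rbrakk> \<Longrightarrow>
    ip H x (y \<ominus> z) = ip H x y - ip H x z"
  by (simp add: a_minus_def inner_add_right inner_uminus_right)

lemmas inner_simps = inner_prod_add inner_add_right inner_prod_smult inner_smult_right
  inner_uminus_left inner_uminus_right inner_diff_left inner_diff_right

lemma inner_finsum_left:
  assumes "finite A" "\<And>i. i \<in> A \<Longrightarrow> f i \<in> carrier H" "y \<in> carrier H"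
  shows "ip H (\<Oplus>i\<in>A. f i) y = (\<Sum>i\<in>A. ip H (f i) y)"
  using assms
proof (induction A rule: finite_induct)
  case (insert a A)
  then have "f \<in> A \<rightarrow> carrier H" "f a \<in> carrier H" by auto
  with insert show ?case by (simp add: inner_prod_add)
qed simp

lemma minus_carrier [simp, intro]: "\<lbrakk>x \<in> carrier H; y \<in> carrier H\<rbrakk> \<Longrightarrow> x \<ominus> y \<in> carrier H"
  by (simp add: a_minus_def)

lemma inner_self: "x \<in> carrier H \<Longrightarrow> ip H x x = complex_of_real ((hnorm H x)\<^sup>2)"
  using inner_prod_nonneg[of x] by (auto simp: hnorm_def complex_nonneg_Reals_iff complex_eq_iff)

lemma hnorm_nonneg [simp]: "x \<in> carrier H \<Longrightarrow> 0 \<le> hnorm H x"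
  using inner_prod_nonneg[of x] by (auto simp: hnorm_def complex_nonneg_Reals_iff)

lemma hnorm_square: "x \<in> carrier H \<Longrightarrow> (hnorm H x)\<^sup>2 = Re (ip H x x)"
  by (simp add: inner_self)

lemma hnorm_zero [simp]: "hnorm H \<zero> = 0"
  by (simp add: hnorm_def)

lemma hnorm_eq_0_iff: "x \<in> carrier H \<Longrightarrow> hnorm H x = 0 \<longleftrightarrow> x = \<zero>"
  using inner_prod_definite[of x] inner_self[of x] by (metis hnorm_zero of_real_0 zero_power2)

lemma minus_eq_zero_imp_eq: "\<lbrakk>x \<in> carrier H; y \<in> carrier H; x \<ominus> y = \<zero>\<rbrakk> \<Longrightarrow> x = y"
  by (metis a_minus_def add.inv_closed local.minus_minus minus_equality)

lemma inner_ext: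
  assumes "x \<in> carrier H" "y \<in> carrier H"
    and "\<And>z. z \<in> carrier H \<Longrightarrow> ip H x z = ip H y z"
  shows "x = y"
proof -
  have "ip H (x \<ominus> y) (x \<ominus> y) = 0"
    using assms by (simp add: inner_diff_left)
  then show ?thesis
    using assms inner_prod_definite[of "x \<ominus> y"] minus_eq_zero_imp_eq[of x y] by simp
qed

lemma inner_ext_right:
  assumes "x \<in> carrier H" "y \<in> carrier H"
    and "\<And>z. z \<in> carrier H \<Longrightarrow> ip H z x = ip H z y"
  shows "x = y"
proof (rule inner_ext)
  fix z assume z: "z \<in> carrier H"
  show "ip H x z = ip H y z"
    using inner_prod_commute[OF assms(1) z] inner_prod_commute[OF assms(2) z] assms(3)[OF z] by simp
qed (fact assms)+

lemma hnorm_square_add_smult: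
  assumes "x \<in> carrier H" "y \<in> carrier H"
  shows "(hnorm H (x \<oplus> z \<odot> y))\<^sup>2
    = (hnorm H x)\<^sup>2 + 2 * Re (cnj z * ip H x y) + (cmod z)\<^sup>2 * (hnorm H y)\<^sup>2"
proof -
  have "complex_of_real ((hnorm H (x \<oplus> z \<odot> y))\<^sup>2) = complex_of_real ((hnorm H x)\<^sup>2)
    + (cnj z * ip H x y + cnj (cnj z * ip H x y))
      + z * cnj z * complex_of_real ((hnorm H y)\<^sup>2)"
    using assms inner_prod_commute[of y x]
    by (simp add: inner_self[symmetric] inner_simps algebra_simps del: of_real_power)
  also have "\<dots> = complex_of_real ((hnorm H x)\<^sup>2 + 2 * Re (cnj z * ip H x y)
      + (cmod z)\<^sup>2 * (hnorm H y)\<^sup>2)"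
    by (simp only: complex_add_cnj complex_norm_square[symmetric]) simp
  finally show ?thesis by (simp only: of_real_eq_iff)
qed

lemma cauchy_schwarz:
  assumes "x \<in> carrier H" "y \<in> carrier H"
  shows "cmod (ip H x y) \<le> hnorm H x * hnorm H y"
proof -
  have "cmod (ip H x y) \<le> sqrt ((hnorm H x)\<^sup>2) * sqrt ((hnorm H y)\<^sup>2)"
  proof (rule quadratic_form_imp_cmod_le)
    fix z
    show "0 \<le> (hnorm H x)\<^sup>2 + 2 * Re (z * ip H x y) + (cmod z)\<^sup>2 * (hnorm H y)\<^sup>2"
      using hnorm_square_add_smult[OF assms, of "cnj z"]
      by (metis complex_cnj_cnj complex_mod_cnj zero_le_power2)
  qed simp_all
  with assms show ?thesis by simp
qed

lemma hnorm_smult: "x \<in> carrier H \<Longrightarrow> hnorm H (a \<odot> x) = cmod a * hnorm H x"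
proof -
  assume x: "x \<in> carrier H"
  have "(hnorm H (a \<odot> x))\<^sup>2 = (cmod a * hnorm H x)\<^sup>2"
    using hnorm_square_add_smult[of \<zero> x a] x by (simp add: power_mult_distrib)
  then show ?thesis using x by (simp add: power2_eq_iff_nonneg)
qed

lemma hnorm_triangle:
  assumes "x \<in> carrier H" "y \<in> carrier H"
  shows "hnorm H (x \<oplus> y) \<le> hnorm H x + hnorm H y"
proof (rule power2_le_imp_le)
  have "(hnorm H (x \<oplus> y))\<^sup>2 = (hnorm H x)\<^sup>2 + 2 * Re (ip H x y) + (hnorm H y)\<^sup>2"
    using hnorm_square_add_smult[OF assms, of 1] smult_one[OF assms(2)] by simp
  also have "\<dots> \<le> (hnorm H x + hnorm H y)\<^sup>2"
    using cauchy_schwarz[OF assms] complex_Re_le_cmod[of "ip H x y"]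
    by (simp add: power2_sum)
  finally show "(hnorm H (x \<oplus> y))\<^sup>2 \<le> (hnorm H x + hnorm H y)\<^sup>2" .
qed (use assms in simp)

lemma hnorm_minus_commute:
  assumes "x \<in> carrier H" "y \<in> carrier H"
  shows "hnorm H (x \<ominus> y) = hnorm H (y \<ominus> x)"
  using assms by (simp add: hnorm_def inner_simps)

lemma hnorm_triangle_minus:
  assumes "x \<in> carrier H" "y \<in> carrier H" "z \<in> carrier H"
  shows "hnorm H (x \<ominus> z) \<le> hnorm H (x \<ominus> y) + hnorm H (y \<ominus> z)"
proof -
  have "x \<ominus> z = (x \<ominus> y) \<oplus> (y \<ominus> z)"
    using assms by (intro inner_ext) (simp_all add: inner_simps)
  then show ?thesis using assms hnorm_triangle[of "x \<ominus> y" "y \<ominus> z"] by simp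
qed

lemma parallelogram_midpoint:
  assumes "x \<in> carrier H" "y \<in> carrier H"
  shows "(hnorm H (x \<ominus> y))\<^sup>2
    = 2 * (hnorm H x)\<^sup>2 + 2 * (hnorm H y)\<^sup>2 - 4 * (hnorm H ((1/2) \<odot> (x \<oplus> y)))\<^sup>2"
  using assms by (simp add: hnorm_square inner_simps algebra_simps)

lemma Metric_space_hdist:
  "Metric_space (carrier H) (\<lambda>x y. if x \<in> carrier H \<and> y \<in> carrier H then hdist H x y else 0)"
proof
  fix x y z
  show "0 \<le> (if x \<in> carrier H \<and> y \<in> carrier H then hdist H x y else 0)"
    by (simp add: hdist_def)
  show "(if x \<in> carrier H \<and> y \<in> carrier H then hdist H x y else 0)
      = (if y \<in> carrier H \<and> x \<in> carrier H then hdist H y x else 0)"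
    using hnorm_minus_commute[of x y] by (simp add: hdist_def)
  show "((if x \<in> carrier H \<and> y \<in> carrier H then hdist H x y else 0) = 0) = (x = y)"
    if "x \<in> carrier H" "y \<in> carrier H"
    using that minus_eq_zero_imp_eq[of x y]
    by (auto simp: hdist_def hnorm_eq_0_iff a_minus_def r_neg)
  show "(if x \<in> carrier H \<and> z \<in> carrier H then hdist H x z else 0)
      \<le> (if x \<in> carrier H \<and> y \<in> carrier H then hdist H x y else 0)
        + (if y \<in> carrier H \<and> z \<in> carrier H then hdist H y z else 0)"
    if "x \<in> carrier H" "y \<in> carrier H" "z \<in> carrier H"
    using that hnorm_triangle_minus[of x y z] by (simp add: hdist_def)
qed

text \<open>
Completeness in terms of norms of differences, free of the cut-off in the metric.
\<close>

lemma mcomplete_iff_Cauchy_convergent: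
  "Metric_space.mcomplete (carrier H)
      (\<lambda>x y. if x \<in> carrier H \<and> y \<in> carrier H then hdist H x y else 0)
    \<longleftrightarrow> (\<forall>s. (\<forall>n. s n \<in> carrier H) \<longrightarrow>
          (\<forall>e>0. \<exists>N. \<forall>m\<ge>N. \<forall>n\<ge>N. hnorm H (s m \<ominus> s n) < e) \<longrightarrow>
          (\<exists>l\<in>carrier H. (\<lambda>n. hnorm H (s n \<ominus> l)) \<longlonglongrightarrow> 0))"
proof -
  interpret M: Metric_space "carrier H"
    "\<lambda>x y. if x \<in> carrier H \<and> y \<in> carrier H then hdist H x y else 0"
    by (rule Metric_space_hdist)
  have C: "M.MCauchy s \<longleftrightarrow> (\<forall>n. s n \<in> carrier H) \<and>
      (\<forall>e>0. \<exists>N. \<forall>m\<ge>N. \<forall>n\<ge>N. hnorm H (s m \<ominus> s n) < e)" for s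
  proof (cases "\<forall>n. s n \<in> carrier H")
    case True
    then show ?thesis unfolding M.MCauchy_def by (auto simp: hdist_def)
  next
    case False
    then show ?thesis unfolding M.MCauchy_def by auto
  qed
  have L: "limitin M.mtopology s l sequentially \<longleftrightarrow>
      l \<in> carrier H \<and> (\<lambda>n. hnorm H (s n \<ominus> l)) \<longlonglongrightarrow> 0" if "\<forall>n. s n \<in> carrier H" for s l
    using that by (auto simp: M.limitin_metric_dist_null hdist_def cong: conj_cong)
  show ?thesis
    unfolding M.mcomplete_def C Bex_def using L by (simp add: imp_conjL cong: imp_cong)
qed

end

context complex_hilbert_space
begin

sublocale complex_pre_hilbert_space H
  by unfold_locales
    (fact inner_prod_add inner_prod_smult inner_prod_commute inner_prod_nonneg
      inner_prod_definite)+

lemma Cauchy_imp_convergent: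
  assumes "\<And>n. s n \<in> carrier H"
    and "\<And>e. e > 0 \<Longrightarrow> \<exists>N. \<forall>m\<ge>N. \<forall>n\<ge>N. hnorm H (s m \<ominus> s n) < e"
  obtains l where "l \<in> carrier H" "(\<lambda>n. hnorm H (s n \<ominus> l)) \<longlonglongrightarrow> 0"
  using complete assms unfolding mcomplete_iff_Cauchy_convergent by blast

text \<open>
The representing vector minimizes \<open>J x = \<parallel>x\<parallel>\<^sup>2 - 2 Re (f x)\<close>: \<open>J\<close> is bounded below because \<open>f\<close>
is bounded, minimizing sequences are Cauchy by the parallelogram law, and the first variation of
\<open>J\<close> at its minimum is the representation.
\<close>

theorem riesz_representation:
  fixes f :: "'a \<Rightarrow> complex"
  assumes add: "\<And>x y. \<lbrakk>x \<in> carrier H; y \<in> carrier H\<rbrakk> \<Longrightarrow> f (x \<oplus> y) = f x + f y"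
    and smult: "\<And>a x. x \<in> carrier H \<Longrightarrow> f (a \<odot> x) = a * f x"
    and bound: "\<And>x. x \<in> carrier H \<Longrightarrow> cmod (f x) \<le> M * hnorm H x"
  obtains z where "z \<in> carrier H" "\<And>x. x \<in> carrier H \<Longrightarrow> f x = ip H x z"
proof -
  define J where "J x = (hnorm H x)\<^sup>2 - 2 * Re (f x)" for x
  have J_ge: "J x \<ge> - M\<^sup>2" if "x \<in> carrier H" for x
  proof -
    have "Re (f x) \<le> M * hnorm H x"
      using bound[OF that] complex_Re_le_cmod[of "f x"] by linarith
    moreover have "0 \<le> (hnorm H x - M)\<^sup>2" by simp
    ultimately show ?thesis by (simp add: J_def power2_diff mult.commute)
  qed
  define m where "m = Inf (J ` carrier H)"
  have bdd: "bdd_below (J ` carrier H)" using J_ge by (meson bdd_belowI2)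
  have m_le: "m \<le> J x" if "x \<in> carrier H" for x
    unfolding m_def using bdd that by (simp add: cINF_lower)
  have "\<exists>x\<in>carrier H. J x < m + inverse (real (Suc n))" for n
  proof -
    have "Inf (J ` carrier H) < m + inverse (real (Suc n))" by (simp add: m_def)
    then show ?thesis using cInf_lessD[of "J ` carrier H"] by blast
  qed
  then obtain s where s: "\<And>n. s n \<in> carrier H" and Js: "\<And>n. J (s n) < m + inverse (real (Suc n))"
    by metis
  have dist: "(hnorm H (s i \<ominus> s j))\<^sup>2 \<le> 2 * inverse (real (Suc i)) + 2 * inverse (real (Suc j))" for i j
  proof -
    have "m \<le> J ((1/2) \<odot> (s i \<oplus> s j))" by (rule m_le) (simp add: s)
    moreover have "Re (f ((1/2) \<odot> (s i \<oplus> s j))) = (Re (f (s i)) + Re (f (s j))) / 2"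
      using s by (simp add: add smult)
    ultimately have "4 * m \<le> 4 * (hnorm H ((1/2) \<odot> (s i \<oplus> s j)))\<^sup>2 - 4 * (Re (f (s i)) + Re (f (s j)))"
      by (simp add: J_def)
    with Js[of i] Js[of j] parallelogram_midpoint[OF s s, of i j] show ?thesis
      unfolding J_def by argo
  qed
  obtain z where z: "z \<in> carrier H" and lim: "(\<lambda>n. hnorm H (s n \<ominus> z)) \<longlonglongrightarrow> 0"
  proof (rule Cauchy_imp_convergent[of s])
    fix e :: real assume "e > 0"
    then have "e\<^sup>2 / 4 > 0" by simp
    then obtain N where N: "inverse (real (Suc N)) < e\<^sup>2 / 4" using reals_Archimedean by blast
    show "\<exists>N. \<forall>m\<ge>N. \<forall>n\<ge>N. hnorm H (s m \<ominus> s n) < e"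
    proof (intro exI allI impI)
      fix i j assume "N \<le> i" "N \<le> j"
      then have "inverse (real (Suc i)) \<le> inverse (real (Suc N))"
          "inverse (real (Suc j)) \<le> inverse (real (Suc N))" by simp_all
      with dist[of i j] N have "(hnorm H (s i \<ominus> s j))\<^sup>2 < e\<^sup>2" by linarith
      then show "hnorm H (s i \<ominus> s j) < e" using \<open>e > 0\<close> power_less_imp_less_base[of _ 2 e] by simp
    qed
  qed (use s in auto)
  have f_diff: "f (x \<ominus> y) = f x - f y" if "x \<in> carrier H" "y \<in> carrier H" for x y
  proof -
    have "x \<ominus> y = x \<oplus> (-1) \<odot> y" using that by (intro inner_ext) (simp_all add: inner_simps)
    then show ?thesis using that by (simp add: add smult)
  qed
  have Jz: "J z \<le> m"
  proof -
    have ub: "(hnorm H z)\<^sup>2 - 2 * Re (f z) \<le> m + (inverse (real (Suc n))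
        + 2 * (\<bar>M\<bar> * hnorm H (s n \<ominus> z)) + 2 * hnorm H z * hnorm H (s n \<ominus> z))" for n
    proof -
      have "cmod (f (s n \<ominus> z)) \<le> \<bar>M\<bar> * hnorm H (s n \<ominus> z)"
        using bound[of "s n \<ominus> z"] mult_right_mono[OF abs_ge_self[of M], of "hnorm H (s n \<ominus> z)"] s z
        by force
      then have a: "Re (f (s n)) - Re (f z) \<le> \<bar>M\<bar> * hnorm H (s n \<ominus> z)"
        using complex_Re_le_cmod[of "f (s n \<ominus> z)"] s z by (simp add: f_diff)
      have "s n = z \<oplus> 1 \<odot> (s n \<ominus> z)"
        using s z by (intro inner_ext) (simp_all add: inner_simps)
      then have "(hnorm H (s n))\<^sup>2 = (hnorm H z)\<^sup>2 + 2 * Re (ip H z (s n \<ominus> z)) + (hnorm H (s n \<ominus> z))\<^sup>2"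
        using hnorm_square_add_smult[of z "s n \<ominus> z" 1] s z by simp
      moreover have "\<bar>Re (ip H z (s n \<ominus> z))\<bar> \<le> hnorm H z * hnorm H (s n \<ominus> z)"
        using cauchy_schwarz[of z "s n \<ominus> z"] abs_Re_le_cmod[of "ip H z (s n \<ominus> z)"] s z by simp
      ultimately have "(hnorm H z)\<^sup>2 \<le> (hnorm H (s n))\<^sup>2 + 2 * (hnorm H z * hnorm H (s n \<ominus> z))"
        using zero_le_power2[of "hnorm H (s n \<ominus> z)"] by linarith
      with a Js[of n] show ?thesis unfolding J_def by linarith
    qed
    have "(\<lambda>n. m + (inverse (real (Suc n)) + 2 * (\<bar>M\<bar> * hnorm H (s n \<ominus> z))
      + 2 * hnorm H z * hnorm H (s n \<ominus> z))) \<longlonglongrightarrow> m + (0 + 2 * (\<bar>M\<bar> * 0) + 2 * hnorm H z * 0)"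
      by (intro tendsto_intros lim LIMSEQ_inverse_real_of_nat)
    then have "(\<lambda>n. m + (inverse (real (Suc n)) + 2 * (\<bar>M\<bar> * hnorm H (s n \<ominus> z))
      + 2 * hnorm H z * hnorm H (s n \<ominus> z))) \<longlonglongrightarrow> m" by simp
    then show ?thesis unfolding J_def using ub by (intro LIMSEQ_le_const) auto
  qed
  have "f x = ip H x z" if x: "x \<in> carrier H" for x
  proof -
    \<comment> \<open>\<open>2 Re (t w)\<close> is the first variation of \<open>J\<close> at \<open>z\<close> in the direction \<open>cnj t \<odot> x\<close>\<close>
    define w where "w = cnj (ip H x z - f x)"
    have "cmod w \<le> sqrt 0 * sqrt ((hnorm H x)\<^sup>2)"
    proof (rule quadratic_form_imp_cmod_le)
      fix t :: complex
      have "J z \<le> J (z \<oplus> cnj t \<odot> x)" using Jz m_le[of "z \<oplus> cnj t \<odot> x"] x z by simp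
      also have "\<dots> = J z + 2 * Re (t * ip H z x) + (cmod t)\<^sup>2 * (hnorm H x)\<^sup>2 - 2 * Re (cnj t * f x)"
        unfolding J_def hnorm_square_add_smult[OF z x] using x z by (simp add: add smult)
      also have "Re (t * ip H z x) = Re (cnj t * ip H x z)"
        using inner_prod_commute[OF z x] by simp
      finally show "0 \<le> 0 + 2 * Re (t * w) + (cmod t)\<^sup>2 * (hnorm H x)\<^sup>2"
        unfolding w_def by (simp add: algebra_simps)
    qed simp_all
    then show ?thesis by (simp add: w_def)
  qed
  with z that show thesis by blast
qed

end

section \<open>Bounded operators and isometries\<close>

lemma bounded_opI:
  assumes "\<And>x. x \<in> carrier H \<Longrightarrow> A x \<in> carrier K"
    and "\<And>x y. \<lbrakk>x \<in> carrier H; y \<in> carrier H\<rbrakk> \<Longrightarrow> A (x \<oplus>\<^bsub>H\<^esub> y) = A x \<oplus>\<^bsub>K\<^esub> A y"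
    and "\<And>a x. x \<in> carrier H \<Longrightarrow> A (a \<odot>\<^bsub>H\<^esub> x) = a \<odot>\<^bsub>K\<^esub> A x"
    and "\<And>x. x \<in> carrier H \<Longrightarrow> hnorm K (A x) \<le> M * hnorm H x"
  shows "bounded_op H K A"
  unfolding bounded_op_def by (intro conjI Pi_I ballI allI exI[of _ M] assms)

lemma bounded_opD:
  assumes "bounded_op H K A"
  shows "x \<in> carrier H \<Longrightarrow> A x \<in> carrier K"
    and "\<lbrakk>x \<in> carrier H; y \<in> carrier H\<rbrakk> \<Longrightarrow> A (x \<oplus>\<^bsub>H\<^esub> y) = A x \<oplus>\<^bsub>K\<^esub> A y"
    and "x \<in> carrier H \<Longrightarrow> A (a \<odot>\<^bsub>H\<^esub> x) = a \<odot>\<^bsub>K\<^esub> A x"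
  using assms by (auto simp: bounded_op_def)

lemma bounded_op_bound:
  assumes "complex_hilbert_space H" "bounded_op H K A"
  obtains M where "M \<ge> 0" "\<And>x. x \<in> carrier H \<Longrightarrow> hnorm K (A x) \<le> M * hnorm H x"
proof -
  interpret complex_hilbert_space H by fact
  from assms obtain M where M: "\<And>x. x \<in> carrier H \<Longrightarrow> hnorm K (A x) \<le> M * hnorm H x"
    unfolding bounded_op_def by blast
  have "hnorm K (A x) \<le> \<bar>M\<bar> * hnorm H x" if "x \<in> carrier H" for x
    using M[OF that] mult_right_mono[OF abs_ge_self[of M], of "hnorm H x"] that by force
  then show thesis using that[of "\<bar>M\<bar>"] by simp
qed

lemma adj_eqI:
  assumes "complex_hilbert_space H" "z \<in> carrier H"
    and "\<And>x. x \<in> carrier H \<Longrightarrow> ip K (A x) y = ip H x z"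
  shows "adj H K A y = z"
proof -
  interpret complex_hilbert_space H by fact
  show ?thesis unfolding adj_def
  proof (rule the_equality)
    fix z' assume "z' \<in> carrier H \<and> (\<forall>x\<in>carrier H. ip K (A x) y = ip H x z')"
    then show "z' = z" using assms by (intro inner_ext_right) auto
  qed (use assms in auto)
qed

text \<open>
The definite description in \<open>adj\<close> denotes because of the Riesz representation.
\<close>

lemma adj_carrier_inner:
  assumes H: "complex_hilbert_space H" and K: "complex_hilbert_space K"
    and A: "bounded_op H K A" and y: "y \<in> carrier K"
  shows "adj H K A y \<in> carrier H"
    and "x \<in> carrier H \<Longrightarrow> ip K (A x) y = ip H x (adj H K A y)"
proof -
  interpret H: complex_hilbert_space H by fact
  interpret K: complex_hilbert_space K by fact
  obtain M where "M \<ge> 0" and M: "\<And>x. x \<in> carrier H \<Longrightarrow> hnorm K (A x) \<le> M * hnorm H x"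
    using bounded_op_bound[OF H A] by blast
  obtain z where z: "z \<in> carrier H" "\<And>x. x \<in> carrier H \<Longrightarrow> ip K (A x) y = ip H x z"
  proof (rule H.riesz_representation[of "\<lambda>x. ip K (A x) y" "M * hnorm K y"])
    fix x assume x: "x \<in> carrier H"
    have "cmod (ip K (A x) y) \<le> hnorm K (A x) * hnorm K y"
      using x y bounded_opD[OF A] by (intro K.cauchy_schwarz) auto
    also have "\<dots> \<le> (M * hnorm H x) * hnorm K y"
      using M[OF x] y by (intro mult_right_mono) auto
    finally show "cmod (ip K (A x) y) \<le> M * hnorm K y * hnorm H x" by (simp add: ac_simps)
  qed (use bounded_opD[OF A] y in \<open>auto simp: K.inner_simps\<close>)
  have eq: "adj H K A y = z" by (rule adj_eqI[OF H z])
  show "adj H K A y \<in> carrier H" unfolding eq by (rule z(1))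
  show "ip K (A x) y = ip H x (adj H K A y)" if "x \<in> carrier H"
    unfolding eq by (rule z(2)[OF that])
qed

lemma hilbert_sum_simps [simp]:
  "carrier (F \<oplus>\<^sub>H G) = carrier F \<times> carrier G"
  "add (F \<oplus>\<^sub>H G) p q = (fst p \<oplus>\<^bsub>F\<^esub> fst q, snd p \<oplus>\<^bsub>G\<^esub> snd q)"
  "smult (F \<oplus>\<^sub>H G) a p = (a \<odot>\<^bsub>F\<^esub> fst p, a \<odot>\<^bsub>G\<^esub> snd p)"
  "inner_prod (F \<oplus>\<^sub>H G) p q = ip F (fst p) (fst q) + ip G (snd p) (snd q)"
  by (simp_all add: hilbert_sum_def)

lemma bounded_op_add:
  assumes H: "complex_hilbert_space H" and K: "complex_hilbert_space K"
    and A: "bounded_op H K A" and B: "bounded_op H K B"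
  shows "bounded_op H K (\<lambda>x. A x \<oplus>\<^bsub>K\<^esub> B x)"
proof -
  interpret H: complex_hilbert_space H by fact
  interpret K: complex_hilbert_space K by fact
  note AD = bounded_opD[OF A] and BD = bounded_opD[OF B]
  obtain M where M: "\<And>x. x \<in> carrier H \<Longrightarrow> hnorm K (A x) \<le> M * hnorm H x"
    using bounded_op_bound[OF H A] by blast
  obtain N where N: "\<And>x. x \<in> carrier H \<Longrightarrow> hnorm K (B x) \<le> N * hnorm H x"
    using bounded_op_bound[OF H B] by blast
  have bound: "hnorm K (A x \<oplus>\<^bsub>K\<^esub> B x) \<le> (M + N) * hnorm H x" if x: "x \<in> carrier H" for x
    using K.hnorm_triangle[OF AD(1)[OF x] BD(1)[OF x]] M[OF x] N[OF x]
    by (simp add: distrib_right)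
  have add: "A (x \<oplus>\<^bsub>H\<^esub> y) \<oplus>\<^bsub>K\<^esub> B (x \<oplus>\<^bsub>H\<^esub> y) = A x \<oplus>\<^bsub>K\<^esub> B x \<oplus>\<^bsub>K\<^esub> (A y \<oplus>\<^bsub>K\<^esub> B y)"
    if "x \<in> carrier H" "y \<in> carrier H" for x y
    using that by (intro K.inner_ext) (simp_all add: AD BD K.inner_simps)
  have smult: "A (a \<odot>\<^bsub>H\<^esub> x) \<oplus>\<^bsub>K\<^esub> B (a \<odot>\<^bsub>H\<^esub> x) = a \<odot>\<^bsub>K\<^esub> (A x \<oplus>\<^bsub>K\<^esub> B x)"
    if "x \<in> carrier H" for x a
    using that by (intro K.inner_ext) (simp_all add: AD BD K.inner_simps algebra_simps)
  have closed: "A x \<oplus>\<^bsub>K\<^esub> B x \<in> carrier K" if "x \<in> carrier H" for x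
    using that by (simp add: AD BD)
  show ?thesis by (rule bounded_opI[OF closed add smult bound])
qed

lemma bounded_op_smult:
  assumes H: "complex_hilbert_space H" and K: "complex_hilbert_space K"
    and A: "bounded_op H K A"
  shows "bounded_op H K (\<lambda>x. a \<odot>\<^bsub>K\<^esub> A x)"
proof -
  interpret H: complex_hilbert_space H by fact
  interpret K: complex_hilbert_space K by fact
  note AD = bounded_opD[OF A]
  obtain M where M: "\<And>x. x \<in> carrier H \<Longrightarrow> hnorm K (A x) \<le> M * hnorm H x"
    using bounded_op_bound[OF H A] by blast
  have bound: "hnorm K (a \<odot>\<^bsub>K\<^esub> A x) \<le> (cmod a * M) * hnorm H x" if x: "x \<in> carrier H" for x
    using mult_left_mono[OF M[OF x], of "cmod a"] AD(1)[OF x] by (simp add: K.hnorm_smult mult.assoc)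
  have add: "a \<odot>\<^bsub>K\<^esub> A (x \<oplus>\<^bsub>H\<^esub> y) = a \<odot>\<^bsub>K\<^esub> A x \<oplus>\<^bsub>K\<^esub> a \<odot>\<^bsub>K\<^esub> A y"
    if "x \<in> carrier H" "y \<in> carrier H" for x y
    using that by (intro K.inner_ext) (simp_all add: AD K.inner_simps algebra_simps)
  have smult: "a \<odot>\<^bsub>K\<^esub> A (b \<odot>\<^bsub>H\<^esub> x) = b \<odot>\<^bsub>K\<^esub> (a \<odot>\<^bsub>K\<^esub> A x)"
    if "x \<in> carrier H" for x b
    using that by (intro K.inner_ext) (simp_all add: AD K.inner_simps algebra_simps)
  have closed: "a \<odot>\<^bsub>K\<^esub> A x \<in> carrier K" if "x \<in> carrier H" for x
    using that by (simp add: AD)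
  show ?thesis by (rule bounded_opI[OF closed add smult bound])
qed

lemma isometry_opD:
  assumes "isometry_op H K V"
  shows "bounded_op H K V" "x \<in> carrier H \<Longrightarrow> hnorm K (V x) = hnorm H x"
  using assms by (auto simp: isometry_op_def)

text \<open>
Polarization: the scalars being complex, a sesquilinear form is determined by its diagonal.
\<close>

lemma (in complex_pre_hilbert_space) sesquilinear_eq_0:
  assumes add1: "\<And>x y z. \<lbrakk>x \<in> carrier H; y \<in> carrier H; z \<in> carrier H\<rbrakk> \<Longrightarrow> s (x \<oplus> y) z = s x z + s y z"
    and add2: "\<And>x y z. \<lbrakk>x \<in> carrier H; y \<in> carrier H; z \<in> carrier H\<rbrakk> \<Longrightarrow> s x (y \<oplus> z) = s x y + s x z"
    and smult1: "\<And>a x y. \<lbrakk>x \<in> carrier H; y \<in> carrier H\<rbrakk> \<Longrightarrow> s (a \<odot> x) y = a * s x y"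
    and smult2: "\<And>a x y. \<lbrakk>x \<in> carrier H; y \<in> carrier H\<rbrakk> \<Longrightarrow> s x (a \<odot> y) = cnj a * s x y"
    and diag: "\<And>x. x \<in> carrier H \<Longrightarrow> s x x = 0"
    and x: "x \<in> carrier H" and y: "y \<in> carrier H"
  shows "s x y = (0 :: complex)"
proof -
  have 1: "s x y + s y x = 0"
    using diag[of "x \<oplus> y"] x y diag[of x] diag[of y] by (simp add: add1 add2 add.commute)
  have "\<i> * (s y x - s x y) = 0"
    using diag[of "x \<oplus> \<i> \<odot> y"] x y diag[of x] diag[of y]
    by (simp add: add1 add2 smult1 smult2 right_diff_distrib)
  then have "s y x = s x y" by simp
  with 1 show ?thesis by simp
qed

lemma isometry_op_inner:
  assumes H: "complex_hilbert_space H" and K: "complex_hilbert_space K"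
    and V: "isometry_op H K V" and x: "x \<in> carrier H" and y: "y \<in> carrier H"
  shows "ip K (V x) (V y) = ip H x y"
proof -
  interpret H: complex_hilbert_space H by fact
  interpret K: complex_hilbert_space K by fact
  note b = bounded_opD[OF isometry_opD(1)[OF V]]
  have "ip K (V x) (V y) - ip H x y = 0"
  proof (rule H.sesquilinear_eq_0[of "\<lambda>x y. ip K (V x) (V y) - ip H x y"])
    fix x assume x: "x \<in> carrier H"
    then show "ip K (V x) (V x) - ip H x x = 0"
      using isometry_opD(2)[OF V x] b(1) by (simp add: H.inner_self K.inner_self)
  qed (use x y in \<open>auto simp: b H.inner_simps K.inner_simps algebra_simps\<close>)
  then show ?thesis by simp
qed

lemma bounded_op_funpow_carrier:
  assumes "bounded_op H H T" "x \<in> carrier H"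
  shows "(T ^^ n) x \<in> carrier H"
  using assms(2) by (induction n) (auto intro: bounded_opD(1)[OF assms(1)])

section \<open>Orthonormal sets\<close>

definition orthonormal_set :: "'a hilbert \<Rightarrow> 'a set \<Rightarrow> bool" where
  "orthonormal_set H E \<longleftrightarrow>
    E \<subseteq> carrier H \<and> (\<forall>e\<in>E. \<forall>f\<in>E. ip H e f = (if e = f then 1 else 0))"

text \<open>
The closed linear span, encoded as the double orthogonal complement; in this form neither finite
linear combinations nor limits have to be handled.
\<close>

definition closed_span :: "'a hilbert \<Rightarrow> 'a set \<Rightarrow> 'a set" where
  "closed_span H E = {u \<in> carrier H.
    \<forall>z\<in>carrier H. (\<forall>e\<in>E. ip H z e = 0) \<longrightarrow> ip H z u = 0}"

lemma orthonormal_setD: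
  assumes "orthonormal_set H E"
  shows "e \<in> E \<Longrightarrow> e \<in> carrier H"
    and "\<lbrakk>e \<in> E; f \<in> E\<rbrakk> \<Longrightarrow> ip H e f = (if e = f then 1 else 0)"
  using assms by (auto simp: orthonormal_set_def)

lemma orthonormal_set_subset: "\<lbrakk>orthonormal_set H E; D \<subseteq> E\<rbrakk> \<Longrightarrow> orthonormal_set H D"
  unfolding orthonormal_set_def by (meson subset_eq)

lemma has_sum_zero_imp_eq: "((\<lambda>e. 0 :: complex) has_sum a) E \<Longrightarrow> a = 0"
  using has_sum_unique[of "\<lambda>e. 0" E a 0] has_sum_0[of E "\<lambda>e. 0"] by blast

lemma has_sum_Kronecker:
  fixes f :: "'a \<Rightarrow> complex"
  assumes "e \<in> E" "\<And>d. \<lbrakk>d \<in> E; d \<noteq> e\<rbrakk> \<Longrightarrow> f d = 0"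
  shows "(f has_sum f e) E"
proof -
  have "(f has_sum (\<Sum>d\<in>{e}. f d)) {e}" by (rule has_sum_finite) simp
  then show ?thesis
    using has_sum_cong_neutral[of "{e}" E f f "f e"] assms by auto
qed

context complex_hilbert_space
begin

lemma inner_eq_0_commute:
  "\<lbrakk>x \<in> carrier H; y \<in> carrier H\<rbrakk> \<Longrightarrow> ip H x y = 0 \<longleftrightarrow> ip H y x = 0"
  using inner_prod_commute[of x y] by auto

lemma inner_finsum_right:
  assumes "finite A" "\<And>i. i \<in> A \<Longrightarrow> f i \<in> carrier H" "y \<in> carrier H"
  shows "ip H y (\<Oplus>i\<in>A. f i) = (\<Sum>i\<in>A. ip H y (f i))"
  using assms
proof (induction A rule: finite_induct)
  case (insert a A)
  then have "f \<in> A \<rightarrow> carrier H" "f a \<in> carrier H" by auto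
  with insert show ?case by (simp add: inner_add_right)
qed simp

text \<open>
The orthogonal projection of \<open>u\<close> onto the span of a finite orthonormal set \<open>G\<close>.
\<close>

definition proj_sum :: "'a set \<Rightarrow> 'a \<Rightarrow> 'a" where
  "proj_sum G u = (\<Oplus>g\<in>G. ip H u g \<odot> g)"

lemma proj_sum:
  assumes "finite G" "orthonormal_set H G" "u \<in> carrier H"
  shows proj_sum_carrier: "proj_sum G u \<in> carrier H"
    and inner_proj_sum: "z \<in> carrier H \<Longrightarrow>
      ip H z (proj_sum G u) = (\<Sum>g\<in>G. cnj (ip H u g) * ip H z g)"
    and inner_minus_proj_sum: "g \<in> G \<Longrightarrow> ip H (u \<ominus> proj_sum G u) g = 0"
proof -
  have G: "g \<in> carrier H" if "g \<in> G" for g using orthonormal_setD(1)[OF assms(2) that] .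
  show c: "proj_sum G u \<in> carrier H"
    unfolding proj_sum_def using G assms by (intro finsum_closed) auto
  show i: "ip H z (proj_sum G u) = (\<Sum>g\<in>G. cnj (ip H u g) * ip H z g)"
    if "z \<in> carrier H" for z
    unfolding proj_sum_def using that G assms
    by (subst inner_finsum_right) (auto simp: inner_smult_right intro!: sum.cong)
  assume g: "g \<in> G"
  have "ip H g (proj_sum G u) = cnj (ip H u g)"
    using i[OF G[OF g]] g assms(1) orthonormal_setD(2)[OF assms(2) g]
    by (simp add: if_distrib cong: if_cong)
  then have "ip H (proj_sum G u) g = ip H u g"
    using inner_prod_commute[OF c G[OF g]] by simp
  then show "ip H (u \<ominus> proj_sum G u) g = 0"
    using c G[OF g] assms(3) by (simp add: inner_diff_left)
qed

lemma bessel: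
  assumes "finite G" "orthonormal_set H G" "u \<in> carrier H"
  shows "(\<Sum>g\<in>G. (cmod (ip H u g))\<^sup>2) \<le> (hnorm H u)\<^sup>2"
proof -
  let ?p = "proj_sum G u"
  have p: "?p \<in> carrier H" by (rule proj_sum_carrier[OF assms])
  have "ip H (u \<ominus> ?p) ?p = 0"
    using inner_minus_proj_sum[OF assms] inner_proj_sum[OF assms, of "u \<ominus> ?p"] p assms(3) by simp
  then have pp: "ip H u ?p = ip H ?p ?p"
    using p assms(3) by (simp add: inner_diff_left)
  have up: "ip H u ?p = complex_of_real (\<Sum>g\<in>G. (cmod (ip H u g))\<^sup>2)"
    unfolding inner_proj_sum[OF assms assms(3)]
    by (simp add: complex_norm_square mult.commute del: of_real_power)
  have "0 \<le> (hnorm H (u \<ominus> ?p))\<^sup>2" by simp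
  also have "\<dots> = Re (ip H u u - ip H u ?p - cnj (ip H u ?p) + ip H u ?p)"
    using p assms(3) pp inner_prod_commute[OF p assms(3)]
    by (simp add: hnorm_square inner_simps)
  finally show ?thesis using assms(3) by (simp add: up hnorm_square)
qed

text \<open>
The vector with prescribed square-summable coordinates along an orthonormal family. Instead of
summing a series of vectors, one sums the scalar products with a test vector; the sum is a
bounded functional of the test vector and is represented by a vector.
\<close>

lemma orthonormal_series:
  fixes a :: "'b \<Rightarrow> complex"
  assumes B: "orthonormal_set H B" and \<iota>: "inj_on \<iota> E" "\<iota> ` E \<subseteq> B"
    and bound: "\<And>G. \<lbrakk>finite G; G \<subseteq> E\<rbrakk> \<Longrightarrow> (\<Sum>e\<in>G. (cmod (a e))\<^sup>2) \<le> C\<^sup>2"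
  obtains v where "v \<in> carrier H"
    "\<And>y. y \<in> carrier H \<Longrightarrow> ((\<lambda>e. a e * ip H (\<iota> e) y) has_sum ip H v y) E"
proof -
  have \<iota>c: "\<iota> e \<in> carrier H" if "e \<in> E" for e
    using that \<iota> orthonormal_setD(1)[OF B] by blast
  let ?t = "\<lambda>y e. cnj (a e) * ip H y (\<iota> e)"
  have fin: "(\<Sum>e\<in>G. cmod (?t y e)) \<le> \<bar>C\<bar> * hnorm H y"
    if "finite G" "G \<subseteq> E" and y: "y \<in> carrier H" for y G
  proof -
    have "(\<Sum>e\<in>G. (cmod (ip H y (\<iota> e)))\<^sup>2) = (\<Sum>b\<in>\<iota> ` G. (cmod (ip H y b))\<^sup>2)"
      using \<iota>(1) that(2) by (subst sum.reindex) (auto intro: inj_on_subset)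
    also have "\<dots> \<le> (hnorm H y)\<^sup>2"
      using that \<iota>(2) by (intro bessel orthonormal_set_subset[OF B]) auto
    finally have "(\<Sum>e\<in>G. (cmod (ip H y (\<iota> e)))\<^sup>2) \<le> (hnorm H y)\<^sup>2" .
    with bound[OF that(1,2)] have "(\<Sum>e\<in>G. (cmod (a e))\<^sup>2) * (\<Sum>e\<in>G. (cmod (ip H y (\<iota> e)))\<^sup>2)
      \<le> C\<^sup>2 * (hnorm H y)\<^sup>2"
      by (intro mult_mono) (auto intro: sum_nonneg)
    with Cauchy_Schwarz_ineq_sum[of "\<lambda>e. cmod (a e)" "\<lambda>e. cmod (ip H y (\<iota> e))" G]
    have "(\<Sum>e\<in>G. cmod (a e) * cmod (ip H y (\<iota> e)))\<^sup>2 \<le> (\<bar>C\<bar> * hnorm H y)\<^sup>2"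
      by (simp add: power_mult_distrib)
    then have "(\<Sum>e\<in>G. cmod (a e) * cmod (ip H y (\<iota> e))) \<le> \<bar>C\<bar> * hnorm H y"
      by (rule power2_le_imp_le) (use y in simp)
    then show ?thesis by (simp add: norm_mult)
  qed
  have summ: "(\<lambda>e. norm (?t y e)) summable_on E" if "y \<in> carrier H" for y
    by (rule nonneg_bdd_above_summable_on) (auto intro!: bdd_aboveI2[where M="\<bar>C\<bar> * hnorm H y"] fin
      that)
  have hs: "(?t y has_sum infsum (?t y) E) E" if "y \<in> carrier H" for y
    using abs_summable_summable[OF summ[OF that]] by simp
  obtain v where v: "v \<in> carrier H" "\<And>y. y \<in> carrier H \<Longrightarrow> infsum (?t y) E = ip H y v"
  proof (rule riesz_representation[of "\<lambda>y. infsum (?t y) E" "\<bar>C\<bar>"])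
    fix x y assume x: "x \<in> carrier H" and y: "y \<in> carrier H"
    have "(?t (x \<oplus> y) has_sum (infsum (?t x) E + infsum (?t y) E)) E"
      using has_sum_add[OF hs[OF x] hs[OF y]]
      by (rule has_sum_cong[THEN iffD1, rotated]) (use x y \<iota>c in \<open>simp add: inner_prod_add
        algebra_simps\<close>)
    then show "infsum (?t (x \<oplus> y)) E = infsum (?t x) E + infsum (?t y) E" by (rule infsumI)
  next
    fix b x assume x: "x \<in> carrier H"
    have "(?t (b \<odot> x) has_sum (b * infsum (?t x) E)) E"
      using has_sum_cmult_right[OF hs[OF x], of b]
      by (rule has_sum_cong[THEN iffD1, rotated]) (use x \<iota>c in \<open>simp add: inner_prod_smult
        algebra_simps\<close>)
    then show "infsum (?t (b \<odot> x)) E = b * infsum (?t x) E" by (rule infsumI)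
  next
    fix x assume x: "x \<in> carrier H"
    have "norm (infsum (?t x) E) \<le> infsum (\<lambda>e. norm (?t x e)) E"
      by (rule norm_infsum_bound[OF summ[OF x]])
    also have "\<dots> \<le> \<bar>C\<bar> * hnorm H x"
      by (rule infsum_le_finite_sums[OF summ[OF x]]) (rule fin[OF _ _ x])
    finally show "cmod (infsum (?t x) E) \<le> \<bar>C\<bar> * hnorm H x" .
  qed blast
  show thesis
  proof (rule that[OF v(1)])
    fix y assume y: "y \<in> carrier H"
    have 1: "((\<lambda>e. cnj (?t y e)) has_sum ip H v y) E"
      unfolding inner_prod_commute[OF v(1) y] has_sum_cnj_iff using hs[OF y] v(2)[OF y] by simp
    have 2: "cnj (?t y e) = a e * ip H (\<iota> e) y" if "e \<in> E" for e
      using inner_prod_commute[OF \<iota>c[OF that] y] by simp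
    show "((\<lambda>e. a e * ip H (\<iota> e) y) has_sum ip H v y) E"
      by (rule has_sum_cong[THEN iffD1, OF 2 1])
  qed
qed

text \<open>
The series of the coordinates of \<open>u\<close> sums to a vector \<open>v\<close>, and \<open>u - v\<close> is orthogonal to \<open>E\<close>,
hence to \<open>u\<close> and to \<open>v\<close>.
\<close>

lemma parseval:
  assumes E: "orthonormal_set H E" and u: "u \<in> closed_span H E" and y: "y \<in> carrier H"
  shows "((\<lambda>e. ip H u e * ip H e y) has_sum ip H u y) E"
proof -
  have uc: "u \<in> carrier H" using u by (simp add: closed_span_def)
  obtain v where v: "v \<in> carrier H" "\<And>y. y \<in> carrier H \<Longrightarrow>
      ((\<lambda>e. ip H u e * ip H e y) has_sum ip H v y) E"
  proof (rule orthonormal_series[OF E, of "\<lambda>e. e" E "\<lambda>e. ip H u e" "hnorm H u"])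
    show "(\<Sum>e\<in>G. (cmod (ip H u e))\<^sup>2) \<le> (hnorm H u)\<^sup>2" if "finite G" "G \<subseteq> E" for G
      using bessel[OF that(1) orthonormal_set_subset[OF E that(2)] uc] .
  qed (auto simp: inj_on_def)
  have ve: "ip H v e = ip H u e" if "e \<in> E" for e
  proof -
    have "((\<lambda>d. ip H u d * ip H d e) has_sum (ip H u e * ip H e e)) E"
      by (rule has_sum_Kronecker) (use that orthonormal_setD(2)[OF E _ that] in auto)
    moreover have ec: "e \<in> carrier H" using orthonormal_setD(1)[OF E that] .
    ultimately show ?thesis
      using has_sum_unique[OF v(2)[OF ec]] orthonormal_setD(2)[OF E that that] by simp
  qed
  let ?w = "u \<ominus> v"
  have we: "ip H ?w e = 0" if "e \<in> E" for e
    using ve[OF that] uc v(1) orthonormal_setD(1)[OF E that] by (simp add: inner_diff_left)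
  have "ip H ?w u = 0" using u we uc v(1) by (simp add: closed_span_def)
  moreover have "ip H v ?w = 0"
  proof -
    have "ip H e ?w = 0" if "e \<in> E" for e
      using we[OF that] inner_eq_0_commute[of ?w e] orthonormal_setD(1)[OF E that] uc v(1) by simp
    then have "((\<lambda>e. 0) has_sum ip H v ?w) E"
      using v(2)[of ?w] uc v(1) by (simp cong: has_sum_cong)
    then show ?thesis by (rule has_sum_zero_imp_eq)
  qed
  ultimately have "ip H ?w ?w = 0"
    using uc v(1) inner_eq_0_commute[of v ?w] by (simp add: inner_diff_right)
  then have "u = v" using uc v(1) inner_prod_definite[of ?w] minus_eq_zero_imp_eq[of u v] by simp
  with v(2)[OF y] show ?thesis by simp
qed

lemma ex_orthonormal_basis:
  obtains B where "orthonormal_set H B" "closed_span H B = carrier H"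
proof -
  obtain B where B: "orthonormal_set H B"
    and max: "\<And>D. \<lbrakk>orthonormal_set H D; B \<subseteq> D\<rbrakk> \<Longrightarrow> D = B"
  proof -
    have "\<exists>M\<in>{D. orthonormal_set H D}. \<forall>D\<in>{D. orthonormal_set H D}. M \<subseteq> D \<longrightarrow> D = M"
    proof (rule subset_Zorn')
      fix C assume C: "subset.chain {D. orthonormal_set H D} C"
      have "ip H e f = (if e = f then 1 else 0)"
        if "e \<in> D" "D \<in> C" "f \<in> Y" "Y \<in> C" for e f D Y
      proof -
        have DY: "orthonormal_set H D" "orthonormal_set H Y" and or: "D \<subseteq> Y \<or> Y \<subseteq> D"
          using C that by (auto simp: subset_chain_def)
        from or show ?thesis
        proof
          assume "D \<subseteq> Y"
          then have "e \<in> Y" using that(1) by (rule subsetD)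
          then show ?thesis using that(3) by (rule orthonormal_setD(2)[OF DY(2)])
        next
          assume "Y \<subseteq> D"
          then have "f \<in> D" using that(3) by (rule subsetD)
          with that(1) show ?thesis by (rule orthonormal_setD(2)[OF DY(1)])
        qed
      qed
      moreover have "\<Union>C \<subseteq> carrier H"
        using C by (auto simp: subset_chain_def orthonormal_set_def)
      ultimately show "\<Union>C \<in> {D. orthonormal_set H D}"
        by (auto simp: orthonormal_set_def)
    qed
    then show thesis using that by auto
  qed
  have z0: "z = \<zero>" if z: "z \<in> carrier H" "\<forall>b\<in>B. ip H z b = 0" for z
  proof (rule ccontr)
    assume nz: "z \<noteq> \<zero>"
    define g where "g = complex_of_real (1 / hnorm H z) \<odot> z"
    have pos: "hnorm H z \<noteq> 0" using nz z hnorm_eq_0_iff by simp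
    have g: "g \<in> carrier H" "ip H g g = 1"
      using z pos inner_self[of z] by (simp_all add: g_def inner_simps power2_eq_square)
    have gb: "ip H g b = 0" "ip H b g = 0" if "b \<in> B" for b
      using z that inner_eq_0_commute[of z b] orthonormal_setD(1)[OF B that]
      by (simp_all add: g_def inner_simps)
    have "orthonormal_set H (insert g B)"
      using B g gb by (auto simp: orthonormal_set_def)
    then have "g \<in> B" using max[of "insert g B"] by blast
    then show False using gb g by force
  qed
  have "ip H z x = 0" if "z \<in> carrier H" "\<forall>b\<in>B. ip H z b = 0" "x \<in> carrier H" for x z
    using that(3) unfolding z0[OF that(1,2)] by (rule inner_zero_left)
  then have "closed_span H B = carrier H" unfolding closed_span_def by blast
  with B that show thesis by blast
qed

lemma countable_inner_nonzero:
  assumes "orthonormal_set H E" "u \<in> carrier H"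
  shows "countable {e \<in> E. ip H u e \<noteq> 0}"
proof -
  have "(\<lambda>e. (cmod (ip H u e))\<^sup>2) summable_on E"
    by (rule nonneg_bdd_above_summable_on)
      (auto intro!: bdd_aboveI2[where M="(hnorm H u)\<^sup>2"] bessel assms orthonormal_set_subset[OF
        assms(1)])
  from summable_countable_real[OF this] show ?thesis by simp
qed

text \<open>
Only those members of an orthonormal basis matter that are not orthogonal to some vector of \<open>S\<close>,
and each vector has at most countably many nonzero coordinates.
\<close>

lemma infinite_spanning_orthonormal_set:
  assumes S: "S \<subseteq> carrier H" and B: "infinite B" "|S| \<le>o |B|"
  obtains E where "orthonormal_set H E" "|E| \<le>o |B|" "S \<subseteq> closed_span H E"
proof -
  obtain D where D: "orthonormal_set H D" "closed_span H D = carrier H"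
    using ex_orthonormal_basis by blast
  define E where "E = (\<Union>s\<in>S. {e \<in> D. ip H s e \<noteq> 0})"
  have "|{e \<in> D. ip H s e \<noteq> 0}| \<le>o |B|" if "s \<in> S" for s
  proof -
    have "countable {e \<in> D. ip H s e \<noteq> 0}"
      using countable_inner_nonzero[OF D(1), of s] S that by blast
    then have "|{e \<in> D. ip H s e \<noteq> 0}| \<le>o |UNIV :: nat set|"
      unfolding countable_def card_of_ordLeq[symmetric] by blast
    moreover have "|UNIV :: nat set| \<le>o |B|" using B(1) by (simp add: infinite_iff_card_of_nat)
    ultimately show ?thesis by (rule ordLeq_transitive)
  qed
  then have "|E| \<le>o |B|" unfolding E_def by (intro card_of_UNION_ordLeq_infinite B) auto
  moreover have "orthonormal_set H E"
    using D(1) by (rule orthonormal_set_subset) (auto simp: E_def)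
  moreover have "s \<in> closed_span H E" if s: "s \<in> S" for s
  proof -
    have sc: "s \<in> carrier H" using s S by blast
    have "ip H z s = 0" if z: "z \<in> carrier H" "\<forall>e\<in>E. ip H z e = 0" for z
    proof -
      have "ip H s e * ip H e z = 0" if "e \<in> D" for e
        using z that s inner_eq_0_commute[of z e] orthonormal_setD(1)[OF D(1) that]
        by (auto simp: E_def)
      moreover have "((\<lambda>e. ip H s e * ip H e z) has_sum ip H s z) D"
        using parseval[OF D(1), of s z] D(2) sc z by simp
      ultimately have "((\<lambda>e. 0) has_sum ip H s z) D"
        by (rule has_sum_cong[THEN iffD1])
      then show ?thesis using has_sum_zero_imp_eq inner_eq_0_commute[OF sc z(1)] by blast
    qed
    with sc show ?thesis by (simp add: closed_span_def)
  qed
  ultimately show thesis using that by blast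
qed

lemma gram_schmidt:
  assumes "finite S" "S \<subseteq> carrier H"
  obtains G where "orthonormal_set H G" "finite G" "card G \<le> card S"
    "S \<subseteq> closed_span H G" "G \<subseteq> closed_span H S"
proof -
  have "\<exists>G. orthonormal_set H G \<and> finite G \<and> card G \<le> card S \<and>
    S \<subseteq> closed_span H G \<and> G \<subseteq> closed_span H S"
    using assms
  proof (induction S rule: finite_induct)
    case empty
    show ?case by (intro exI[of _ "{}"]) (simp add: orthonormal_set_def)
  next
    case (insert s S)
    then obtain G where G: "orthonormal_set H G" "finite G" "card G \<le> card S"
      and SG: "S \<subseteq> closed_span H G" and GS: "G \<subseteq> closed_span H S" by auto
    have s: "s \<in> carrier H" using insert.prems by simp
    have Gc: "G \<subseteq> carrier H" using G(1) by (simp add: orthonormal_set_def)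
    define p where "p = proj_sum G s"
    define r where "r = s \<ominus> p"
    have p: "p \<in> carrier H" unfolding p_def by (rule proj_sum_carrier[OF G(2,1) s])
    have pz: "ip H z p = 0" if "z \<in> carrier H" "\<forall>g\<in>G. ip H z g = 0" for z
      using inner_proj_sum[OF G(2,1) s that(1)] that(2) by (simp add: p_def)
    have r: "r \<in> carrier H" using s p by (simp add: r_def)
    have rg: "ip H r g = 0" if "g \<in> G" for g
      unfolding r_def p_def by (rule inner_minus_proj_sum[OF G(2,1) s that])
    have zs: "ip H z s = ip H z p + ip H z r" if "z \<in> carrier H" for z
      using that s p by (simp add: r_def inner_simps)
    show ?case
    proof (cases "r = \<zero>")
      case True
      have "s \<in> closed_span H G"
        using s zs pz True by (simp add: closed_span_def)
      moreover have "G \<subseteq> closed_span H (insert s S)" using GS by (auto simp: closed_span_def)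
      ultimately show ?thesis using G SG insert.hyps by (intro exI[of _ G]) simp
    next
      case False
      define g where "g = complex_of_real (1 / hnorm H r) \<odot> r"
      have pos: "hnorm H r \<noteq> 0" using False r hnorm_eq_0_iff by simp
      have g: "g \<in> carrier H" "ip H g g = 1"
        using r pos inner_self[of r] by (simp_all add: g_def inner_simps power2_eq_square)
      have gG: "ip H g b = 0" "ip H b g = 0" if "b \<in> G" for b
        using r that rg[OF that] inner_eq_0_commute[of r b] Gc
        by (auto simp add: g_def inner_simps subset_iff)
      have zg: "ip H z g = 0 \<longleftrightarrow> ip H z r = 0" if "z \<in> carrier H" for z
        using that r pos by (simp add: g_def inner_simps)
      have "orthonormal_set H (insert g G)"
        using G(1) g gG by (auto simp: orthonormal_set_def)
      moreover have "s \<in> closed_span H (insert g G)"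
        using s zs pz zg by (simp add: closed_span_def)
      moreover have "S \<subseteq> closed_span H (insert g G)" using SG by (auto simp: closed_span_def)
      moreover have "g \<in> closed_span H (insert s S)"
      proof -
        have "ip H z g = 0"
          if z: "z \<in> carrier H" "\<forall>e\<in>insert s S. ip H z e = 0" for z
        proof -
          have "\<forall>b\<in>G. ip H z b = 0" using GS z by (auto simp: closed_span_def)
          then show ?thesis using pz[of z] zs[of z] zg[of z] z by simp
        qed
        with g show ?thesis by (simp add: closed_span_def)
      qed
      moreover have "G \<subseteq> closed_span H (insert s S)" using GS by (auto simp: closed_span_def)
      moreover have "card (insert g G) \<le> card (insert s S)"
        using G insert.hyps card_insert_le_m1 by (simp add: card_insert_if)
      ultimately show ?thesis using G(2) by (intro exI[of _ "insert g G"]) simp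
    qed
  qed
  then show thesis using that by blast
qed

end

text \<open>
If \<open>z\<close> is orthogonal to the images of a basis, then \<open>A* z\<close> is orthogonal to the basis.
\<close>

lemma bounded_op_image_in_closed_span:
  assumes H: "complex_hilbert_space H" and F: "complex_hilbert_space F"
    and A: "bounded_op H F A" and B: "B \<subseteq> carrier H" "closed_span H B = carrier H"
    and E: "A ` B \<subseteq> closed_span F E" and x: "x \<in> carrier H"
  shows "A x \<in> closed_span F E"
proof -
  interpret H: complex_hilbert_space H by fact
  interpret F: complex_hilbert_space F by fact
  have "ip F z (A x) = 0" if z: "z \<in> carrier F" "\<forall>e\<in>E. ip F z e = 0" for z
  proof -
    let ?w = "adj H F A z"
    note adj = adj_carrier_inner[OF H F A z(1)]
    have "ip H ?w b = 0" if b: "b \<in> B" for b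
    proof -
      have "b \<in> carrier H" using B(1) b by blast
      moreover have "ip F z (A b) = 0" using E b z by (auto simp: closed_span_def)
      ultimately show ?thesis
        using adj(1) adj(2)[of b] H.inner_eq_0_commute[of ?w b] F.inner_eq_0_commute[of z "A b"]
          z bounded_opD(1)[OF A] by simp
    qed
    moreover have "x \<in> closed_span H B" using B(2) x by simp
    ultimately have "ip H ?w x = 0" using adj(1) by (simp add: closed_span_def)
    then show ?thesis
      using adj(1) adj(2)[OF x] H.inner_eq_0_commute[of ?w x] F.inner_eq_0_commute[of z "A x"]
        z x bounded_opD(1)[OF A] by simp
  qed
  then show ?thesis using bounded_opD(1)[OF A x] by (simp add: closed_span_def)
qed

text \<open>
A comparison of cardinalities turns into an operator: \<open>R\<close> sends the vector with coordinates
\<open>\<langle>u, e\<rangle>\<close> along \<open>E\<close> to the vector with the same coordinates along the images of \<open>E\<close> in \<open>B\<close>.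
\<close>

lemma ex_isometry_on_closed_span:
  fixes F :: "'f hilbert" and H :: "'h hilbert"
  assumes H: "complex_hilbert_space H" and F: "complex_hilbert_space F"
    and E: "orthonormal_set F E" and B: "orthonormal_set H B" and EB: "|E| \<le>o |B|"
  obtains R where "\<And>u. u \<in> carrier F \<Longrightarrow> R u \<in> carrier H"
    and "\<And>u v. \<lbrakk>u \<in> carrier F; v \<in> carrier F\<rbrakk> \<Longrightarrow> R (u \<oplus>\<^bsub>F\<^esub> v) = R u \<oplus>\<^bsub>H\<^esub> R v"
    and "\<And>a u. u \<in> carrier F \<Longrightarrow> R (a \<odot>\<^bsub>F\<^esub> u) = a \<odot>\<^bsub>H\<^esub> R u"
    and "\<And>u v. \<lbrakk>u \<in> closed_span F E; v \<in> carrier F\<rbrakk> \<Longrightarrow>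
      ip H (R u) (R v) = ip F u v"
proof -
  interpret H: complex_hilbert_space H by fact
  interpret F: complex_hilbert_space F by fact
  obtain \<iota> where \<iota>: "inj_on \<iota> E" "\<iota> ` E \<subseteq> B" using EB by (metis card_of_ordLeq)
  have \<iota>c: "\<iota> e \<in> carrier H" if "e \<in> E" for e
    using that \<iota> orthonormal_setD(1)[OF B] by blast
  have Ec: "e \<in> carrier F" if "e \<in> E" for e using orthonormal_setD(1)[OF E that] .
  have "\<exists>v. v \<in> carrier H \<and> (\<forall>y\<in>carrier H.
      ((\<lambda>e. ip F u e * ip H (\<iota> e) y) has_sum ip H v y) E)"
    if u: "u \<in> carrier F" for u
  proof (rule H.orthonormal_series[OF B \<iota>, of "\<lambda>e. ip F u e" "hnorm F u"])
    show "(\<Sum>e\<in>G. (cmod (ip F u e))\<^sup>2) \<le> (hnorm F u)\<^sup>2" if "finite G" "G \<subseteq> E" for G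
      using F.bessel[OF that(1) orthonormal_set_subset[OF E that(2)] u] .
  qed blast
  then have "\<forall>u\<in>carrier F. \<exists>v. v \<in> carrier H \<and> (\<forall>y\<in>carrier H.
      ((\<lambda>e. ip F u e * ip H (\<iota> e) y) has_sum ip H v y) E)" by blast
  from bchoice[OF this] obtain R where R: "\<And>u. u \<in> carrier F \<Longrightarrow> R u \<in> carrier H"
    and hs: "\<And>u y. \<lbrakk>u \<in> carrier F; y \<in> carrier H\<rbrakk> \<Longrightarrow>
      ((\<lambda>e. ip F u e * ip H (\<iota> e) y) has_sum ip H (R u) y) E"
    by blast
  have add: "R (u \<oplus>\<^bsub>F\<^esub> v) = R u \<oplus>\<^bsub>H\<^esub> R v" if u: "u \<in> carrier F" and v: "v \<in> carrier F" for u v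
  proof (rule H.inner_ext)
    fix y assume y: "y \<in> carrier H"
    have "((\<lambda>e. ip F (u \<oplus>\<^bsub>F\<^esub> v) e * ip H (\<iota> e) y) has_sum
        (ip H (R u) y + ip H (R v) y)) E"
      using has_sum_add[OF hs[OF u y] hs[OF v y]]
      by (rule has_sum_cong[THEN iffD1, rotated]) (use u v Ec in \<open>simp add: F.inner_simps
        algebra_simps\<close>)
    then show "ip H (R (u \<oplus>\<^bsub>F\<^esub> v)) y = ip H (R u \<oplus>\<^bsub>H\<^esub> R v) y"
      using has_sum_unique hs[of "u \<oplus>\<^bsub>F\<^esub> v" y] u v y R by (simp add: H.inner_simps) blast
  qed (use u v R in auto)
  have smult: "R (a \<odot>\<^bsub>F\<^esub> u) = a \<odot>\<^bsub>H\<^esub> R u" if u: "u \<in> carrier F" for u a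
  proof (rule H.inner_ext)
    fix y assume y: "y \<in> carrier H"
    have "((\<lambda>e. ip F (a \<odot>\<^bsub>F\<^esub> u) e * ip H (\<iota> e) y) has_sum
        (a * ip H (R u) y)) E"
      using has_sum_cmult_right[OF hs[OF u y], of a]
      by (rule has_sum_cong[THEN iffD1, rotated]) (use u Ec in \<open>simp add: F.inner_simps algebra_simps\<close>)
    then show "ip H (R (a \<odot>\<^bsub>F\<^esub> u)) y = ip H (a \<odot>\<^bsub>H\<^esub> R u) y"
      using has_sum_unique hs[of "a \<odot>\<^bsub>F\<^esub> u" y] u y R by (simp add: H.inner_simps) blast
  qed (use u R in auto)
  have inner: "ip H (R u) (R v) = ip F u v"
    if u: "u \<in> closed_span F E" and v: "v \<in> carrier F" for u v
  proof -
    have uc: "u \<in> carrier F" using u by (simp add: closed_span_def)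
    have "ip H (\<iota> e) (R v) = ip F e v" if e: "e \<in> E" for e
    proof -
      have "((\<lambda>d. ip F v d * ip H (\<iota> d) (\<iota> e)) has_sum
          (ip F v e * ip H (\<iota> e) (\<iota> e))) E"
      proof (rule has_sum_Kronecker[OF e])
        show "ip F v d * ip H (\<iota> d) (\<iota> e) = 0" if "d \<in> E" "d \<noteq> e" for d
        proof -
          have "\<iota> d \<noteq> \<iota> e" using that e \<iota>(1) by (simp add: inj_on_eq_iff)
          moreover have "\<iota> d \<in> B" "\<iota> e \<in> B" using that e \<iota>(2) by auto
          ultimately show ?thesis using orthonormal_setD(2)[OF B, of "\<iota> d" "\<iota> e"] by simp
        qed
      qed
      moreover have "ip H (\<iota> e) (\<iota> e) = 1"
        using orthonormal_setD(2)[OF B, of "\<iota> e" "\<iota> e"] e \<iota> by auto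
      ultimately have "ip H (R v) (\<iota> e) = ip F v e"
        using has_sum_unique[OF hs[OF v \<iota>c[OF e]]] by simp
      then show ?thesis
        using H.inner_prod_commute[OF \<iota>c[OF e] R[OF v]] F.inner_prod_commute[OF Ec[OF e] v] by simp
    qed
    then have "((\<lambda>e. ip F u e * ip F e v) has_sum ip H (R u) (R v)) E"
      using hs[OF uc R[OF v]] by (simp cong: has_sum_cong)
    then show ?thesis using has_sum_unique F.parseval[OF E u v] by blast
  qed
  show thesis by (rule that[OF R add smult inner])
qed

section \<open>The Hilbert space of a positive kernel\<close>

text \<open>
A list of pairs \<open>(a, p)\<close> stands for the formal linear combination of points \<open>p\<close> with
coefficients \<open>a\<close>, and \<open>kform\<close> is the sesquilinear extension of the kernel. Lists with
repetitions are used because all lists are admissible and addition is concatenation.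
\<close>

definition kform :: "('s \<Rightarrow> 's \<Rightarrow> complex) \<Rightarrow> (complex \<times> 's) list \<Rightarrow> (complex \<times> 's) list \<Rightarrow> complex" where
  "kform K xs ys = (\<Sum>x\<leftarrow>xs. fst x * (\<Sum>y\<leftarrow>ys. cnj (fst y) * K (snd x) (snd y)))"

definition lscale :: "complex \<Rightarrow> (complex \<times> 's) list \<Rightarrow> (complex \<times> 's) list" where
  "lscale c = map (apfst ((*) c))"

definition ldiff :: "(complex \<times> 's) list \<Rightarrow> (complex \<times> 's) list \<Rightarrow> (complex \<times> 's) list" where
  "ldiff xs ys = xs @ lscale (-1) ys"

lemma kform_Nil [simp]: "kform K [] ys = 0" "kform K xs [] = 0"
  by (simp_all add: kform_def)

lemma kform_append_left: "kform K (xs @ xs') ys = kform K xs ys + kform K xs' ys"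
  by (simp add: kform_def)

lemma kform_append_right: "kform K xs (ys @ ys') = kform K xs ys + kform K xs ys'"
  by (simp add: kform_def distrib_left sum_list_addf)

lemma kform_lscale_left: "kform K (lscale c xs) ys = c * kform K xs ys"
  by (simp add: kform_def lscale_def o_def mult.assoc sum_list_const_mult)

lemma kform_lscale_right: "kform K xs (lscale c ys) = cnj c * kform K xs ys"
proof -
  have "(\<Sum>y\<leftarrow>lscale c ys. cnj (fst y) * K p (snd y)) = cnj c * (\<Sum>y\<leftarrow>ys. cnj (fst y) * K p (snd y))" for p
    by (simp add: lscale_def o_def mult.assoc sum_list_const_mult)
  then show ?thesis by (simp add: kform_def mult.left_commute sum_list_const_mult)
qed

lemmas kform_simps = ldiff_def kform_append_left kform_append_right kform_lscale_left kform_lscale_right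

locale positive_kernel =
  fixes K :: "'s \<Rightarrow> 's \<Rightarrow> complex"
  assumes kernel_commute: "K q p = cnj (K p q)"
    and kernel_positive: "0 \<le> Re (kform K xs xs)"
begin

abbreviation form where "form \<equiv> kform K"

text \<open>
The function represented by a combination of points: the value at \<open>q\<close> is the product with \<open>q\<close>.
\<close>

definition ev :: "(complex \<times> 's) list \<Rightarrow> 's \<Rightarrow> complex" where
  "ev xs q = form xs [(1, q)]"

definition nrm :: "(complex \<times> 's) list \<Rightarrow> real" where
  "nrm xs = sqrt (Re (form xs xs))"

lemma form_commute: "form ys xs = cnj (form xs ys)"
proof (induction xs)
  case (Cons x xs)
  have "form ys [x] = cnj (form [x] ys)"
  proof (induction ys)
    case (Cons y ys)
    then show ?case
      using kform_append_left[of K "[y]" ys "[x]"] kform_append_right[of K "[x]" "[y]" ys]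
        kernel_commute[of "snd y" "snd x"]
      by (simp add: kform_def)
  qed simp
  with Cons show ?case
    using kform_append_left[of K "[x]" xs ys] kform_append_right[of K ys "[x]" xs] by simp
qed simp

lemma nrm_nonneg [simp]: "0 \<le> nrm xs"
  using kernel_positive[of xs] by (simp add: nrm_def)

lemma nrm_square: "(nrm xs)\<^sup>2 = Re (form xs xs)"
  using kernel_positive[of xs] by (simp add: nrm_def)

lemma form_self: "form xs xs = complex_of_real ((nrm xs)\<^sup>2)"
  using form_commute[of xs xs] by (simp add: nrm_square complex_eq_iff)

lemma form_cauchy_schwarz: "cmod (form xs ys) \<le> nrm xs * nrm ys"
proof -
  have "cmod (form xs ys) \<le> sqrt ((nrm xs)\<^sup>2) * sqrt ((nrm ys)\<^sup>2)"
  proof (rule quadratic_form_imp_cmod_le)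
    fix z
    \<comment> \<open>the conjugate makes the cross term \<open>z * form xs ys\<close>\<close>
    let ?zs = "xs @ lscale (cnj z) ys"
    have "form ?zs ?zs = form xs xs + (z * form xs ys + cnj (z * form xs ys)) + z * cnj z * form ys ys"
      using form_commute[of ys xs] by (simp add: kform_simps algebra_simps)
    also have "\<dots> = complex_of_real ((nrm xs)\<^sup>2 + 2 * Re (z * form xs ys) + (cmod z)\<^sup>2 * (nrm ys)\<^sup>2)"
      by (simp only: complex_add_cnj complex_norm_square[symmetric] form_self) simp
    finally show "0 \<le> (nrm xs)\<^sup>2 + 2 * Re (z * form xs ys) + (cmod z)\<^sup>2 * (nrm ys)\<^sup>2"
      using kernel_positive[of ?zs] by simp
  qed simp_all
  then show ?thesis by simp
qed

lemma nrm_append: "nrm (xs @ ys) \<le> nrm xs + nrm ys"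
proof (rule power2_le_imp_le)
  have "(nrm (xs @ ys))\<^sup>2 = (nrm xs)\<^sup>2 + 2 * Re (form xs ys) + (nrm ys)\<^sup>2"
    using form_commute[of ys xs] by (simp add: nrm_square kform_simps)
  also have "\<dots> \<le> (nrm xs + nrm ys)\<^sup>2"
    using form_cauchy_schwarz[of xs ys] complex_Re_le_cmod[of "form xs ys"] by (simp add: power2_sum)
  finally show "(nrm (xs @ ys))\<^sup>2 \<le> (nrm xs + nrm ys)\<^sup>2" .
qed simp

lemma nrm_lscale: "nrm (lscale c xs) = cmod c * nrm xs"
proof -
  have "form (lscale c xs) (lscale c xs) = complex_of_real ((cmod c * nrm xs)\<^sup>2)"
    by (simp only: kform_simps form_self power_mult_distrib of_real_mult complex_norm_square) (simp
      add: ac_simps)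
  then have "(nrm (lscale c xs))\<^sup>2 = (cmod c * nrm xs)\<^sup>2" by (simp add: nrm_square)
  then show ?thesis by (simp add: power2_eq_iff_nonneg)
qed

lemma nrm_ldiff_triangle: "nrm (ldiff xs zs) \<le> nrm (ldiff xs ys) + nrm (ldiff ys zs)"
proof -
  have "nrm (ldiff xs zs) = nrm (ldiff xs ys @ ldiff ys zs)"
    by (simp add: nrm_def kform_simps)
  then show ?thesis using nrm_append by simp
qed

lemma nrm_le_ldiff: "nrm xs \<le> nrm (ldiff xs ys) + nrm ys"
  using nrm_ldiff_triangle[of xs "[]" ys] by (simp add: ldiff_def lscale_def)

definition kCauchy :: "(nat \<Rightarrow> (complex \<times> 's) list) \<Rightarrow> bool" where
  "kCauchy s \<longleftrightarrow> (\<forall>e>0. \<exists>N. \<forall>m\<ge>N. \<forall>n\<ge>N. nrm (ldiff (s m) (s n)) < e)"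

text \<open>
Elements of the completion are functions on the set of points, namely the pointwise limits of
Cauchy sequences of combinations. No quotient is needed, since such a limit determines the
Cauchy sequence up to a null sequence (\<open>represents_nrm_ldiff\<close>).
\<close>

definition represents :: "(nat \<Rightarrow> (complex \<times> 's) list) \<Rightarrow> ('s \<Rightarrow> complex) \<Rightarrow> bool" where
  "represents s f \<longleftrightarrow> kCauchy s \<and> (\<forall>q. (\<lambda>n. ev (s n) q) \<longlonglongrightarrow> f q)"

definition kip :: "('s \<Rightarrow> complex) \<Rightarrow> ('s \<Rightarrow> complex) \<Rightarrow> complex" where
  "kip f g = lim (\<lambda>n. form ((SOME s. represents s f) n) ((SOME t. represents t g) n))"

lemma kCauchy_bounded:
  assumes "kCauchy s"
  obtains M where "\<And>n. nrm (s n) \<le> M" "M \<ge> 0"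
proof -
  obtain N where N: "\<And>m n. \<lbrakk>m \<ge> N; n \<ge> N\<rbrakk> \<Longrightarrow> nrm (ldiff (s m) (s n)) < 1"
    using assms unfolding kCauchy_def by (meson zero_less_one)
  define M where "M = Max ((\<lambda>n. nrm (s n)) ` {..N}) + 1"
  have small: "nrm (s n) \<le> M - 1" if "n \<le> N" for n
    using that by (auto simp: M_def)
  have "nrm (s n) \<le> M" for n
  proof (cases "n \<le> N")
    case False
    then show ?thesis using nrm_le_ldiff[of "s n" "s N"] N[of n N] small[of N] by simp
  qed (use small in force)
  moreover have "M \<ge> 0" using calculation nrm_nonneg order_trans by blast
  ultimately show thesis using that by blast
qed

lemma form_diff_le:
  "cmod (form xs ys - form xs' ys') \<le> nrm (ldiff xs xs') * nrm ys + nrm xs' * nrm (ldiff ys ys')"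
proof -
  have "form xs ys - form xs' ys' = form (ldiff xs xs') ys + form xs' (ldiff ys ys')"
    by (simp add: kform_simps)
  then have "cmod (form xs ys - form xs' ys')
    \<le> cmod (form (ldiff xs xs') ys) + cmod (form xs' (ldiff ys ys'))"
    by (simp add: norm_triangle_ineq)
  also have "\<dots> \<le> nrm (ldiff xs xs') * nrm ys + nrm xs' * nrm (ldiff ys ys')"
    by (intro add_mono form_cauchy_schwarz)
  finally show ?thesis .
qed

lemma convergent_form:
  assumes "kCauchy s" "kCauchy t"
  shows "convergent (\<lambda>n. form (s n) (t n))"
proof -
  obtain Ms where Ms: "\<And>n. nrm (s n) \<le> Ms" "Ms \<ge> 0" using kCauchy_bounded[OF assms(1)] by blast
  obtain Mt where Mt: "\<And>n. nrm (t n) \<le> Mt" "Mt \<ge> 0" using kCauchy_bounded[OF assms(2)] by blast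
  have "Cauchy (\<lambda>n. form (s n) (t n))"
  proof (rule metric_CauchyI)
    fix e :: real assume e: "e > 0"
    define e' where "e' = e / (Ms + Mt + 1)"
    have e': "e' > 0" using e Ms Mt by (simp add: e'_def)
    obtain N1 where N1: "\<And>m n. \<lbrakk>m \<ge> N1; n \<ge> N1\<rbrakk> \<Longrightarrow> nrm (ldiff (s m) (s n)) < e'"
      using assms(1) e' unfolding kCauchy_def by meson
    obtain N2 where N2: "\<And>m n. \<lbrakk>m \<ge> N2; n \<ge> N2\<rbrakk> \<Longrightarrow> nrm (ldiff (t m) (t n)) < e'"
      using assms(2) e' unfolding kCauchy_def by meson
    show "\<exists>N. \<forall>m\<ge>N. \<forall>n\<ge>N. dist (form (s m) (t m)) (form (s n) (t n)) < e"
    proof (intro exI allI impI)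
      fix m n assume "max N1 N2 \<le> m" "max N1 N2 \<le> n"
      then have "nrm (ldiff (s m) (s n)) \<le> e'" "nrm (ldiff (t m) (t n)) \<le> e'"
        using N1[of m n] N2[of m n] by simp_all
      then have "nrm (ldiff (s m) (s n)) * nrm (t m) + nrm (s n) * nrm (ldiff (t m) (t n))
        \<le> e' * Mt + Ms * e'"
        using Ms Mt e' by (intro add_mono mult_mono) auto
      also have "\<dots> < e' * (Ms + Mt + 1)" using e' by (simp add: algebra_simps)
      also have "\<dots> = e" using Ms Mt by (simp add: e'_def)
      finally show "dist (form (s m) (t m)) (form (s n) (t n)) < e"
        using form_diff_le[of "s m" "t m" "s n" "t n"] by (simp add: dist_norm)
    qed
  qed
  then show ?thesis by (simp add: Cauchy_convergent_iff)
qed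

lemma kCauchy_ldiff:
  assumes "kCauchy s" "kCauchy t"
  shows "kCauchy (\<lambda>n. ldiff (s n) (t n))"
  unfolding kCauchy_def
proof (intro allI impI)
  fix e :: real assume e: "e > 0"
  then have "e / 2 > 0" by simp
  obtain N1 where N1: "\<And>m n. \<lbrakk>m \<ge> N1; n \<ge> N1\<rbrakk> \<Longrightarrow> nrm (ldiff (s m) (s n)) < e / 2"
    using assms(1) \<open>e / 2 > 0\<close> unfolding kCauchy_def by meson
  obtain N2 where N2: "\<And>m n. \<lbrakk>m \<ge> N2; n \<ge> N2\<rbrakk> \<Longrightarrow> nrm (ldiff (t m) (t n)) < e / 2"
    using assms(2) \<open>e / 2 > 0\<close> unfolding kCauchy_def by meson
  have "nrm (ldiff (ldiff (s m) (t m)) (ldiff (s n) (t n)))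
      \<le> nrm (ldiff (s m) (s n)) + nrm (ldiff (t m) (t n))" for m n
  proof -
    have "nrm (ldiff (ldiff (s m) (t m)) (ldiff (s n) (t n)))
        = nrm (ldiff (s m) (s n) @ lscale (-1) (ldiff (t m) (t n)))"
      by (simp add: nrm_def kform_simps algebra_simps)
    then show ?thesis
      using nrm_append[of "ldiff (s m) (s n)" "lscale (-1) (ldiff (t m) (t n))"]
        by (simp add: nrm_lscale)
  qed
  then show "\<exists>N. \<forall>m\<ge>N. \<forall>n\<ge>N. nrm (ldiff (ldiff (s m) (t m)) (ldiff (s n) (t n))) < e"
    using N1 N2 by (intro exI[of _ "max N1 N2"]) (smt (verit, best) field_sum_of_halves max.bounded_iff)
qed

lemma form_tendsto_0:
  assumes "\<And>q. (\<lambda>n. ev (u n) q) \<longlonglongrightarrow> 0"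
  shows "(\<lambda>n. form (u n) xs) \<longlonglongrightarrow> 0"
proof (induction xs)
  case (Cons x xs)
  have "form (u n) (x # xs) = cnj (fst x) * ev (u n) (snd x) + form (u n) xs" for n
    using kform_append_right[of K "u n" "lscale (fst x) [(1, snd x)]" xs]
      kform_lscale_right[of K "u n" "fst x" "[(1, snd x)]"]
    by (simp add: lscale_def ev_def)
  moreover have "(\<lambda>n. cnj (fst x) * ev (u n) (snd x) + form (u n) xs) \<longlonglongrightarrow> cnj (fst x) * 0 + 0"
    by (intro tendsto_intros assms Cons)
  ultimately show ?case by simp
qed simp

text \<open>
The step that makes functions a faithful model of the completion: a Cauchy sequence whose
functions tend to zero pointwise tends to zero in norm. The terms \<open>u n\<close> are close to a fixed
\<open>u N\<close>, and the products of \<open>u n\<close> with the finite combination \<open>u N\<close> tend to zero.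
\<close>

lemma nrm_tendsto_0:
  assumes C: "kCauchy u" and 0: "\<And>q. (\<lambda>n. ev (u n) q) \<longlonglongrightarrow> 0"
  shows "(\<lambda>n. nrm (u n)) \<longlonglongrightarrow> 0"
proof -
  obtain M where M: "\<And>n. nrm (u n) \<le> M" "M \<ge> 0" using kCauchy_bounded[OF C] by blast
  have "(\<lambda>n. (nrm (u n))\<^sup>2) \<longlonglongrightarrow> 0"
  proof (rule LIMSEQ_I)
    fix e :: real assume e: "e > 0"
    define e' where "e' = e / (2 * (M + 1))"
    have e': "e' > 0" using e M by (simp add: e'_def)
    obtain N where N: "\<And>m n. \<lbrakk>m \<ge> N; n \<ge> N\<rbrakk> \<Longrightarrow> nrm (ldiff (u m) (u n)) < e'"
      using C e' unfolding kCauchy_def by meson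
    obtain N' where N': "\<And>n. n \<ge> N' \<Longrightarrow> cmod (form (u n) (u N)) < e / 2"
      using LIMSEQ_D[OF form_tendsto_0[OF 0, of "u N"], of "e / 2"] e by auto
    have "(nrm (u n))\<^sup>2 < e" if n: "n \<ge> max N N'" for n
    proof -
      have "form (u n) (u n) = form (u n) (ldiff (u n) (u N)) + form (u n) (u N)"
        by (simp add: kform_simps)
      then have "cmod (form (u n) (u n)) \<le> cmod (form (u n) (ldiff (u n) (u N)))
        + cmod (form (u n) (u N))"
        by (simp add: norm_triangle_ineq)
      moreover have "cmod (form (u n) (u n)) = (nrm (u n))\<^sup>2" by (simp add: form_self norm_power)
      moreover have "cmod (form (u n) (ldiff (u n) (u N))) \<le> M * e'"
        using form_cauchy_schwarz[of "u n" "ldiff (u n) (u N)"] N[of n N] n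
          mult_mono[of "nrm (u n)" M "nrm (ldiff (u n) (u N))" e'] M by fastforce
      moreover have "M * e' \<le> e / 2"
        using e M by (simp add: e'_def field_simps)
      moreover have "cmod (form (u n) (u N)) < e / 2" using N' n by simp
      ultimately show ?thesis by linarith
    qed
    then show "\<exists>no. \<forall>n\<ge>no. norm ((nrm (u n))\<^sup>2 - 0) < e" by (intro exI[of _ "max N N'"]) simp
  qed
  then have "(\<lambda>n. sqrt ((nrm (u n))\<^sup>2)) \<longlonglongrightarrow> sqrt 0" by (rule tendsto_real_sqrt)
  then show ?thesis by simp
qed

lemma representsD:
  assumes "represents s f"
  shows "kCauchy s" "(\<lambda>n. ev (s n) q) \<longlonglongrightarrow> f q"
  using assms by (auto simp: represents_def)

lemma represents_nrm_ldiff: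
  assumes "represents s f" "represents s' f"
  shows "(\<lambda>n. nrm (ldiff (s n) (s' n))) \<longlonglongrightarrow> 0"
proof (rule nrm_tendsto_0)
  show "kCauchy (\<lambda>n. ldiff (s n) (s' n))"
    using assms by (intro kCauchy_ldiff representsD(1))
  show "(\<lambda>n. ev (ldiff (s n) (s' n)) q) \<longlonglongrightarrow> 0" for q
    using tendsto_diff[OF representsD(2)[OF assms(1), of q] representsD(2)[OF assms(2), of q]]
    by (simp add: ev_def kform_simps)
qed

lemma form_tendsto_kip:
  assumes s: "represents s f" and t: "represents t g"
  shows "(\<lambda>n. form (s n) (t n)) \<longlonglongrightarrow> kip f g"
proof -
  define s' where "s' = (SOME s. represents s f)"
  define t' where "t' = (SOME t. represents t g)"
  have s': "represents s' f" unfolding s'_def by (rule someI[of "\<lambda>s. represents s f", OF s])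
  have t': "represents t' g" unfolding t'_def by (rule someI[of "\<lambda>t. represents t g", OF t])
  obtain M where M: "\<And>n. nrm (s' n) \<le> M" "M \<ge> 0" using kCauchy_bounded[OF representsD(1)[OF s']]
    by blast
  obtain M' where M': "\<And>n. nrm (t n) \<le> M'" "M' \<ge> 0" using kCauchy_bounded[OF representsD(1)[OF t]]
    by blast
  have lim: "(\<lambda>n. form (s' n) (t' n)) \<longlonglongrightarrow> kip f g"
    unfolding kip_def s'_def[symmetric] t'_def[symmetric]
    using convergent_form[OF representsD(1)[OF s'] representsD(1)[OF t']] convergent_LIMSEQ_iff by blast
  have "(\<lambda>n. form (s n) (t n) - form (s' n) (t' n)) \<longlonglongrightarrow> 0"
  proof (rule Lim_null_comparison)
    have "(\<lambda>n. nrm (ldiff (s n) (s' n)) * M' + M * nrm (ldiff (t n) (t' n))) \<longlonglongrightarrow> 0 * M' + M * 0"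
      by (intro tendsto_intros represents_nrm_ldiff[OF s s'] represents_nrm_ldiff[OF t t'])
    then show "(\<lambda>n. nrm (ldiff (s n) (s' n)) * M' + M * nrm (ldiff (t n) (t' n))) \<longlonglongrightarrow> 0" by simp
    have "nrm (ldiff (s n) (s' n)) * nrm (t n) + nrm (s' n) * nrm (ldiff (t n) (t' n))
        \<le> nrm (ldiff (s n) (s' n)) * M' + M * nrm (ldiff (t n) (t' n))" for n
      using M M' by (intro add_mono mult_left_mono mult_right_mono) auto
    then show "\<forall>\<^sub>F n in sequentially. norm (form (s n) (t n) - form (s' n) (t' n))
        \<le> nrm (ldiff (s n) (s' n)) * M' + M * nrm (ldiff (t n) (t' n))"
      using form_diff_le order_trans by (intro always_eventually allI) blast
  qed
  from tendsto_add[OF this lim] show ?thesis by simp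
qed

lemma represents_const: "represents (\<lambda>_. xs) (ev xs)"
  by (simp add: represents_def kCauchy_def nrm_def kform_simps)

lemma represents_add:
  assumes "represents s f" "represents t g"
  shows "represents (\<lambda>n. s n @ t n) (\<lambda>q. f q + g q)"
proof -
  have e: "represents (\<lambda>n. lscale (-1) (t n)) (\<lambda>q. - g q)"
    unfolding represents_def
  proof
    have "nrm (ldiff (lscale (-1) (t m)) (lscale (-1) (t n))) = nrm (ldiff (t m) (t n))" for m n
      by (simp add: nrm_def kform_simps)
    then show "kCauchy (\<lambda>n. lscale (-1) (t n))"
      using representsD(1)[OF assms(2)] by (simp add: kCauchy_def)
    show "\<forall>q. (\<lambda>n. ev (lscale (- 1) (t n)) q) \<longlonglongrightarrow> - g q"
      using tendsto_minus[OF representsD(2)[OF assms(2)]] by (simp add: ev_def kform_simps)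
  qed
  have "kCauchy (\<lambda>n. ldiff (s n) (lscale (-1) (t n)))"
    using kCauchy_ldiff[OF representsD(1)[OF assms(1)] representsD(1)[OF e]] .
  moreover have "ldiff (s n) (lscale (-1) (t n)) = s n @ t n" for n
    by (simp add: ldiff_def lscale_def o_def apfst_def map_prod_def case_prod_beta)
  ultimately have "kCauchy (\<lambda>n. s n @ t n)" by simp
  then show ?thesis
    using tendsto_add[OF representsD(2)[OF assms(1)] representsD(2)[OF assms(2)]]
    by (simp add: represents_def ev_def kform_simps)
qed

lemma represents_smult:
  assumes "represents s f"
  shows "represents (\<lambda>n. lscale c (s n)) (\<lambda>q. c * f q)"
proof -
  have "nrm (ldiff (lscale c (s m)) (lscale c (s n))) = cmod c * nrm (ldiff (s m) (s n))" for m n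
  proof -
    have "nrm (ldiff (lscale c (s m)) (lscale c (s n))) = nrm (lscale c (ldiff (s m) (s n)))"
      by (simp add: nrm_def kform_simps algebra_simps)
    then show ?thesis by (simp add: nrm_lscale)
  qed
  moreover have "\<exists>N. \<forall>m\<ge>N. \<forall>n\<ge>N. cmod c * nrm (ldiff (s m) (s n)) < e" if e: "e > 0" for e
  proof -
    have "e / (cmod c + 1) > 0" using e by (simp add: add_nonneg_pos)
    then obtain N where N: "\<And>m n. \<lbrakk>m \<ge> N; n \<ge> N\<rbrakk> \<Longrightarrow> nrm (ldiff (s m) (s n)) < e / (cmod c + 1)"
      using representsD(1)[OF assms] unfolding kCauchy_def by meson
    have "cmod c * nrm (ldiff (s m) (s n)) < e" if "m \<ge> N" "n \<ge> N" for m n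
    proof -
      have "cmod c * nrm (ldiff (s m) (s n)) \<le> (cmod c + 1) * nrm (ldiff (s m) (s n))"
        by (intro mult_right_mono) auto
      also have "\<dots> < e" using N[OF that] by (simp add: pos_less_divide_eq add_nonneg_pos mult.commute)
      finally show ?thesis .
    qed
    then show ?thesis by blast
  qed
  ultimately show ?thesis
    using tendsto_mult_left[OF representsD(2)[OF assms]]
    by (simp add: represents_def kCauchy_def ev_def kform_simps)
qed

lemma represents_diff:
  assumes "represents s f" "represents t g"
  shows "represents (\<lambda>n. ldiff (s n) (t n)) (\<lambda>q. f q - g q)"
  using represents_add[OF assms(1) represents_smult[OF assms(2), of "-1"]] by (simp add: ldiff_def)

definition rspace :: "('s \<Rightarrow> complex) set" where
  "rspace = {f. \<exists>s. represents s f}"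

lemma ev_in_rspace: "ev xs \<in> rspace"
  using represents_const by (auto simp: rspace_def)

lemma rspace_zero: "(\<lambda>q. 0) \<in> rspace"
proof -
  have "ev [] = (\<lambda>q. 0)" by (simp add: fun_eq_iff ev_def)
  with ev_in_rspace[of "[]"] show ?thesis by simp
qed

lemma rspace_add: "\<lbrakk>f \<in> rspace; g \<in> rspace\<rbrakk> \<Longrightarrow> (\<lambda>q. f q + g q) \<in> rspace"
  unfolding rspace_def using represents_add by blast

lemma rspace_smult: "f \<in> rspace \<Longrightarrow> (\<lambda>q. c * f q) \<in> rspace"
  unfolding rspace_def using represents_smult by blast

lemma kip_add:
  assumes "f \<in> rspace" "g \<in> rspace" "h \<in> rspace"
  shows "kip (\<lambda>q. f q + g q) h = kip f h + kip g h"
proof -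
  obtain s t u where r: "represents s f" "represents t g" "represents u h"
    using assms by (auto simp: rspace_def)
  have "(\<lambda>n. form (s n @ t n) (u n)) \<longlonglongrightarrow> kip f h + kip g h"
    using tendsto_add[OF form_tendsto_kip[OF r(1,3)] form_tendsto_kip[OF r(2,3)]]
      by (simp add: kform_simps)
  then show ?thesis
    using form_tendsto_kip[OF represents_add[OF r(1,2)] r(3)] LIMSEQ_unique by blast
qed

lemma kip_smult:
  assumes "f \<in> rspace" "g \<in> rspace"
  shows "kip (\<lambda>q. c * f q) g = c * kip f g"
proof -
  obtain s t where r: "represents s f" "represents t g"
    using assms by (auto simp: rspace_def)
  have "(\<lambda>n. form (lscale c (s n)) (t n)) \<longlonglongrightarrow> c * kip f g"
    using tendsto_mult_left[OF form_tendsto_kip[OF r]] by (simp add: kform_simps)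
  then show ?thesis
    using form_tendsto_kip[OF represents_smult[OF r(1)] r(2)] LIMSEQ_unique by blast
qed

lemma kip_commute:
  assumes "f \<in> rspace" "g \<in> rspace"
  shows "kip f g = cnj (kip g f)"
proof -
  obtain s t where r: "represents s f" "represents t g"
    using assms by (auto simp: rspace_def)
  have "(\<lambda>n. form (s n) (t n)) \<longlonglongrightarrow> cnj (kip g f)"
    using tendsto_cnj[OF form_tendsto_kip[OF r(2,1)]] form_commute[symmetric] by simp
  then show ?thesis using form_tendsto_kip[OF r] LIMSEQ_unique by blast
qed

lemma nrm_tendsto_kip:
  assumes "represents s f"
  shows "(\<lambda>n. (nrm (s n))\<^sup>2) \<longlonglongrightarrow> Re (kip f f)"
  using tendsto_Re[OF form_tendsto_kip[OF assms assms]] by (simp add: nrm_square)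

lemma kip_self_nonneg:
  assumes "f \<in> rspace"
  shows "0 \<le> Re (kip f f)"
proof -
  obtain s where s: "represents s f" using assms by (auto simp: rspace_def)
  show ?thesis by (rule LIMSEQ_le_const[OF nrm_tendsto_kip[OF s]]) simp
qed

lemma kip_self_zero:
  assumes "f \<in> rspace" "kip f f = 0"
  shows "f q = 0"
proof -
  obtain s where s: "represents s f" using assms by (auto simp: rspace_def)
  have "(\<lambda>n. (nrm (s n))\<^sup>2) \<longlonglongrightarrow> 0" using nrm_tendsto_kip[OF s] assms(2) by simp
  then have "(\<lambda>n. sqrt ((nrm (s n))\<^sup>2)) \<longlonglongrightarrow> sqrt 0" by (rule tendsto_real_sqrt)
  then have 0: "(\<lambda>n. nrm (s n)) \<longlonglongrightarrow> 0" by simp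
  have "(\<lambda>n. ev (s n) q) \<longlonglongrightarrow> 0"
  proof (rule Lim_null_comparison)
    show "\<forall>\<^sub>F n in sequentially. norm (ev (s n) q) \<le> nrm (s n) * nrm [(1, q)]"
      unfolding ev_def by (intro always_eventually allI form_cauchy_schwarz)
    show "(\<lambda>n. nrm (s n) * nrm [(1, q)]) \<longlonglongrightarrow> 0"
      using tendsto_mult_right[OF 0, of "nrm [(1, q)]"] by simp
  qed
  then show ?thesis using representsD(2)[OF s] LIMSEQ_unique by blast
qed

lemma kip_ev: "kip (ev xs) (ev ys) = form xs ys"
  by (rule LIMSEQ_unique[OF form_tendsto_kip[OF represents_const represents_const] tendsto_const])

lemma kip_reproducing:
  assumes "f \<in> rspace"
  shows "kip f (ev [(1, q)]) = f q"
proof -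
  obtain s where s: "represents s f" using assms by (auto simp: rspace_def)
  have "(\<lambda>n. form (s n) [(1, q)]) \<longlonglongrightarrow> f q"
    using representsD(2)[OF s, of q] by (simp add: ev_def)
  then show ?thesis
    by (rule LIMSEQ_unique[OF form_tendsto_kip[OF s represents_const]])
qed

lemma rspace_approx:
  assumes f: "f \<in> rspace" and e: "e > 0"
  obtains xs where "sqrt (Re (kip (\<lambda>q. f q - ev xs q) (\<lambda>q. f q - ev xs q))) < e"
proof -
  obtain s where s: "represents s f" using f by (auto simp: rspace_def)
  obtain N where N: "\<And>m n. \<lbrakk>m \<ge> N; n \<ge> N\<rbrakk> \<Longrightarrow> nrm (ldiff (s m) (s n)) < e / 2"
    using representsD(1)[OF s] e unfolding kCauchy_def by (meson half_gt_zero)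
  have "represents (\<lambda>m. ldiff (s m) (s N)) (\<lambda>q. f q - ev (s N) q)"
    by (rule represents_diff[OF s represents_const])
  from nrm_tendsto_kip[OF this]
  have "Re (kip (\<lambda>q. f q - ev (s N) q) (\<lambda>q. f q - ev (s N) q)) \<le> (e / 2)\<^sup>2"
  proof (rule LIMSEQ_le_const2)
    have "(nrm (ldiff (s m) (s N)))\<^sup>2 \<le> (e / 2)\<^sup>2" if "m \<ge> N" for m
      using N[of m N] that by (intro power_mono) auto
    then show "\<exists>M. \<forall>m\<ge>M. (nrm (ldiff (s m) (s N)))\<^sup>2 \<le> (e / 2)\<^sup>2" by blast
  qed
  then have "sqrt (Re (kip (\<lambda>q. f q - ev (s N) q) (\<lambda>q. f q - ev (s N) q))) \<le> sqrt ((e / 2)\<^sup>2)"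
    by (rule real_sqrt_le_mono)
  also have "\<dots> < e" using e by simp
  finally show thesis by (rule that)
qed

end

text \<open>
The injection \<open>tag\<close> places the function space inside a given type, such as a summand of a sum
type.
\<close>

locale tagged_kernel = positive_kernel K for K :: "'s \<Rightarrow> 's \<Rightarrow> complex" +
  fixes tag :: "('s \<Rightarrow> complex) \<Rightarrow> 'x"
  assumes inj_tag: "inj tag"
begin

definition untag :: "'x \<Rightarrow> 's \<Rightarrow> complex" where
  "untag = inv_into UNIV tag"

lemma untag_tag [simp]: "untag (tag f) = f"
  unfolding untag_def using inj_tag by simp

text \<open>
The reproducing kernel Hilbert space of \<open>K\<close>.
\<close>

definition kernel_space :: "'x hilbert" where
  "kernel_space =
    \<lparr>carrier = tag ` rspace,
     mult = (\<lambda>x y. x),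
     one = tag (\<lambda>q. 0),
     zero = tag (\<lambda>q. 0),
     add = (\<lambda>x y. tag (\<lambda>q. untag x q + untag y q)),
     smult = (\<lambda>a x. tag (\<lambda>q. a * untag x q)),
     inner_prod = (\<lambda>x y. kip (untag x) (untag y))\<rparr>"

lemma kernel_space_simps [simp]:
  "carrier kernel_space = tag ` rspace"
  "zero kernel_space = tag (\<lambda>q. 0)"
  "add kernel_space x y = tag (\<lambda>q. untag x q + untag y q)"
  "smult kernel_space a x = tag (\<lambda>q. a * untag x q)"
  "ip kernel_space x y = kip (untag x) (untag y)"
  by (simp_all add: kernel_space_def)

lemma tag_eq_iff: "tag f = tag g \<longleftrightarrow> f = g"
  using inj_tag by (simp add: inj_eq)

lemma kernel_space_pre_hilbert: "complex_pre_hilbert_space kernel_space"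
proof -
  have "Module.module ring_of_type_algebra kernel_space"
  proof (rule moduleI)
    show "cring (ring_of_type_algebra :: complex ring)" by (rule cring_from_type_algebra)
    show "abelian_group kernel_space"
    proof (rule abelian_groupI)
      fix x assume "x \<in> carrier kernel_space"
      then obtain f where "x = tag f" "f \<in> rspace" by auto
      then show "\<exists>y\<in>carrier kernel_space. y \<oplus>\<^bsub>kernel_space\<^esub> x = \<zero>\<^bsub>kernel_space\<^esub>"
        using rspace_smult[of f "-1"] by (intro bexI[of _ "tag (\<lambda>q. - 1 * f q)"]) auto
    qed (auto simp: rspace_zero rspace_add ac_simps)
  qed (auto simp: rspace_smult algebra_simps)
  then interpret Module.module "ring_of_type_algebra :: complex ring" kernel_space .
  show ?thesis
  proof
    fix x assume "x \<in> carrier kernel_space"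
    then obtain f where f: "x = tag f" "f \<in> rspace" by auto
    have "Im (kip f f) = 0"
      using arg_cong[OF kip_commute[OF f(2,2)], of Im] by simp
    then show "ip kernel_space x x \<in> \<real>\<^sub>\<ge>\<^sub>0"
      using kip_self_nonneg[OF f(2)] f by (simp add: complex_nonneg_Reals_iff)
    show "x = \<zero>\<^bsub>kernel_space\<^esub>" if "ip kernel_space x x = 0"
      using kip_self_zero[OF f(2)] that f by (auto simp: tag_eq_iff)
  qed (auto simp: kip_add kip_smult intro: kip_commute)
qed

lemma kernel_space_minus:
  assumes "x \<in> carrier kernel_space" "y \<in> carrier kernel_space"
  shows "x \<ominus>\<^bsub>kernel_space\<^esub> y = tag (\<lambda>q. untag x q - untag y q)"
proof -
  interpret complex_pre_hilbert_space kernel_space by (rule kernel_space_pre_hilbert)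
  have "(-1) \<odot>\<^bsub>kernel_space\<^esub> y \<in> carrier kernel_space" using assms(2) by blast
  moreover have "(-1) \<odot>\<^bsub>kernel_space\<^esub> y \<oplus>\<^bsub>kernel_space\<^esub> y = \<zero>\<^bsub>kernel_space\<^esub>" by simp
  ultimately have "\<ominus>\<^bsub>kernel_space\<^esub> y = (-1) \<odot>\<^bsub>kernel_space\<^esub> y"
    using assms(2) by (intro minus_equality) auto
  then show ?thesis by (simp add: a_minus_def)
qed

text \<open>
A Cauchy sequence in the space is approximated, with errors tending to zero, by finite
combinations; these form a Cauchy sequence of combinations and so represent an element of the
space.
\<close>

theorem kernel_space_hilbert: "complex_hilbert_space kernel_space"
proof -
  interpret complex_pre_hilbert_space kernel_space by (rule kernel_space_pre_hilbert)
  let ?S = kernel_space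
  have hn: "hnorm ?S (tag f \<ominus>\<^bsub>?S\<^esub> tag g)
      = sqrt (Re (kip (\<lambda>q. f q - g q) (\<lambda>q. f q - g q)))" if "f \<in> rspace" "g \<in> rspace" for f g
    using that kernel_space_minus[of "tag f" "tag g"] by (simp add: hnorm_def)
  have "\<exists>l\<in>carrier ?S. (\<lambda>n. hnorm ?S (x n \<ominus>\<^bsub>?S\<^esub> l)) \<longlonglongrightarrow> 0"
    if x: "\<forall>n. x n \<in> carrier ?S"
      and C: "\<forall>e>0. \<exists>N. \<forall>m\<ge>N. \<forall>n\<ge>N. hnorm ?S (x m \<ominus>\<^bsub>?S\<^esub> x n) < e" for x
  proof -
    have "\<exists>xs. hnorm ?S (x n \<ominus>\<^bsub>?S\<^esub> tag (ev xs)) < inverse (real (Suc n))" for n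
    proof -
      obtain f where f: "x n = tag f" "f \<in> rspace" using x by auto
      obtain xs where "sqrt (Re (kip (\<lambda>q. f q - ev xs q) (\<lambda>q. f q - ev xs q))) < inverse (real (Suc n))"
        using rspace_approx[OF f(2), of "inverse (real (Suc n))"] by auto
      then show ?thesis using hn[OF f(2) ev_in_rspace, of xs] f(1) by (intro exI[of _ xs]) simp
    qed
    then obtain c where c: "\<And>n. hnorm ?S (x n \<ominus>\<^bsub>?S\<^esub> tag (ev (c n))) < inverse (real (Suc n))"
      by metis
    let ?c = "\<lambda>n. tag (ev (c n))"
    have cc: "?c n \<in> carrier ?S" for n using ev_in_rspace by simp
    have xc: "x n \<in> carrier ?S" for n using x by blast
    have nrm_c: "nrm (ldiff (c m) (c n)) = hnorm ?S (?c m \<ominus>\<^bsub>?S\<^esub> ?c n)" for m n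
    proof -
      have "(\<lambda>q. ev (c m) q - ev (c n) q) = ev (ldiff (c m) (c n))"
        by (simp add: ev_def kform_simps fun_eq_iff)
      then show ?thesis using hn[OF ev_in_rspace ev_in_rspace] by (simp add: kip_ev nrm_def)
    qed
    have Cc: "kCauchy c" unfolding kCauchy_def nrm_c
    proof (intro allI impI)
      fix e :: real assume e: "e > 0"
      then have "e / 3 > 0" by simp
      then obtain N1 where N1: "inverse (real (Suc N1)) < e / 3" using reals_Archimedean by blast
      obtain N2 where N2: "\<And>m n. \<lbrakk>m \<ge> N2; n \<ge> N2\<rbrakk> \<Longrightarrow> hnorm ?S (x m \<ominus>\<^bsub>?S\<^esub> x n) < e / 3"
        using C \<open>e / 3 > 0\<close> by meson
      show "\<exists>N. \<forall>m\<ge>N. \<forall>n\<ge>N. hnorm ?S (?c m \<ominus>\<^bsub>?S\<^esub> ?c n) < e"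
      proof (intro exI allI impI)
        fix m n assume mn: "max N1 N2 \<le> m" "max N1 N2 \<le> n"
        then have "inverse (real (Suc m)) \<le> inverse (real (Suc N1))" "inverse (real (Suc n))
          \<le> inverse (real (Suc N1))"
          by simp_all
        moreover have "hnorm ?S (?c m \<ominus>\<^bsub>?S\<^esub> ?c n)
            \<le> hnorm ?S (?c m \<ominus>\<^bsub>?S\<^esub> x m)
              + (hnorm ?S (x m \<ominus>\<^bsub>?S\<^esub> x n) + hnorm ?S (x n \<ominus>\<^bsub>?S\<^esub> ?c n))"
          using hnorm_triangle_minus[OF cc[of m] xc[of m] cc[of n]] hnorm_triangle_minus[OF xc[of m]
            xc[of n] cc[of n]]
          by linarith
        moreover have "hnorm ?S (x m \<ominus>\<^bsub>?S\<^esub> x n) < e / 3"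
          using N2[of m n] mn by simp
        ultimately show "hnorm ?S (?c m \<ominus>\<^bsub>?S\<^esub> ?c n) < e"
          using c[of m] c[of n] N1 hnorm_minus_commute[OF cc[of m] xc[of m]] by linarith
      qed
    qed
    define f where "f q = lim (\<lambda>n. ev (c n) q)" for q
    have "kCauchy (\<lambda>_. [(1, q)])" for q using representsD(1)[OF represents_const] .
    then have "convergent (\<lambda>n. form (c n) [(1, q)])" for q
      by (rule convergent_form[OF Cc])
    then have "(\<lambda>n. ev (c n) q) \<longlonglongrightarrow> f q" for q
      by (simp add: f_def ev_def convergent_LIMSEQ_iff)
    with Cc have rep: "represents c f" by (simp add: represents_def)
    then have f: "f \<in> rspace" by (auto simp: rspace_def)
    have lim: "(\<lambda>n. hnorm ?S (?c n \<ominus>\<^bsub>?S\<^esub> tag f)) \<longlonglongrightarrow> 0"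
    proof (rule LIMSEQ_I)
      fix e :: real assume e: "e > 0"
      obtain N where N: "\<And>m n. \<lbrakk>m \<ge> N; n \<ge> N\<rbrakk> \<Longrightarrow> nrm (ldiff (c m) (c n)) < e / 2"
        using Cc e unfolding kCauchy_def by (meson half_gt_zero)
      have "hnorm ?S (?c n \<ominus>\<^bsub>?S\<^esub> tag f) < e" if n: "n \<ge> N" for n
      proof -
        have "Re (kip (\<lambda>q. ev (c n) q - f q) (\<lambda>q. ev (c n) q - f q)) \<le> (e / 2)\<^sup>2"
        proof (rule LIMSEQ_le_const2[OF nrm_tendsto_kip[OF represents_diff[OF represents_const rep]]])
          have "(nrm (ldiff (c n) (c m)))\<^sup>2 \<le> (e / 2)\<^sup>2" if "m \<ge> N" for m
            using N[of n m] n that by (intro power_mono) auto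
          then show "\<exists>M. \<forall>m\<ge>M. (nrm (ldiff (c n) (c m)))\<^sup>2 \<le> (e / 2)\<^sup>2" by blast
        qed
        then have "hnorm ?S (?c n \<ominus>\<^bsub>?S\<^esub> tag f) \<le> sqrt ((e / 2)\<^sup>2)"
          unfolding hn[OF ev_in_rspace f] by (rule real_sqrt_le_mono)
        also have "\<dots> < e" using e by simp
        finally show ?thesis .
      qed
      moreover have "tag f \<in> carrier ?S" using f by simp
      ultimately show "\<exists>no. \<forall>n\<ge>no. norm (hnorm ?S (?c n \<ominus>\<^bsub>?S\<^esub> tag f) - 0) < e"
        using hnorm_nonneg[OF minus_carrier[OF cc]]
          by (intro exI[of _ N]) (simp del: kernel_space_simps)
    qed
    have tf: "tag f \<in> carrier ?S" using f by simp
    have "(\<lambda>n. hnorm ?S (x n \<ominus>\<^bsub>?S\<^esub> tag f)) \<longlonglongrightarrow> 0"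
    proof (rule Lim_null_comparison)
      have "hnorm ?S (x n \<ominus>\<^bsub>?S\<^esub> tag f)
          \<le> inverse (real (Suc n)) + hnorm ?S (?c n \<ominus>\<^bsub>?S\<^esub> tag f)" for n
        using hnorm_triangle_minus[OF xc cc tf, of n n] c[of n] by linarith
      then show "\<forall>\<^sub>F n in sequentially. norm (hnorm ?S (x n \<ominus>\<^bsub>?S\<^esub> tag f))
          \<le> inverse (real (Suc n)) + hnorm ?S (?c n \<ominus>\<^bsub>?S\<^esub> tag f)"
        using hnorm_nonneg[OF minus_carrier[OF xc tf]] by (intro always_eventually allI) simp
      show "(\<lambda>n. inverse (real (Suc n)) + hnorm ?S (?c n \<ominus>\<^bsub>?S\<^esub> tag f)) \<longlonglongrightarrow> 0"
        using tendsto_add[OF LIMSEQ_inverse_real_of_nat lim] by simp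
    qed
    with tf show ?thesis by blast
  qed
  then have compl: "Metric_space.mcomplete (carrier ?S)
      (\<lambda>x y. if x \<in> carrier ?S \<and> y \<in> carrier ?S then hdist kernel_space x y else 0)"
    unfolding mcomplete_iff_Cauchy_convergent by blast
  show ?thesis
    by unfold_locales
      (fact inner_prod_add inner_prod_smult inner_prod_commute inner_prod_nonneg
        inner_prod_definite compl)+
qed

definition kfun :: "'s \<Rightarrow> 'x" where
  "kfun p = tag (K p)"

lemma ev_single: "ev [(1, p)] = K p"
  by (simp add: ev_def kform_def fun_eq_iff)

lemma kfun_carrier: "kfun p \<in> carrier kernel_space"
  using ev_in_rspace[of "[(1, p)]"] by (simp add: kfun_def ev_single)

lemma inner_kfun: "ip kernel_space (kfun p) (kfun q) = K p q"
  using kip_reproducing[OF ev_in_rspace, of "[(1, p)]" q] by (simp add: kfun_def ev_single)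

definition shift_op :: "('s \<Rightarrow> 's) \<Rightarrow> 'x \<Rightarrow> 'x" where
  "shift_op \<theta> x = tag (\<lambda>q. untag x (inv_into UNIV \<theta> q))"

lemma shift_op_kfun:
  assumes "bij \<theta>" "\<And>p q. K (\<theta> p) (\<theta> q) = K p q"
  shows "shift_op \<theta> (kfun p) = kfun (\<theta> p)"
proof -
  have "K p (inv_into UNIV \<theta> q) = K (\<theta> p) q" for q
    using assms(2)[of p "inv_into UNIV \<theta> q"] bij_is_surj[OF assms(1)] by (simp add: surj_f_inv_f)
  then show ?thesis by (simp add: shift_op_def kfun_def)
qed

lemma represents_shift:
  assumes \<theta>: "bij \<theta>" "\<And>p q. K (\<theta> p) (\<theta> q) = K p q" and s: "represents s f"
  shows "represents (\<lambda>n. map (apsnd \<theta>) (s n)) (\<lambda>q. f (inv_into UNIV \<theta> q))"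
proof -
  have form: "form (map (apsnd \<theta>) xs) (map (apsnd \<theta>) ys) = form xs ys" for xs ys
    by (simp add: kform_def o_def \<theta>(2))
  have diff: "ldiff (map (apsnd \<theta>) xs) (map (apsnd \<theta>) ys) = map (apsnd \<theta>) (ldiff xs ys)" for xs ys
    by (simp add: ldiff_def lscale_def)
  have "ev (map (apsnd \<theta>) xs) q = ev xs (inv_into UNIV \<theta> q)" for xs q
    using form[of xs "[(1, inv_into UNIV \<theta> q)]"] bij_is_surj[OF \<theta>(1)] by (simp add: ev_def surj_f_inv_f)
  then show ?thesis
    using s by (simp add: represents_def kCauchy_def diff nrm_def form)
qed

text \<open>
A bijection of the points that preserves the kernel maps representing Cauchy sequences to
representing Cauchy sequences with the same products; the inverse bijection gives surjectivity.
\<close>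

lemma unitary_shift_op:
  assumes \<theta>: "bij \<theta>" "\<And>p q. K (\<theta> p) (\<theta> q) = K p q"
  shows "unitary_op kernel_space (shift_op \<theta>)"
proof -
  have closed: "(\<lambda>q. f (inv_into UNIV \<theta> q)) \<in> rspace" if "f \<in> rspace" for f
    using that represents_shift[OF \<theta>] unfolding rspace_def by blast
  have kip: "kip (\<lambda>q. f (inv_into UNIV \<theta> q)) (\<lambda>q. f (inv_into UNIV \<theta> q)) = kip f f"
    if f: "f \<in> rspace" for f
  proof -
    obtain s where s: "represents s f" using f by (auto simp: rspace_def)
    have "(\<lambda>n. form (s n) (s n)) \<longlonglongrightarrow> kip (\<lambda>q. f (inv_into UNIV \<theta> q)) (\<lambda>q. f (inv_into UNIV \<theta> q))"
      using form_tendsto_kip[OF represents_shift[OF \<theta> s] represents_shift[OF \<theta> s]]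
      by (simp add: kform_def o_def \<theta>(2))
    then show ?thesis using form_tendsto_kip[OF s s] LIMSEQ_unique by blast
  qed
  have inv: "bij (inv_into UNIV \<theta>)" "K (inv_into UNIV \<theta> p) (inv_into UNIV \<theta> q) = K p q" for p q
    using \<theta>(2)[of "inv_into UNIV \<theta> p" "inv_into UNIV \<theta> q"] bij_is_surj[OF \<theta>(1)] bij_imp_bij_inv[OF \<theta>(1)]
    by (simp_all add: surj_f_inv_f)
  have surj: "tag f \<in> shift_op \<theta> ` tag ` rspace" if f: "f \<in> rspace" for f
  proof -
    obtain s where s: "represents s f" using f by (auto simp: rspace_def)
    have "(\<lambda>q. f (\<theta> q)) \<in> rspace"
      using represents_shift[OF inv s] inv_inv_eq[OF \<theta>(1)] by (auto simp: rspace_def)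
    moreover have "shift_op \<theta> (tag (\<lambda>q. f (\<theta> q))) = tag f"
      using bij_is_surj[OF \<theta>(1)] by (simp add: shift_op_def surj_f_inv_f)
    ultimately show ?thesis by (metis image_eqI)
  qed
  have iso: "hnorm kernel_space (shift_op \<theta> x) = hnorm kernel_space x" if "x \<in> tag ` rspace" for x
    using that kip by (auto simp: hnorm_def shift_op_def)
  have into: "shift_op \<theta> \<in> tag ` rspace \<rightarrow> tag ` rspace"
    using closed by (auto simp: shift_op_def)
  have "bounded_op kernel_space kernel_space (shift_op \<theta>)"
    unfolding bounded_op_def
  proof (intro conjI)
    show "\<exists>M. \<forall>x\<in>carrier kernel_space. hnorm kernel_space (shift_op \<theta> x) \<le> M * hnorm kernel_space x"
      using iso by (intro exI[of _ 1]) simp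
  qed (use into in \<open>auto simp: shift_op_def\<close>)
  moreover have "shift_op \<theta> ` tag ` rspace = tag ` rspace"
    using into surj by blast
  ultimately show ?thesis
    using iso by (simp add: unitary_op_def isometry_op_def)
qed

lemma shift_op_commute:
  assumes "bij \<theta>" "bij \<eta>" "\<And>p. \<theta> (\<eta> p) = \<eta> (\<theta> p)"
  shows "shift_op \<theta> (shift_op \<eta> x) = shift_op \<eta> (shift_op \<theta> x)"
proof -
  have "inv_into UNIV \<eta> (inv_into UNIV \<theta> q) = inv_into UNIV \<theta> (inv_into UNIV \<eta> q)" for q
  proof -
    have "\<theta> \<circ> \<eta> = \<eta> \<circ> \<theta>" using assms(3) by auto
    then have "inv_into UNIV (\<theta> \<circ> \<eta>) = inv_into UNIV (\<eta> \<circ> \<theta>)" by simp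
    then show ?thesis
      by (simp add: o_inv_distrib[OF assms(1,2)] o_inv_distrib[OF assms(2,1)] fun_eq_iff)
  qed
  then show ?thesis by (simp add: shift_op_def)
qed

end

section \<open>Shift-invariant means of kernels\<close>

text \<open>
Tychonoff's theorem for a product of discs. The filter \<open>G\<close> serves as a generalized subsequence
along which all coordinates converge simultaneously, also when there are uncountably many of
them.
\<close>

lemma pointwise_bounded_seq_cluster:
  fixes A :: "nat \<Rightarrow> 'i \<Rightarrow> complex"
  assumes bound: "\<And>N i. cmod (A N i) \<le> M i"
  obtains G L where "G \<le> sequentially" "G \<noteq> bot" "\<And>i. ((\<lambda>N. A N i) \<longlongrightarrow> L i) G"
proof -
  let ?U = "PiE UNIV (\<lambda>i. cball (0 :: complex) (M i))"
  have "compactin (product_topology (\<lambda>i. euclidean :: complex topology) UNIV) ?U"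
    unfolding compactin_PiE by simp
  then have "compact ?U" by (simp add: euclidean_product_topology)
  moreover have "filtermap A sequentially \<noteq> bot" by (simp add: filtermap_bot_iff)
  moreover have "eventually (\<lambda>f. f \<in> ?U) (filtermap A sequentially)"
    using bound by (simp add: eventually_filtermap PiE_iff)
  ultimately obtain L where L: "inf (nhds L) (filtermap A sequentially) \<noteq> bot"
    unfolding compact_filter by blast
  define G where "G = inf sequentially (filtercomap A (nhds L))"
  have "G \<noteq> bot"
  proof
    assume "G = bot"
    then have "eventually (\<lambda>_. False) G" by simp
    then obtain P Q where P: "eventually P sequentially" and Q: "eventually Q (filtercomap A (nhds L))"
      and PQ: "\<And>N. P N \<Longrightarrow> Q N \<Longrightarrow> False"
      unfolding G_def eventually_inf by blast
    from Q obtain R where R: "eventually R (nhds L)" and RQ: "\<And>N. R (A N) \<Longrightarrow> Q N"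
      unfolding eventually_filtercomap by blast
    have "eventually (\<lambda>f. \<not> R f) (filtermap A sequentially)"
      unfolding eventually_filtermap using P by eventually_elim (use PQ RQ in blast)
    with R have "eventually (\<lambda>_. False) (inf (nhds L) (filtermap A sequentially))"
      unfolding eventually_inf by blast
    with L show False by (simp add: trivial_limit_def)
  qed
  moreover have "((\<lambda>N. A N i) \<longlongrightarrow> L i) G" for i
  proof -
    have "(A \<longlongrightarrow> L) G"
      unfolding filterlim_def filtermap_le_iff_le_filtercomap by (simp add: G_def)
    then show ?thesis
    proof (intro topological_tendstoI)
      fix S assume S: "open S" "L i \<in> S" and lim: "(A \<longlongrightarrow> L) G"
      have "open ((\<lambda>f. f i) -` S)"
        by (rule open_vimage[OF S(1) continuous_on_product_coordinates])
      from topological_tendstoD[OF lim this] S(2) show "\<forall>\<^sub>F N in G. A N i \<in> S" by simp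
    qed
  qed
  moreover have "G \<le> sequentially" by (simp add: G_def)
  ultimately show thesis using that by blast
qed

text \<open>
Shifting a box by one moves a proportion \<open>1/N\<close> of its points across the boundary.
\<close>

lemma box_average_shift_tendsto_0:
  fixes f :: "nat \<Rightarrow> nat \<Rightarrow> complex"
  assumes bound: "\<And>n m. cmod (f n m) \<le> M"
  shows "(\<lambda>N. (\<Sum>n<Suc N. \<Sum>m<Suc N. f (Suc n) m) / of_nat ((Suc N)\<^sup>2)
      - (\<Sum>n<Suc N. \<Sum>m<Suc N. f n m) / of_nat ((Suc N)\<^sup>2)) \<longlonglongrightarrow> 0"
proof (rule Lim_null_comparison)
  have "M \<ge> 0" using bound[of 0 0] norm_ge_zero order_trans by blast
  have "cmod ((\<Sum>n<Suc N. \<Sum>m<Suc N. f (Suc n) m) / of_nat ((Suc N)\<^sup>2)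
      - (\<Sum>n<Suc N. \<Sum>m<Suc N. f n m) / of_nat ((Suc N)\<^sup>2)) \<le> 2 * M * inverse (real (Suc N))" for N
  proof -
    have "(\<Sum>n<Suc N. \<Sum>m<Suc N. f (Suc n) m) - (\<Sum>n<Suc N. \<Sum>m<Suc N. f n m)
        = (\<Sum>n<Suc N. (\<Sum>m<Suc N. f (Suc n) m) - (\<Sum>m<Suc N. f n m))"
      by (rule sum_subtractf[symmetric])
    also have "\<dots> = (\<Sum>m<Suc N. f (Suc N) m) - (\<Sum>m<Suc N. f 0 m)"
      by (rule sum_lessThan_telescope)
    finally have eq: "(\<Sum>n<Suc N. \<Sum>m<Suc N. f (Suc n) m) - (\<Sum>n<Suc N. \<Sum>m<Suc N. f n m)
        = (\<Sum>m<Suc N. f (Suc N) m - f 0 m)" by (simp only: sum_subtractf)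
    have "cmod (\<Sum>m<Suc N. f (Suc N) m - f 0 m) \<le> (\<Sum>m<Suc N. 2 * M)"
    proof (rule sum_norm_le)
      fix m
      show "cmod (f (Suc N) m - f 0 m) \<le> 2 * M"
        using norm_triangle_ineq4[of "f (Suc N) m" "f 0 m"] bound[of "Suc N" m] bound[of 0 m]
          by linarith
    qed
    then have le: "cmod (\<Sum>m<Suc N. f (Suc N) m - f 0 m) \<le> real (Suc N) * (2 * M)" by simp
    have "cmod ((\<Sum>n<Suc N. \<Sum>m<Suc N. f (Suc n) m) / of_nat ((Suc N)\<^sup>2)
      - (\<Sum>n<Suc N. \<Sum>m<Suc N. f n m) / of_nat ((Suc N)\<^sup>2))
        = cmod (\<Sum>m<Suc N. f (Suc N) m - f 0 m) / (real (Suc N))\<^sup>2"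
      unfolding diff_divide_distrib[symmetric] eq norm_divide
      by (metis norm_of_nat of_nat_power)
    also have "\<dots> \<le> real (Suc N) * (2 * M) / (real (Suc N))\<^sup>2"
      using le by (intro divide_right_mono) auto
    also have "\<dots> = 2 * M * inverse (real (Suc N))"
      by (simp add: power2_eq_square divide_inverse del: of_nat_Suc)
    finally show ?thesis .
  qed
  then show "\<forall>\<^sub>F N in sequentially. norm ((\<Sum>n<Suc N. \<Sum>m<Suc N. f (Suc n) m) / of_nat ((Suc N)\<^sup>2)
      - (\<Sum>n<Suc N. \<Sum>m<Suc N. f n m) / of_nat ((Suc N)\<^sup>2)) \<le> 2 * M * inverse (real (Suc N))"
    by (intro always_eventually allI)
  show "(\<lambda>N. 2 * M * inverse (real (Suc N))) \<longlonglongrightarrow> 0"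
    using tendsto_mult_left[OF LIMSEQ_inverse_real_of_nat, of "2 * M"] by simp
qed

text \<open>
A cluster point of box averages over the quadrant takes the place of a Banach limit. It inherits
positivity, linear relations and constant values from the individual kernels, and in addition
turns equivariance under the two shifts into invariance.
\<close>

theorem ex_invariant_mean_kernel:
  fixes k :: "nat \<Rightarrow> nat \<Rightarrow> 's \<Rightarrow> 's \<Rightarrow> complex"
  assumes pos: "\<And>n m. positive_kernel (k n m)"
    and bound: "\<And>n m p q. cmod (k n m p q) \<le> M p q"
  obtains K where "positive_kernel K"
    and "\<And>xs ys. (\<And>n m. kform (k n m) xs ys = 0) \<Longrightarrow> kform K xs ys = 0"
    and "\<And>p q c. (\<And>n m. k n m p q = c) \<Longrightarrow> K p q = c"
    and "\<And>p q p' q'. (\<And>n m. k (Suc n) m p q = k n m p' q') \<Longrightarrow> K p' q' = K p q"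
    and "\<And>p q p' q'. (\<And>n m. k n (Suc m) p q = k n m p' q') \<Longrightarrow> K p' q' = K p q"
proof -
  define A where "A N p q = (\<Sum>n<Suc N. \<Sum>m<Suc N. k n m p q) / of_nat ((Suc N)\<^sup>2)" for N p q
  have A_bound: "cmod (A N p q) \<le> M p q" for N p q
  proof -
    have "cmod (\<Sum>n<Suc N. \<Sum>m<Suc N. k n m p q) \<le> (\<Sum>n<Suc N. \<Sum>m<Suc N. M p q)"
      by (intro sum_norm_le bound)
    also have "\<dots> = real (Suc N) * (real (Suc N) * M p q)" by simp
    also have "\<dots> = M p q * (real (Suc N))\<^sup>2" by (simp only: power2_eq_square ac_simps)
    finally have "cmod (\<Sum>n<Suc N. \<Sum>m<Suc N. k n m p q) \<le> M p q * (real (Suc N))\<^sup>2" .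
    moreover have "cmod (A N p q) = cmod (\<Sum>n<Suc N. \<Sum>m<Suc N. k n m p q) / (real (Suc N))\<^sup>2"
      unfolding A_def norm_divide by (metis norm_of_nat of_nat_power)
    ultimately show ?thesis by (simp add: pos_divide_le_eq del: of_nat_Suc)
  qed
  obtain G L where G: "G \<le> sequentially" "G \<noteq> bot"
    and L: "\<And>i. ((\<lambda>N. A N (fst i) (snd i)) \<longlongrightarrow> L i) G"
    using pointwise_bounded_seq_cluster[of "\<lambda>N i. A N (fst i) (snd i)" "\<lambda>i. M (fst i) (snd i)"] A_bound
    by metis
  define K where "K p q = L (p, q)" for p q
  have lim: "((\<lambda>N. A N p q) \<longlongrightarrow> K p q) G" for p q
    using L[of "(p, q)"] by (simp add: K_def)
  have uniq: "a = b" if "(f \<longlongrightarrow> a) G" "(f \<longlongrightarrow> b) G" for f :: "nat \<Rightarrow> complex" and a b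
    using tendsto_unique[OF G(2) that] .
  have kform_sum: "kform (\<lambda>p q. \<Sum>n\<in>I. h n p q) xs ys = (\<Sum>n\<in>I. kform (h n) xs ys)"
    for h :: "nat \<Rightarrow> 's \<Rightarrow> 's \<Rightarrow> complex" and I xs ys
  proof -
    have "(\<Sum>y\<leftarrow>ys. cnj (fst y) * (\<Sum>n\<in>I. h n p (snd y)))
        = (\<Sum>n\<in>I. \<Sum>y\<leftarrow>ys. cnj (fst y) * h n p (snd y))" for p
      by (induction ys) (simp_all add: sum.distrib sum_distrib_left)
    then show ?thesis
      unfolding kform_def by (induction xs) (simp_all add: sum.distrib sum_distrib_left)
  qed
  have kform_div: "kform (\<lambda>p q. h p q / c) xs ys = kform h xs ys / c"
    for h :: "'s \<Rightarrow> 's \<Rightarrow> complex" and c xs ys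
  proof -
    have "(\<Sum>y\<leftarrow>ys. cnj (fst y) * (h p (snd y) / c)) = (\<Sum>y\<leftarrow>ys. cnj (fst y) * h p (snd y)) / c" for p
      by (induction ys) (simp_all add: add_divide_distrib)
    then show ?thesis
      unfolding kform_def by (induction xs) (simp_all add: add_divide_distrib)
  qed
  have kform_A: "kform (A N) xs ys = (\<Sum>n<Suc N. \<Sum>m<Suc N. kform (k n m) xs ys) / of_nat ((Suc N)\<^sup>2)"
    for N xs ys
    unfolding A_def[abs_def] kform_div kform_sum ..
  have kform_lim: "((\<lambda>N. kform (A N) xs ys) \<longlongrightarrow> kform K xs ys) G" for xs ys
  proof -
    have "((\<lambda>N. \<Sum>y\<leftarrow>ys. cnj (fst y) * A N p (snd y)) \<longlongrightarrow> (\<Sum>y\<leftarrow>ys. cnj (fst y) * K p (snd y))) G" for p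
      by (induction ys) (auto intro!: tendsto_intros lim)
    then show ?thesis
      unfolding kform_def by (induction xs) (auto intro!: tendsto_intros)
  qed
  have "positive_kernel K"
  proof
    fix p q
    have "A N q p = cnj (A N p q)" for N
      unfolding A_def using positive_kernel.kernel_commute[OF pos, of _ _ q p] by simp
    then have "((\<lambda>N. A N q p) \<longlongrightarrow> cnj (K p q)) G" using tendsto_cnj[OF lim[of p q]] by simp
    then show "K q p = cnj (K p q)" using uniq lim by blast
  next
    fix xs
    have "0 \<le> Re (kform (A N) xs xs)" for N
    proof -
      have "0 \<le> (\<Sum>n<Suc N. \<Sum>m<Suc N. Re (kform (k n m) xs xs))"
        by (intro sum_nonneg positive_kernel.kernel_positive pos)
      then show ?thesis
        unfolding kform_A by (simp only: Re_divide_of_nat Re_sum) simp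
    qed
    then show "0 \<le> Re (kform K xs xs)"
      by (intro tendsto_lowerbound[OF tendsto_Re[OF kform_lim]]) (use G in auto)
  qed
  moreover have "kform K xs ys = 0" if "\<And>n m. kform (k n m) xs ys = 0" for xs ys
  proof -
    have "((\<lambda>N. kform (A N) xs ys) \<longlongrightarrow> 0) G" by (simp add: kform_A that)
    from uniq[OF kform_lim this] show ?thesis .
  qed
  moreover have "K p q = c" if "\<And>n m. k n m p q = c" for p q c
  proof -
    have "A N p q = c" for N
    proof -
      have "(\<Sum>n<Suc N. \<Sum>m<Suc N. k n m p q) = c * of_nat ((Suc N)\<^sup>2)"
        unfolding that by (simp add: power2_eq_square algebra_simps)
      then show ?thesis unfolding A_def by (simp del: of_nat_Suc of_nat_power)
    qed
    then have "((\<lambda>N. A N p q) \<longlongrightarrow> c) G" by simp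
    from uniq[OF lim this] show ?thesis .
  qed
  moreover have "K p' q' = K p q" if "\<And>n m. k (Suc n) m p q = k n m p' q'" for p q p' q'
  proof -
    have "(\<lambda>N. A N p' q' - A N p q) \<longlonglongrightarrow> 0"
      using box_average_shift_tendsto_0[of "\<lambda>n m. k n m p q" "M p q", OF bound]
        by (simp only: that A_def)
    then have "((\<lambda>N. A N p' q' - A N p q) \<longlongrightarrow> 0) G" by (rule tendsto_mono[OF G(1)])
    from uniq[OF this tendsto_diff[OF lim lim]] show ?thesis by simp
  qed
  moreover have "K p' q' = K p q" if "\<And>n m. k n (Suc m) p q = k n m p' q'" for p q p' q'
  proof -
    have swap: "A N r s = (\<Sum>m<Suc N. \<Sum>n<Suc N. k n m r s) / of_nat ((Suc N)\<^sup>2)" for N r s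
      unfolding A_def by (subst sum.swap) (rule refl)
    have "(\<lambda>N. A N p' q' - A N p q) \<longlonglongrightarrow> 0"
      using box_average_shift_tendsto_0[of "\<lambda>m n. k n m p q" "M p q", OF bound]
        by (simp only: that swap)
    then have "((\<lambda>N. A N p' q' - A N p q) \<longlongrightarrow> 0) G" by (rule tendsto_mono[OF G(1)])
    from uniq[OF this tendsto_diff[OF lim lim]] show ?thesis by simp
  qed
  ultimately show thesis by (rule that)
qed

section \<open>Quadratic pencils\<close>

text \<open>
Six values suffice: those at \<open>(0,0)\<close>, \<open>(1,0)\<close>, \<open>(2,0)\<close>, \<open>(0,1)\<close>, \<open>(0,2)\<close> and \<open>(1,1)\<close>.
\<close>

lemma quadratic_coeffs_unique:
  fixes a00 a01 a02 a10 a11 a20 b00 b01 b02 b10 b11 b20 :: complex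
  assumes "\<And>n m :: nat. a00 + of_nat m * a01 + of_nat m ^ 2 * a02 + of_nat n * a10
      + of_nat n * of_nat m * a11 + of_nat n ^ 2 * a20
    = b00 + of_nat m * b01 + of_nat m ^ 2 * b02 + of_nat n * b10
      + of_nat n * of_nat m * b11 + of_nat n ^ 2 * b20"
  shows "a00 = b00" "a01 = b01" "a02 = b02" "a10 = b10" "a11 = b11" "a20 = b20"
proof -
  show 00: "a00 = b00" using assms[where n=0 and m=0] by simp
  have m1: "a01 + a02 = b01 + b02" using assms[where n=0 and m=1] 00 by simp
  have m2: "2 * a01 + 4 * a02 = 2 * b01 + 4 * b02" using assms[where n=0 and m=2] 00 by simp
  have "2 * a02 = (2 * a01 + 4 * a02) - 2 * (a01 + a02)" by (simp add: algebra_simps)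
  also have "\<dots> = 2 * b02" unfolding m1 m2 by (simp add: algebra_simps)
  finally show 02: "a02 = b02" by simp
  show 01: "a01 = b01" using m1 02 by simp
  have n1: "a10 + a20 = b10 + b20" using assms[where n=1 and m=0] 00 by simp
  have n2: "2 * a10 + 4 * a20 = 2 * b10 + 4 * b20" using assms[where n=2 and m=0] 00 by simp
  have "2 * a20 = (2 * a10 + 4 * a20) - 2 * (a10 + a20)" by (simp add: algebra_simps)
  also have "\<dots> = 2 * b20" unfolding n1 n2 by (simp add: algebra_simps)
  finally show 20: "a20 = b20" by simp
  show 10: "a10 = b10" using n1 20 by simp
  show "a11 = b11" using assms[where n=1 and m=1] 00 01 02 10 20 by simp
qed

context complex_hilbert_space
begin

lemma inner_pencil:
  assumes B: "\<And>i j. i + j \<le> 2 \<Longrightarrow> bounded_op H H (B i j)"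
    and x: "x \<in> carrier H" and y: "y \<in> carrier H"
  shows pencil_carrier: "pencil H B \<alpha> \<beta> x \<in> carrier H"
    and "ip H (pencil H B \<alpha> \<beta> x) y
      = ip H (B 0 0 x) y + of_real \<beta> * ip H (B 0 1 x) y
        + of_real \<beta> ^ 2 * ip H (B 0 2 x) y + of_real \<alpha> * ip H (B 1 0 x) y
        + of_real \<alpha> * of_real \<beta> * ip H (B 1 1 x) y + of_real \<alpha> ^ 2 * ip H (B 2 0 x) y"
proof -
  have c: "B i j x \<in> carrier H" if "i \<in> {..2}" "j \<in> {..2 - i}" for i j
    using bounded_opD(1)[OF B x, of i j] that by auto
  have c': "(\<Oplus>j\<in>{..2 - i}. complex_of_real (\<alpha> ^ i * \<beta> ^ j) \<odot> B i j x) \<in> carrier H"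
    if "i \<in> {..2}" for i
    using c that by (intro finsum_closed) auto
  then show "pencil H B \<alpha> \<beta> x \<in> carrier H"
    unfolding pencil_def by (intro finsum_closed) auto
  have "ip H (pencil H B \<alpha> \<beta> x) y
      = (\<Sum>i\<in>{..2}. ip H (\<Oplus>j\<in>{..2 - i}. complex_of_real (\<alpha> ^ i * \<beta> ^ j) \<odot> B i j x) y)"
    unfolding pencil_def by (rule inner_finsum_left) (use c' y in auto)
  also have "\<dots> = (\<Sum>i\<in>{..2}. \<Sum>j\<in>{..2 - i}. ip H (complex_of_real (\<alpha> ^ i * \<beta> ^ j) \<odot> B i j x) y)"
    by (intro sum.cong refl inner_finsum_left) (use c y in auto)
  also have "\<dots> = (\<Sum>i\<in>{..2}. \<Sum>j\<in>{..2 - i}. complex_of_real (\<alpha> ^ i * \<beta> ^ j) * ip H (B i j x) y)"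
    by (intro sum.cong refl inner_prod_smult) (use c y in auto)
  also have "\<dots> = ip H (B 0 0 x) y + of_real \<beta> * ip H (B 0 1 x) y
        + of_real \<beta> ^ 2 * ip H (B 0 2 x) y + of_real \<alpha> * ip H (B 1 0 x) y
        + of_real \<alpha> * of_real \<beta> * ip H (B 1 1 x) y + of_real \<alpha> ^ 2 * ip H (B 2 0 x) y"
    by (simp add: numeral_2_eq_2 atMost_Suc)
  finally show "ip H (pencil H B \<alpha> \<beta> x) y
      = ip H (B 0 0 x) y + of_real \<beta> * ip H (B 0 1 x) y
        + of_real \<beta> ^ 2 * ip H (B 0 2 x) y + of_real \<alpha> * ip H (B 1 0 x) y
        + of_real \<alpha> * of_real \<beta> * ip H (B 1 1 x) y + of_real \<alpha> ^ 2 * ip H (B 2 0 x) y" .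
qed

lemma inner_adj_funpow:
  assumes T: "bounded_op H H T" and z: "z \<in> carrier H"
  shows "(adj H H T ^^ n) z \<in> carrier H"
    and "y \<in> carrier H \<Longrightarrow> ip H ((adj H H T ^^ n) z) y = ip H z ((T ^^ n) y)"
proof -
  note adj = adj_carrier_inner[OF complex_hilbert_space_axioms complex_hilbert_space_axioms T]
  show c: "(adj H H T ^^ n) z \<in> carrier H" for n
    using z by (induction n) (auto intro: adj(1))
  show "ip H ((adj H H T ^^ n) z) y = ip H z ((T ^^ n) y)" if "y \<in> carrier H"
    using that
  proof (induction n arbitrary: y)
    case (Suc n)
    have Ty: "T y \<in> carrier H" using bounded_opD(1)[OF T Suc.prems] .
    have "ip H ((adj H H T ^^ Suc n) z) y = ip H ((adj H H T ^^ n) z) (T y)"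
      using adj(1)[OF c[of n]] adj(2)[OF c[of n] Suc.prems] c[of n] Ty
        inner_prod_commute[of _ y] inner_prod_commute[of _ "T y"] Suc.prems by simp
    also have "\<dots> = ip H z ((T ^^ Suc n) y)"
      unfolding Suc.IH[OF Ty] by (simp add: funpow_swap1)
    finally show ?case .
  qed simp
qed

lemma inner_pencil_nat:
  assumes T1: "bounded_op H H T1" and T2: "bounded_op H H T2"
    and B: "pencil_coeffs H T1 T2 B" and x: "x \<in> carrier H" and y: "y \<in> carrier H"
  shows "ip H (pencil H B (real n) (real m) x) y
    = ip H ((T1 ^^ n) ((T2 ^^ m) x)) ((T1 ^^ n) ((T2 ^^ m) y))"
proof -
  let ?z = "(T1 ^^ n) ((T2 ^^ m) x)"
  have z: "?z \<in> carrier H" and y': "(T2 ^^ m) y \<in> carrier H"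
    using T1 T2 x y by (intro bounded_op_funpow_carrier; simp)+
  have "ip H (pencil H B (real n) (real m) x) y
      = ip H ((adj H H T2 ^^ m) ((adj H H T1 ^^ n) ?z)) y"
    using B x by (simp add: pencil_coeffs_def)
  also have "\<dots> = ip H ((adj H H T1 ^^ n) ?z) ((T2 ^^ m) y)"
    by (rule inner_adj_funpow(2)[OF T2 inner_adj_funpow(1)[OF T1 z] y])
  also have "\<dots> = ip H ?z ((T1 ^^ n) ((T2 ^^ m) y))"
    by (rule inner_adj_funpow(2)[OF T1 z y'])
  finally show ?thesis .
qed

text \<open>
The tool for all coefficient comparisons below: any quadratic polynomial that gives the products
of the orbits on the grid of natural numbers gives the coefficients of the pencil.
\<close>

lemma pencil_coeffs_eq:
  assumes T1: "bounded_op H H T1" and T2: "bounded_op H H T2"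
    and B: "pencil_coeffs H T1 T2 B" and x: "x \<in> carrier H" and y: "y \<in> carrier H"
    and q: "\<And>n m. ip H ((T1 ^^ n) ((T2 ^^ m) x)) ((T1 ^^ n) ((T2 ^^ m) y))
      = q00 + of_nat m * q01 + of_nat m ^ 2 * q02 + of_nat n * q10
        + of_nat n * of_nat m * q11 + of_nat n ^ 2 * q20"
  shows "ip H (B 0 0 x) y = q00" "ip H (B 0 1 x) y = q01"
    "ip H (B 0 2 x) y = q02" "ip H (B 1 0 x) y = q10"
    "ip H (B 1 1 x) y = q11" "ip H (B 2 0 x) y = q20"
proof -
  have B': "\<And>i j. i + j \<le> 2 \<Longrightarrow> bounded_op H H (B i j)" using B by (simp add: pencil_coeffs_def)
  have "ip H (B 0 0 x) y + of_nat m * ip H (B 0 1 x) y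
        + of_nat m ^ 2 * ip H (B 0 2 x) y + of_nat n * ip H (B 1 0 x) y
        + of_nat n * of_nat m * ip H (B 1 1 x) y + of_nat n ^ 2 * ip H (B 2 0 x) y
      = q00 + of_nat m * q01 + of_nat m ^ 2 * q02 + of_nat n * q10
        + of_nat n * of_nat m * q11 + of_nat n ^ 2 * q20" for n m
    using inner_pencil_nat[OF T1 T2 B x y, where n=n and m=m] inner_pencil(2)[OF B' x y,
      where \<alpha>="real n" and \<beta>="real m"]
      q[of n m] by simp
  from quadratic_coeffs_unique[OF this]
  show "ip H (B 0 0 x) y = q00" "ip H (B 0 1 x) y = q01"
    "ip H (B 0 2 x) y = q02" "ip H (B 1 0 x) y = q10"
    "ip H (B 1 1 x) y = q11" "ip H (B 2 0 x) y = q20" .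
qed

end

lemma pencil_coeffs_coeff_op:
  assumes "three_isometric_pair H T1 T2"
  shows "pencil_coeffs H T1 T2 (coeff_op H T1 T2)"
proof -
  have "\<exists>B. pencil_coeffs H T1 T2 B" using assms by (simp add: three_isometric_pair_def)
  then show ?thesis unfolding coeff_op_def by (rule someI_ex)
qed

lemma (in complex_hilbert_space) inner_Q_hat:
  assumes B: "pencil_coeffs H T1 T2 (coeff_op H T1 T2)" and x: "x \<in> carrier H" and y: "y \<in> carrier H"
  shows "Q_hat c d H T1 T2 \<alpha> \<beta> x \<in> carrier H"
    and "ip H (Q_hat c d H T1 T2 \<alpha> \<beta> x) y
      = ip H (pencil H (coeff_op H T1 T2) \<alpha> \<beta> x) y
        - ip H (coeff_op H T1 T2 2 0 x) y / (of_real c)\<^sup>2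
        - ip H (coeff_op H T1 T2 0 2 x) y / (of_real d)\<^sup>2"
proof -
  have B': "\<And>i j. i + j \<le> 2 \<Longrightarrow> bounded_op H H (coeff_op H T1 T2 i j)"
    using B by (simp add: pencil_coeffs_def)
  have c: "pencil H (coeff_op H T1 T2) \<alpha> \<beta> x \<in> carrier H"
    "coeff_op H T1 T2 2 0 x \<in> carrier H" "coeff_op H T1 T2 0 2 x \<in> carrier H"
    using pencil_carrier[OF B' x y] bounded_opD(1)[OF B' x, of 2 0] bounded_opD(1)[OF B' x, of 0 2]
    by simp_all
  then show "Q_hat c d H T1 T2 \<alpha> \<beta> x \<in> carrier H"
    by (simp add: Q_hat_def Q_pencil_def)
  show "ip H (Q_hat c d H T1 T2 \<alpha> \<beta> x) y
      = ip H (pencil H (coeff_op H T1 T2) \<alpha> \<beta> x) y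
        - ip H (coeff_op H T1 T2 2 0 x) y / (of_real c)\<^sup>2
        - ip H (coeff_op H T1 T2 0 2 x) y / (of_real d)\<^sup>2"
    using c y by (simp add: Q_hat_def Q_pencil_def inner_simps)
qed

section \<open>Recurrence in finite dimension\<close>

lemma finite_coordinates_convergent_subseq:
  fixes a :: "nat \<Rightarrow> 'g \<Rightarrow> complex"
  assumes "finite G" "\<And>g. g \<in> G \<Longrightarrow> bounded (range (\<lambda>n. a n g))"
  obtains r where "strict_mono r" "\<And>g. g \<in> G \<Longrightarrow> convergent (\<lambda>n. a (r n) g)"
proof -
  have "\<exists>r :: nat \<Rightarrow> nat. strict_mono r \<and> (\<forall>g\<in>G. convergent (\<lambda>n. a (r n) g))"
    using assms
  proof (induction G rule: finite_induct)
    case empty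
    show ?case by (intro exI[of _ id]) (simp add: strict_mono_def)
  next
    case (insert g G)
    then obtain r :: "nat \<Rightarrow> nat" where r: "strict_mono r" "\<forall>g\<in>G. convergent (\<lambda>n. a (r n) g)" by auto
    have "bounded (range (\<lambda>n. a (r n) g))"
      using insert.prems[of g] by (rule bounded_subset[OF _ image_subsetI]) auto
    then obtain l t where t: "strict_mono t" "((\<lambda>n. a (r n) g) \<circ> t) \<longlonglongrightarrow> l"
      using bounded_imp_convergent_subsequence by blast
    have "convergent (\<lambda>n. a ((r \<circ> t) n) h)" if "h \<in> insert g G" for h
    proof (cases "h = g")
      case True
      then show ?thesis using t(2) by (auto simp: convergent_def o_def)
    next
      case False
      then have "convergent (\<lambda>n. a (r n) h)" using that r(2) by blast
      from convergent_subseq_convergent[OF this t(1)] show ?thesis by (simp add: o_def)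
    qed
    moreover have "strict_mono (r \<circ> t)" using r(1) t(1) by (rule strict_mono_o)
    ultimately show ?case by blast
  qed
  then show thesis using that by blast
qed

text \<open>
The hypothesis \<open>shift\<close> holds for \<open>u n = U ^^ n (u 0)\<close> with an isometry \<open>U\<close>. A bounded sequence
in finite dimension has two terms with large index distance that are close to each other, and
\<open>shift\<close> moves this near-coincidence back to \<open>u 0\<close>.
\<close>

lemma finite_dim_isometric_orbit_recurrent:
  fixes F :: "'f hilbert" and u :: "nat \<Rightarrow> 'f"
  assumes F: "complex_hilbert_space F" and G: "finite G" "orthonormal_set F G"
    and u: "\<And>n. u n \<in> closed_span F G" and bound: "\<And>n. hnorm F (u n) \<le> M"
    and shift: "\<And>n m. hnorm F (u (n + m) \<ominus>\<^bsub>F\<^esub> u n) = hnorm F (u m \<ominus>\<^bsub>F\<^esub> u 0)"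
    and e: "e > 0"
  obtains m where "m \<ge> N" "hnorm F (u m \<ominus>\<^bsub>F\<^esub> u 0) < e"
proof -
  interpret complex_hilbert_space F by fact
  have uc: "u n \<in> carrier F" for n using u[of n] by (simp add: closed_span_def)
  have Gc: "g \<in> carrier F" if "g \<in> G" for g using orthonormal_setD(1)[OF G(2) that] .
  have bdd: "bounded (range (\<lambda>n. ip F (u n) g))" if g: "g \<in> G" for g
  proof (rule boundedI)
    fix z assume "z \<in> range (\<lambda>n. ip F (u n) g)"
    then obtain n where "z = ip F (u n) g" by blast
    then have "cmod z \<le> hnorm F (u n) * hnorm F g" using cauchy_schwarz[OF uc Gc[OF g]] by simp
    also have "\<dots> \<le> M * hnorm F g" using bound Gc[OF g] by (intro mult_right_mono) auto
    finally show "norm z \<le> M * hnorm F g" .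
  qed
  obtain r where r: "strict_mono r" "\<And>g. g \<in> G \<Longrightarrow> convergent (\<lambda>n. ip F (u (r n)) g)"
    using finite_coordinates_convergent_subseq[OF G(1), of "\<lambda>n g. ip F (u n) g"] bdd by blast
  \<comment> \<open>\<open>card G\<close> squared coordinate differences, each below \<open>e'\<close>, add up to less than \<open>e\<^sup>2\<close>\<close>
  define e' where "e' = e\<^sup>2 / (2 * (real (card G) + 1))"
  have e': "e' > 0" using e by (simp add: e'_def)
  have "\<exists>k. \<forall>i\<ge>k. \<forall>j\<ge>k. (cmod (ip F (u (r i)) g - ip F (u (r j)) g))\<^sup>2 < e'"
    if g: "g \<in> G" for g
  proof -
    have "Cauchy (\<lambda>n. ip F (u (r n)) g)" using r(2)[OF g] by (rule convergent_Cauchy)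
    then obtain k where k: "\<forall>i\<ge>k. \<forall>j\<ge>k. cmod (ip F (u (r i)) g - ip F (u (r j)) g) < sqrt e'"
      unfolding Cauchy_def dist_norm using e' by (meson real_sqrt_gt_zero)
    have "(cmod (ip F (u (r i)) g - ip F (u (r j)) g))\<^sup>2 < (sqrt e')\<^sup>2"
      if "i \<ge> k" "j \<ge> k" for i j
      using k that by (intro power_strict_mono) auto
    then show ?thesis using e' by auto
  qed
  then obtain k where k: "\<And>g i j. \<lbrakk>g \<in> G; i \<ge> k g; j \<ge> k g\<rbrakk> \<Longrightarrow>
      (cmod (ip F (u (r i)) g - ip F (u (r j)) g))\<^sup>2 < e'"
    by metis
  define i where "i = Max (insert 0 (k ` G))"
  have ki: "k g \<le> i" if "g \<in> G" for g using G(1) that by (simp add: i_def)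
  define j where "j = i + N"
  let ?w = "u (r j) \<ominus>\<^bsub>F\<^esub> u (r i)"
  have w: "?w \<in> closed_span F G"
    using u[of "r i"] u[of "r j"] by (auto simp: closed_span_def inner_diff_right)
  have wc: "?w \<in> carrier F" using uc by simp
  have "((\<lambda>g. ip F ?w g * ip F g ?w) has_sum ip F ?w ?w) G"
    by (rule parseval[OF G(2) w wc])
  then have "ip F ?w ?w = (\<Sum>g\<in>G. ip F ?w g * ip F g ?w)"
    using has_sum_unique has_sum_finite[OF G(1)] by blast
  also have "\<dots> = (\<Sum>g\<in>G. complex_of_real ((cmod (ip F (u (r j)) g - ip F (u (r i)) g))\<^sup>2))"
  proof (rule sum.cong[OF refl])
    fix g assume g: "g \<in> G"
    have "ip F g ?w = cnj (ip F ?w g)" by (rule inner_prod_commute[OF Gc[OF g] wc])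
    then show "ip F ?w g * ip F g ?w
        = complex_of_real ((cmod (ip F (u (r j)) g - ip F (u (r i)) g))\<^sup>2)"
      using uc Gc[OF g] by (simp only: complex_norm_square inner_diff_left)
  qed
  finally have "complex_of_real ((hnorm F ?w)\<^sup>2)
      = complex_of_real (\<Sum>g\<in>G. (cmod (ip F (u (r j)) g - ip F (u (r i)) g))\<^sup>2)"
    by (simp only: inner_self[OF wc] of_real_sum)
  then have "(hnorm F ?w)\<^sup>2 = (\<Sum>g\<in>G. (cmod (ip F (u (r j)) g - ip F (u (r i)) g))\<^sup>2)"
    by (simp only: of_real_eq_iff)
  also have "\<dots> \<le> (\<Sum>g\<in>G. e')"
    using k ki by (intro sum_mono less_imp_le) (auto simp: j_def trans_le_add1)
  also have "\<dots> = e\<^sup>2 * (real (card G) / (2 * (real (card G) + 1)))" by (simp add: e'_def)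
  also have "\<dots> < e\<^sup>2 * 1"
    using e by (intro mult_strict_left_mono) (auto simp: divide_simps)
  finally have "(hnorm F ?w)\<^sup>2 < e\<^sup>2" by simp
  then have le: "hnorm F ?w < e" using e power_less_imp_less_base[of "hnorm F ?w" 2 e] by simp
  have "r i + N \<le> r j"
  proof -
    have "r i + n \<le> r (i + n)" for n
    proof (induction n)
      case (Suc n)
      then show ?case using strict_monoD[OF r(1), of "i + n" "i + Suc n"] by simp
    qed simp
    then show ?thesis by (simp add: j_def)
  qed
  then have "N \<le> r j - r i" "r j = r i + (r j - r i)" by simp_all
  moreover have "hnorm F (u (r j - r i) \<ominus>\<^bsub>F\<^esub> u 0) < e"
    using shift[of "r i" "r j - r i"] le calculation(2) by simp
  ultimately show thesis using that by blast
qed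

text \<open>
The vectors \<open>r n = A0 (T ^^ n x) - n c A1 (T ^^ n x)\<close> satisfy \<open>r (n + 1) = U (r n)\<close> and so have
constant norm. Pairing with \<open>z\<close> removes their first term and leaves a bound of order \<open>1/n\<close> for
\<open>\<langle>z, u n\<rangle>\<close>, where \<open>u n = A1 (T ^^ n x)\<close>; recurrence of the orbit \<open>u\<close> then excludes
\<open>\<langle>z, u 0\<rangle> \<noteq> 0\<close>. In other words, the range of \<open>A1\<close> lies in the range of \<open>A0\<close>.
\<close>

lemma orthogonal_to_constant_term_finite_dim:
  assumes H: "complex_hilbert_space H" and F: "complex_hilbert_space F"
    and B: "finite B" "B \<subseteq> carrier H" "closed_span H B = carrier H"
    and A0: "bounded_op H F A0" and A1: "bounded_op H F A1" and T: "bounded_op H H T"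
    and U: "isometry_op F F U" and c: "c > 0"
    and A0T: "\<And>x. x \<in> carrier H \<Longrightarrow> A0 (T x) = U (A0 x) \<oplus>\<^bsub>F\<^esub> complex_of_real c \<odot>\<^bsub>F\<^esub> U (A1 x)"
    and A1T: "\<And>x. x \<in> carrier H \<Longrightarrow> A1 (T x) = U (A1 x)"
    and z: "z \<in> carrier F" "\<And>x. x \<in> carrier H \<Longrightarrow> ip F z (A0 x) = 0"
    and x: "x \<in> carrier H"
  shows "ip F z (A1 x) = 0"
proof (rule ccontr)
  assume nz: "ip F z (A1 x) \<noteq> 0"
  interpret H: complex_hilbert_space H by fact
  interpret F: complex_hilbert_space F by fact
  note A0D = bounded_opD[OF A0] and A1D = bounded_opD[OF A1] and UD
    = bounded_opD[OF isometry_opD(1)[OF U]]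
  have U_inner: "ip F (U v) (U w) = ip F v w" if "v \<in> carrier F" "w \<in> carrier F" for v w
    by (rule isometry_op_inner[OF F F U that])
  have Tc: "(T ^^ n) x \<in> carrier H" for n by (rule bounded_op_funpow_carrier[OF T x])
  define u where "u n = A1 ((T ^^ n) x)" for n
  have uc: "u n \<in> carrier F" for n unfolding u_def by (rule A1D(1)[OF Tc])
  have uSuc: "u (Suc n) = U (u n)" for n using A1T[OF Tc] by (simp add: u_def)
  have U_diff: "U (v \<ominus>\<^bsub>F\<^esub> w) = U v \<ominus>\<^bsub>F\<^esub> U w" if "v \<in> carrier F" "w \<in> carrier F" for v w
  proof -
    have eq: "v \<ominus>\<^bsub>F\<^esub> w = v \<oplus>\<^bsub>F\<^esub> (-1) \<odot>\<^bsub>F\<^esub> w" if "v \<in> carrier F" "w \<in> carrier F" for v w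
      using that by (intro F.inner_ext) (simp_all add: F.inner_simps)
    show ?thesis using that eq[of v w] eq[of "U v" "U w"] by (simp add: UD)
  qed
  have norm_u: "hnorm F (u n) = hnorm F (u 0)" for n
    by (induction n) (simp_all add: uSuc isometry_opD(2)[OF U uc])
  have shift: "hnorm F (u (n + m) \<ominus>\<^bsub>F\<^esub> u n) = hnorm F (u m \<ominus>\<^bsub>F\<^esub> u 0)" for n m
  proof (induction n)
    case (Suc n)
    have "u (Suc n + m) \<ominus>\<^bsub>F\<^esub> u (Suc n) = U (u (n + m) \<ominus>\<^bsub>F\<^esub> u n)"
      using uc by (simp add: uSuc U_diff)
    then show ?case using Suc isometry_opD(2)[OF U] uc by simp
  qed simp
  define r where "r n = A0 ((T ^^ n) x) \<ominus>\<^bsub>F\<^esub> complex_of_real (real n * c) \<odot>\<^bsub>F\<^esub> u n" for n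
  have rc: "r n \<in> carrier F" for n unfolding r_def using A0D(1)[OF Tc] uc by simp
  have rSuc: "r (Suc n) = U (r n)" for n
  proof (rule F.inner_ext)
    fix w assume w: "w \<in> carrier F"
    have "r (Suc n) = (U (A0 ((T ^^ n) x)) \<oplus>\<^bsub>F\<^esub> complex_of_real c \<odot>\<^bsub>F\<^esub> U (u n))
        \<ominus>\<^bsub>F\<^esub> complex_of_real (real (Suc n) * c) \<odot>\<^bsub>F\<^esub> U (u n)"
      using A0T[OF Tc, of n] by (simp add: r_def uSuc u_def[symmetric])
    moreover have "U (r n) = U (A0 ((T ^^ n) x)) \<ominus>\<^bsub>F\<^esub> complex_of_real (real n * c) \<odot>\<^bsub>F\<^esub> U (u n)"
      using A0D(1)[OF Tc] uc by (simp add: r_def U_diff UD)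
    ultimately show "ip F (r (Suc n)) w = ip F (U (r n)) w"
      using w A0D(1)[OF Tc] uc UD(1) by (simp add: F.inner_simps algebra_simps)
  qed (use rc UD in auto)
  have norm_r: "hnorm F (r n) = hnorm F (r 0)" for n
    by (induction n) (simp_all add: rSuc isometry_opD(2)[OF U rc])
  have small: "real n * c * cmod (ip F z (u n)) \<le> hnorm F z * hnorm F (r 0)" for n
  proof -
    have "ip F z (r n) = - complex_of_real (real n * c) * ip F z (u n)"
      unfolding r_def using z uc A0D(1)[OF Tc] Tc by (simp add: F.inner_simps)
    then have "real n * c * cmod (ip F z (u n)) = cmod (ip F z (r n))"
      using c by (simp add: norm_mult)
    also have "\<dots> \<le> hnorm F z * hnorm F (r n)" by (rule F.cauchy_schwarz[OF z(1) rc])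
    finally show ?thesis using norm_r[of n] by simp
  qed
  obtain G where G: "orthonormal_set F G" "finite G" "A1 ` B \<subseteq> closed_span F G"
  proof (rule F.gram_schmidt[of "A1 ` B"])
    show "finite (A1 ` B)" using B by simp
    show "A1 ` B \<subseteq> carrier F" using A1D(1) B by auto
  qed blast
  have span: "u n \<in> closed_span F G" for n
    unfolding u_def by (rule bounded_op_image_in_closed_span[OF H F A1 B(2,3) G(3) Tc])
  define a where "a = cmod (ip F z (u 0))"
  have a: "a > 0" using nz by (simp add: a_def u_def)
  have zpos: "hnorm F z > 0"
    using a F.cauchy_schwarz[OF z(1) uc[of 0]] F.hnorm_nonneg[OF z(1)] unfolding a_def
    by (metis less_eq_real_def linorder_not_less mult_zero_left)
  \<comment> \<open>from \<open>N\<close> on the bound of order \<open>1/n\<close> is below \<open>a / 2\<close>, while recurrence forces some later value above \<open>a / 2\<close>\<close>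
  obtain N :: nat where N: "real N * (c * a) > 2 * hnorm F z * hnorm F (r 0)"
    using reals_Archimedean3[of "c * a"] a c by (auto simp: mult.commute)
  have pos: "0 < a / (2 * hnorm F z)" using a zpos by simp
  obtain m where m: "m \<ge> N" "hnorm F (u m \<ominus>\<^bsub>F\<^esub> u 0) < a / (2 * hnorm F z)"
    by (rule finite_dim_isometric_orbit_recurrent[OF F G(2,1) span eq_refl[OF norm_u] shift pos])
  have "ip F z (u 0) = ip F z (u m) - ip F z (u m \<ominus>\<^bsub>F\<^esub> u 0)"
    using z uc by (simp add: F.inner_simps)
  then have "a \<le> cmod (ip F z (u m)) + cmod (ip F z (u m \<ominus>\<^bsub>F\<^esub> u 0))"
    unfolding a_def by (metis norm_triangle_ineq4)
  moreover have "cmod (ip F z (u m \<ominus>\<^bsub>F\<^esub> u 0)) \<le> hnorm F z * hnorm F (u m \<ominus>\<^bsub>F\<^esub> u 0)"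
    using F.cauchy_schwarz z uc by simp
  moreover have "hnorm F z * hnorm F (u m \<ominus>\<^bsub>F\<^esub> u 0) < a / 2"
    using m(2) zpos by (simp add: field_simps)
  ultimately have "a / 2 < cmod (ip F z (u m))" by linarith
  then have "real m * c * (a / 2) \<le> hnorm F z * hnorm F (r 0)"
    using small[of m] mult_left_mono[of "a / 2" "cmod (ip F z (u m))" "real m * c"] c by simp
  moreover have "real N * (c * a) \<le> real m * (c * a)" using m(1) c a by (intro mult_right_mono) auto
  ultimately show False using N by (simp add: algebra_simps)
qed

section \<open>From a lifting to a factorization\<close>

text \<open>
The operators \<open>A0, A1, A2\<close> are the components of a lifting with values in \<open>F \<oplus> F \<oplus> F\<close>.
\<close>

locale lifting_components =
  H: complex_hilbert_space H + F: complex_hilbert_space F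
  for H :: "'h hilbert" and F :: "'f hilbert" +
  fixes T1 T2 :: "'h \<Rightarrow> 'h" and U1 U2 :: "'f \<Rightarrow> 'f" and A0 A1 A2 :: "'h \<Rightarrow> 'f" and c d :: real
  assumes T1: "bounded_op H H T1" and T2: "bounded_op H H T2"
    and U1: "isometry_op F F U1" and U2: "isometry_op F F U2"
    and A0: "bounded_op H F A0" and A1: "bounded_op H F A1" and A2: "bounded_op H F A2"
    and c: "c > 0" and d: "d > 0"
    and inner_A: "\<lbrakk>x \<in> carrier H; y \<in> carrier H\<rbrakk> \<Longrightarrow> ip H x y
      = ip F (A0 x) (A0 y) + ip F (A1 x) (A1 y) + ip F (A2 x) (A2 y)"
    and A0T1: "x \<in> carrier H \<Longrightarrow> A0 (T1 x) = U1 (A0 x) \<oplus>\<^bsub>F\<^esub> complex_of_real c \<odot>\<^bsub>F\<^esub> U1 (A1 x)"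
    and A1T1: "x \<in> carrier H \<Longrightarrow> A1 (T1 x) = U1 (A1 x)"
    and A2T1: "x \<in> carrier H \<Longrightarrow> A2 (T1 x) = U1 (A2 x)"
    and A0T2: "x \<in> carrier H \<Longrightarrow> A0 (T2 x) = U2 (A0 x) \<oplus>\<^bsub>F\<^esub> complex_of_real d \<odot>\<^bsub>F\<^esub> U2 (A2 x)"
    and A1T2: "x \<in> carrier H \<Longrightarrow> A1 (T2 x) = U2 (A1 x)"
    and A2T2: "x \<in> carrier H \<Longrightarrow> A2 (T2 x) = U2 (A2 x)"
begin

lemmas H_ax = H.complex_hilbert_space_axioms
lemmas F_ax = F.complex_hilbert_space_axioms
lemmas AD = bounded_opD[OF A0] bounded_opD[OF A1] bounded_opD[OF A2]
lemmas U1D = bounded_opD[OF isometry_opD(1)[OF U1]]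
lemmas U2D = bounded_opD[OF isometry_opD(1)[OF U2]]

definition W :: "real \<Rightarrow> real \<Rightarrow> 'h \<Rightarrow> 'f" where
  "W \<alpha> \<beta> x = A0 x \<oplus>\<^bsub>F\<^esub> complex_of_real (\<alpha> * c) \<odot>\<^bsub>F\<^esub> A1 x \<oplus>\<^bsub>F\<^esub> complex_of_real (\<beta> * d) \<odot>\<^bsub>F\<^esub> A2 x"

lemma W_carrier: "x \<in> carrier H \<Longrightarrow> W \<alpha> \<beta> x \<in> carrier F"
  by (simp add: W_def AD)

lemma W_T1: "x \<in> carrier H \<Longrightarrow> W \<alpha> \<beta> (T1 x) = U1 (W (\<alpha> + 1) \<beta> x)"
  by (rule F.inner_ext)
    (simp_all add: W_def A0T1 A1T1 A2T1 U1D AD F.inner_simps algebra_simps)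

lemma W_T2: "x \<in> carrier H \<Longrightarrow> W \<alpha> \<beta> (T2 x) = U2 (W \<alpha> (\<beta> + 1) x)"
  by (rule F.inner_ext)
    (simp_all add: W_def A0T2 A1T2 A2T2 U2D AD F.inner_simps algebra_simps)

text \<open>
The form of the pencil \<open>Q\<close>, in terms of the components of the lifting; the first summand turns
out to be the form of the modified pencil.
\<close>

definition Q_form :: "real \<Rightarrow> real \<Rightarrow> 'h \<Rightarrow> 'h \<Rightarrow> complex" where
  "Q_form \<alpha> \<beta> x y = ip F (W \<alpha> \<beta> x) (W \<alpha> \<beta> y)
    + ip F (A1 x) (A1 y) + ip F (A2 x) (A2 y)"

lemma Q_form_T1_pow:
  assumes "x \<in> carrier H" "y \<in> carrier H"
  shows "Q_form \<alpha> \<beta> ((T1 ^^ n) x) ((T1 ^^ n) y) = Q_form (\<alpha> + real n) \<beta> x y"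
proof (induction n arbitrary: \<alpha>)
  case (Suc n)
  have c: "(T1 ^^ n) x \<in> carrier H" "(T1 ^^ n) y \<in> carrier H"
    using assms by (simp_all add: bounded_op_funpow_carrier[OF T1])
  have "Q_form \<alpha> \<beta> ((T1 ^^ Suc n) x) ((T1 ^^ Suc n) y) = Q_form (\<alpha> + 1) \<beta> ((T1 ^^ n) x) ((T1 ^^ n) y)"
    using c by (simp add: Q_form_def W_T1 A1T1 A2T1 AD W_carrier isometry_op_inner[OF F_ax F_ax U1])
  then show ?case using Suc.IH[of "\<alpha> + 1"] by (simp add: algebra_simps)
qed simp

lemma Q_form_T2_pow:
  assumes "x \<in> carrier H" "y \<in> carrier H"
  shows "Q_form \<alpha> \<beta> ((T2 ^^ n) x) ((T2 ^^ n) y) = Q_form \<alpha> (\<beta> + real n) x y"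
proof (induction n arbitrary: \<beta>)
  case (Suc n)
  have c: "(T2 ^^ n) x \<in> carrier H" "(T2 ^^ n) y \<in> carrier H"
    using assms by (simp_all add: bounded_op_funpow_carrier[OF T2])
  have "Q_form \<alpha> \<beta> ((T2 ^^ Suc n) x) ((T2 ^^ Suc n) y) = Q_form \<alpha> (\<beta> + 1) ((T2 ^^ n) x) ((T2 ^^ n) y)"
    using c by (simp add: Q_form_def W_T2 A1T2 A2T2 AD W_carrier isometry_op_inner[OF F_ax F_ax U2])
  then show ?case using Suc.IH[of "\<beta> + 1"] by (simp add: algebra_simps)
qed simp

lemma Q_form_0: "\<lbrakk>x \<in> carrier H; y \<in> carrier H\<rbrakk> \<Longrightarrow> Q_form 0 0 x y = ip H x y"
  by (simp add: Q_form_def W_def inner_A AD F.inner_simps)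

lemma inner_T_pow:
  assumes "x \<in> carrier H" "y \<in> carrier H"
  shows "ip H ((T1 ^^ n) ((T2 ^^ m) x)) ((T1 ^^ n) ((T2 ^^ m) y)) = Q_form (real n) (real m) x y"
  using assms Q_form_0[of "(T1 ^^ n) ((T2 ^^ m) x)" "(T1 ^^ n) ((T2 ^^ m) y)"]
    Q_form_T1_pow[of "(T2 ^^ m) x" "(T2 ^^ m) y" 0 0 n] Q_form_T2_pow[of x y "real n" 0 m]
  by (simp add: bounded_op_funpow_carrier[OF T1] bounded_op_funpow_carrier[OF T2])

lemma inner_Q_hat_W:
  assumes B: "pencil_coeffs H T1 T2 (coeff_op H T1 T2)" and x: "x \<in> carrier H" and y: "y \<in> carrier H"
  shows "ip H (Q_hat c d H T1 T2 \<alpha> \<beta> x) y = ip F (W \<alpha> \<beta> x) (W \<alpha> \<beta> y)"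
proof -
  let ?B = "coeff_op H T1 T2"
  let ?G = "\<lambda>A A'. ip F (A x) (A' y)"
  have expand: "ip F (W \<alpha> \<beta> x) (W \<alpha> \<beta> y)
    = ?G A0 A0 + of_real \<beta> * (of_real d * (?G A0 A2 + ?G A2 A0))
      + of_real \<beta> ^ 2 * (of_real d ^ 2 * ?G A2 A2)
      + of_real \<alpha> * (of_real c * (?G A0 A1 + ?G A1 A0))
      + of_real \<alpha> * of_real \<beta> * (of_real c * of_real d * (?G A1 A2 + ?G A2 A1))
      + of_real \<alpha> ^ 2 * (of_real c ^ 2 * ?G A1 A1)" for \<alpha> \<beta>
    using x y by (simp add: W_def AD F.inner_simps algebra_simps power2_eq_square)
  have B': "\<And>i j. i + j \<le> 2 \<Longrightarrow> bounded_op H H (?B i j)" using B by (simp add: pencil_coeffs_def)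
  have "ip H ((T1 ^^ n) ((T2 ^^ m) x)) ((T1 ^^ n) ((T2 ^^ m) y))
    = (?G A0 A0 + ?G A1 A1 + ?G A2 A2) + of_nat m * (of_real d * (?G A0 A2 + ?G A2 A0))
      + of_nat m ^ 2 * (of_real d ^ 2 * ?G A2 A2)
      + of_nat n * (of_real c * (?G A0 A1 + ?G A1 A0))
      + of_nat n * of_nat m * (of_real c * of_real d * (?G A1 A2 + ?G A2 A1))
      + of_nat n ^ 2 * (of_real c ^ 2 * ?G A1 A1)" for n m
    unfolding inner_T_pow[OF x y] Q_form_def expand by simp
  note q = H.pencil_coeffs_eq[OF T1 T2 B x y this]
  have "ip H (pencil H ?B \<alpha> \<beta> x) y
      = ip H (?B 0 0 x) y + of_real \<beta> * ip H (?B 0 1 x) y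
        + of_real \<beta> ^ 2 * ip H (?B 0 2 x) y + of_real \<alpha> * ip H (?B 1 0 x) y
        + of_real \<alpha> * of_real \<beta> * ip H (?B 1 1 x) y + of_real \<alpha> ^ 2 * ip H (?B 2 0 x) y"
    by (rule H.inner_pencil(2)[OF B' x y])
  then show ?thesis
    unfolding H.inner_Q_hat(2)[OF B x y] q expand using c d by simp
qed

text \<open>
For infinite \<open>B\<close>, three copies of \<open>B\<close> have the cardinality of \<open>B\<close>. For finite \<open>B\<close> the range of
\<open>A0\<close> alone spans the others.
\<close>

lemma ex_range_spanning_orthonormal_set:
  obtains B E where "orthonormal_set H B" "orthonormal_set F E" "|E| \<le>o |B|"
    "\<And>x. x \<in> carrier H \<Longrightarrow> A0 x \<in> closed_span F E"
    "\<And>x. x \<in> carrier H \<Longrightarrow> A1 x \<in> closed_span F E"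
    "\<And>x. x \<in> carrier H \<Longrightarrow> A2 x \<in> closed_span F E"
proof -
  obtain B where B: "orthonormal_set H B" "closed_span H B = carrier H"
    using H.ex_orthonormal_basis by blast
  have Bc: "B \<subseteq> carrier H" using B(1) by (simp add: orthonormal_set_def)
  note range_span = bounded_op_image_in_closed_span[OF H_ax F_ax _ Bc B(2)]
  show thesis
  proof (cases "finite B")
    case True
    obtain E where E: "orthonormal_set F E" "finite E" "card E \<le> card (A0 ` B)"
        "A0 ` B \<subseteq> closed_span F E"
    proof (rule F.gram_schmidt[of "A0 ` B"])
      show "finite (A0 ` B)" using True by simp
      show "A0 ` B \<subseteq> carrier F" using AD(1) Bc by auto
    qed blast
    have "card E \<le> card B" using E(3) card_image_le[OF True, of A0] by linarith
    then have EB: "|E| \<le>o |B|"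
      unfolding card_of_ordLeq[symmetric] inj_on_iff_card_le[OF E(2) True] .
    have s0: "A0 x \<in> closed_span F E" if "x \<in> carrier H" for x
      by (rule range_span[OF A0 E(4) that])
    have s1: "A1 x \<in> closed_span F E" if x: "x \<in> carrier H" for x
    proof -
      have "ip F z (A1 x) = 0" if z: "z \<in> carrier F" "\<forall>e\<in>E. ip F z e = 0" for z
        by (rule orthogonal_to_constant_term_finite_dim[OF H_ax F_ax True Bc B(2) A0 A1 T1 U1 c A0T1
          A1T1 z(1) _ x])
          (use s0 z in \<open>auto simp: closed_span_def\<close>)
      then show ?thesis using AD(4)[OF x] by (simp add: closed_span_def)
    qed
    have s2: "A2 x \<in> closed_span F E" if x: "x \<in> carrier H" for x
    proof -
      have "ip F z (A2 x) = 0" if z: "z \<in> carrier F" "\<forall>e\<in>E. ip F z e = 0" for z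
        by (rule orthogonal_to_constant_term_finite_dim[OF H_ax F_ax True Bc B(2) A0 A2 T2 U2 d A0T2
          A2T2 z(1) _ x])
          (use s0 z in \<open>auto simp: closed_span_def\<close>)
      then show ?thesis using AD(7)[OF x] by (simp add: closed_span_def)
    qed
    show thesis by (rule that[OF B(1) E(1) EB s0 s1 s2])
  next
    case False
    let ?S = "A0 ` B \<union> (A1 ` B \<union> A2 ` B)"
    have Sc: "?S \<subseteq> carrier F" using AD Bc by auto
    have "\<not> finite (Field |B| )" using False by (simp add: Field_card_of)
    then have "|?S| \<le>o |B|"
      by (intro card_of_Un_ordLeq_infinite_Field card_of_Card_order card_of_image)
    then obtain E where E: "orthonormal_set F E" "|E| \<le>o |B|" "?S \<subseteq> closed_span F E"
      using F.infinite_spanning_orthonormal_set[OF Sc False] by blast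
    have s0: "A0 x \<in> closed_span F E" if "x \<in> carrier H" for x
      by (rule range_span[OF A0 _ that]) (use E(3) in blast)
    have s1: "A1 x \<in> closed_span F E" if "x \<in> carrier H" for x
      by (rule range_span[OF A1 _ that]) (use E(3) in blast)
    have s2: "A2 x \<in> closed_span F E" if "x \<in> carrier H" for x
      by (rule range_span[OF A2 _ that]) (use E(3) in blast)
    show thesis by (rule that[OF B(1) E(1,2) s0 s1 s2])
  qed
qed

theorem Q_hat_factors:
  assumes B: "pencil_coeffs H T1 T2 (coeff_op H T1 T2)"
  shows "\<exists>V0 V1 V2. bounded_op H H V0 \<and> bounded_op H H V1 \<and> bounded_op H H V2 \<and>
    (\<forall>\<alpha> \<beta> :: real. \<forall>x\<in>carrier H.
      let W = (\<lambda>y. V0 y \<oplus>\<^bsub>H\<^esub> complex_of_real \<alpha> \<odot>\<^bsub>H\<^esub> V1 y \<oplus>\<^bsub>H\<^esub> complex_of_real \<beta> \<odot>\<^bsub>H\<^esub> V2 y)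
      in Q_hat c d H T1 T2 \<alpha> \<beta> x = adj H H W (W x))"
proof -
  obtain D E where D: "orthonormal_set H D" and E: "orthonormal_set F E" "|E| \<le>o |D|"
    and s: "\<And>x. x \<in> carrier H \<Longrightarrow> A0 x \<in> closed_span F E"
      "\<And>x. x \<in> carrier H \<Longrightarrow> A1 x \<in> closed_span F E"
      "\<And>x. x \<in> carrier H \<Longrightarrow> A2 x \<in> closed_span F E"
    using ex_range_spanning_orthonormal_set by blast
  obtain R where Rc: "\<And>u. u \<in> carrier F \<Longrightarrow> R u \<in> carrier H"
    and Radd: "\<And>u v. \<lbrakk>u \<in> carrier F; v \<in> carrier F\<rbrakk> \<Longrightarrow> R (u \<oplus>\<^bsub>F\<^esub> v) = R u \<oplus>\<^bsub>H\<^esub> R v"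
    and Rsmult: "\<And>a u. u \<in> carrier F \<Longrightarrow> R (a \<odot>\<^bsub>F\<^esub> u) = a \<odot>\<^bsub>H\<^esub> R u"
    and Rinner: "\<And>u v. \<lbrakk>u \<in> closed_span F E; v \<in> carrier F\<rbrakk> \<Longrightarrow> ip H (R u) (R v) = ip F u v"
    by (rule ex_isometry_on_closed_span[OF H_ax F_ax E(1) D E(2)]) blast
  have bdd: "bounded_op H H (\<lambda>x. R (A x))"
    if A: "bounded_op H F A" and sA: "\<And>x. x \<in> carrier H \<Longrightarrow> A x \<in> closed_span F E" for A
  proof -
    note AD = bounded_opD[OF A]
    obtain M where M: "\<And>x. x \<in> carrier H \<Longrightarrow> hnorm F (A x) \<le> M * hnorm H x"
      using bounded_op_bound[OF H_ax A] by blast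
    have "hnorm H (R (A x)) = hnorm F (A x)" if "x \<in> carrier H" for x
      using Rinner[OF sA[OF that] AD(1)[OF that]] by (simp add: hnorm_def)
    then have "hnorm H (R (A x)) \<le> M * hnorm H x" if "x \<in> carrier H" for x using M[OF that] that by simp
    then show ?thesis using AD Rc by (intro bounded_opI[where M=M]) (simp_all add: Radd Rsmult)
  qed
  define V0 where "V0 = (\<lambda>x. R (A0 x))"
  define V1 where "V1 = (\<lambda>x. complex_of_real c \<odot>\<^bsub>H\<^esub> R (A1 x))"
  define V2 where "V2 = (\<lambda>x. complex_of_real d \<odot>\<^bsub>H\<^esub> R (A2 x))"
  have V: "bounded_op H H V0" "bounded_op H H V1" "bounded_op H H V2"
    unfolding V0_def V1_def V2_def
    by (intro bdd bounded_op_smult H_ax A0 A1 A2 s; assumption)+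
  have "Q_hat c d H T1 T2 \<alpha> \<beta> x = adj H H W' (W' x)"
    if x: "x \<in> carrier H" and W': "W' = (\<lambda>y. V0 y \<oplus>\<^bsub>H\<^esub> complex_of_real \<alpha> \<odot>\<^bsub>H\<^esub> V1 y \<oplus>\<^bsub>H\<^esub>
      complex_of_real \<beta> \<odot>\<^bsub>H\<^esub> V2 y)"
    for \<alpha> \<beta> x W'
  proof -
    have W_R: "W' y = R (W \<alpha> \<beta> y)" if y: "y \<in> carrier H" for y
      using y by (intro H.inner_ext)
        (simp_all add: W' W_def V0_def V1_def V2_def AD Radd Rsmult Rc H.inner_simps)
    have W_span: "W \<alpha> \<beta> y \<in> closed_span F E" if y: "y \<in> carrier H" for y
      using W_carrier[OF y] s[OF y] AD(1,4,7)[OF y] by (simp add: closed_span_def W_def F.inner_simps)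
    let ?Q = "Q_hat c d H T1 T2 \<alpha> \<beta> x"
    have Qc: "?Q \<in> carrier H" by (rule H.inner_Q_hat(1)[OF B x x])
    have "ip H (W' y) (W' x) = ip H y ?Q" if y: "y \<in> carrier H" for y
    proof -
      have "ip H (W' y) (W' x) = ip F (W \<alpha> \<beta> y) (W \<alpha> \<beta> x)"
        unfolding W_R[OF x] W_R[OF y] by (rule Rinner[OF W_span[OF y] W_carrier[OF x]])
      also have "\<dots> = cnj (ip F (W \<alpha> \<beta> x) (W \<alpha> \<beta> y))"
        by (rule F.inner_prod_commute[OF W_carrier[OF y] W_carrier[OF x]])
      also have "\<dots> = cnj (ip H ?Q y)" unfolding inner_Q_hat_W[OF B x y] ..
      also have "\<dots> = ip H y ?Q" by (rule H.inner_prod_commute[OF y Qc, symmetric])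
      finally show ?thesis .
    qed
    from adj_eqI[OF H_ax Qc this] show ?thesis by simp
  qed
  then show ?thesis
    using V unfolding Let_def by (intro exI[of _ V0] exI[of _ V1] exI[of _ V2] conjI allI ballI)
      simp_all
qed

end

lemma lifting_imp_Q_hat_factors:
  fixes K :: "('f \<times> 'f \<times> 'f) hilbert"
  assumes H: "complex_hilbert_space H" and c: "c > 0" and d: "d > 0"
    and T: "three_isometric_pair H T1 T2"
    and J: "class_J c d K J1 J2" and L: "lifts_to H T1 T2 K J1 J2"
  shows "\<exists>V0 V1 V2. bounded_op H H V0 \<and> bounded_op H H V1 \<and> bounded_op H H V2 \<and>
    (\<forall>\<alpha> \<beta> :: real. \<forall>x\<in>carrier H.
      let W = (\<lambda>y. V0 y \<oplus>\<^bsub>H\<^esub> complex_of_real \<alpha> \<odot>\<^bsub>H\<^esub> V1 y \<oplus>\<^bsub>H\<^esub> complex_of_real \<beta> \<odot>\<^bsub>H\<^esub> V2 y)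
      in Q_hat c d H T1 T2 \<alpha> \<beta> x = adj H H W (W x))"
proof -
  interpret H: complex_hilbert_space H by fact
  obtain F U1 U2 where F: "complex_hilbert_space F" and K: "K = F \<oplus>\<^sub>H F \<oplus>\<^sub>H F"
    and U1: "unitary_op F U1" and U2: "unitary_op F U2"
    and J1: "\<And>x y z. \<lbrakk>x \<in> carrier F; y \<in> carrier F; z \<in> carrier F\<rbrakk> \<Longrightarrow>
      J1 (x, y, z) = (U1 x \<oplus>\<^bsub>F\<^esub> complex_of_real c \<odot>\<^bsub>F\<^esub> U1 y, U1 y, U1 z)"
    and J2: "\<And>x y z. \<lbrakk>x \<in> carrier F; y \<in> carrier F; z \<in> carrier F\<rbrakk> \<Longrightarrow>
      J2 (x, y, z) = (U2 x \<oplus>\<^bsub>F\<^esub> complex_of_real d \<odot>\<^bsub>F\<^esub> U2 z, U2 y, U2 z)"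
    using J unfolding class_J_def by auto
  interpret F: complex_hilbert_space F by fact
  obtain V where V: "isometry_op H K V"
    and VT: "\<And>x. x \<in> carrier H \<Longrightarrow> V (T1 x) = J1 (V x)" "\<And>x. x \<in> carrier H \<Longrightarrow> V (T2 x) = J2 (V x)"
    using L unfolding lifts_to_def by auto
  note VD = bounded_opD[OF isometry_opD(1)[OF V]]
  define A0 where "A0 = (\<lambda>x. fst (V x))"
  define A1 where "A1 = (\<lambda>x. fst (snd (V x)))"
  define A2 where "A2 = (\<lambda>x. snd (snd (V x)))"
  have Ac: "A0 x \<in> carrier F" "A1 x \<in> carrier F" "A2 x \<in> carrier F" if "x \<in> carrier H" for x
    using VD(1)[OF that] by (auto simp: K A0_def A1_def A2_def)
  have VA: "V x = (A0 x, A1 x, A2 x)" for x by (simp add: A0_def A1_def A2_def)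
  have add: "A0 (x \<oplus>\<^bsub>H\<^esub> y) = A0 x \<oplus>\<^bsub>F\<^esub> A0 y" "A1 (x \<oplus>\<^bsub>H\<^esub> y) = A1 x \<oplus>\<^bsub>F\<^esub> A1 y"
    "A2 (x \<oplus>\<^bsub>H\<^esub> y) = A2 x \<oplus>\<^bsub>F\<^esub> A2 y" if "x \<in> carrier H" "y \<in> carrier H" for x y
    using VD(2)[OF that] by (simp_all add: K VA)
  have smult: "A0 (a \<odot>\<^bsub>H\<^esub> x) = a \<odot>\<^bsub>F\<^esub> A0 x" "A1 (a \<odot>\<^bsub>H\<^esub> x) = a \<odot>\<^bsub>F\<^esub> A1 x"
    "A2 (a \<odot>\<^bsub>H\<^esub> x) = a \<odot>\<^bsub>F\<^esub> A2 x" if "x \<in> carrier H" for x a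
    using VD(3)[OF that] by (simp_all add: K VA)
  have nrm: "(hnorm H x)\<^sup>2 = (hnorm F (A0 x))\<^sup>2 + (hnorm F (A1 x))\<^sup>2 + (hnorm F (A2 x))\<^sup>2"
    if x: "x \<in> carrier H" for x
  proof -
    have "0 \<le> Re (ip K (V x) (V x))"
      using Ac[OF x] F.hnorm_square[symmetric] by (simp add: K VA)
    then have "(hnorm K (V x))\<^sup>2 = Re (ip K (V x) (V x))" by (simp add: hnorm_def)
    then show ?thesis using isometry_opD(2)[OF V x] Ac[OF x] by (simp add: K VA F.hnorm_square)
  qed
  have inner: "ip H x y
      = ip F (A0 x) (A0 y) + ip F (A1 x) (A1 y) + ip F (A2 x) (A2 y)"
    if x: "x \<in> carrier H" and y: "y \<in> carrier H" for x y
  proof -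
    have "ip F (A0 x) (A0 y) + ip F (A1 x) (A1 y) + ip F (A2 x) (A2 y)
        - ip H x y = 0"
    proof (rule H.sesquilinear_eq_0[where s="\<lambda>x y. ip F (A0 x) (A0 y)
        + ip F (A1 x) (A1 y) + ip F (A2 x) (A2 y) - ip H x y"])
      fix x assume x: "x \<in> carrier H"
      show "ip F (A0 x) (A0 x) + ip F (A1 x) (A1 x) + ip F (A2 x) (A2 x)
          - ip H x x = 0"
        using Ac[OF x] x by (simp add: F.inner_self H.inner_self nrm del: of_real_power)
    qed (use x y in \<open>auto simp: add smult Ac F.inner_simps H.inner_simps algebra_simps\<close>)
    then show ?thesis by simp
  qed
  have bound: "hnorm F (A0 x) \<le> 1 * hnorm H x" "hnorm F (A1 x) \<le> 1 * hnorm H x"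
    "hnorm F (A2 x) \<le> 1 * hnorm H x" if x: "x \<in> carrier H" for x
    by (rule power2_le_imp_le; use nrm[OF x] x in simp)+
  have A: "bounded_op H F A0" "bounded_op H F A1" "bounded_op H F A2"
    by (rule bounded_opI[where M=1]; use Ac add smult bound in simp)+
  have T12: "bounded_op H H T1" "bounded_op H H T2" using T by (auto simp: three_isometric_pair_def)
  interpret lifting_components H F T1 T2 U1 U2 A0 A1 A2 c d
  proof
    show "isometry_op F F U1" "isometry_op F F U2" using U1 U2 by (auto simp: unitary_op_def)
    fix x assume x: "x \<in> carrier H"
    show "A0 (T1 x) = U1 (A0 x) \<oplus>\<^bsub>F\<^esub> complex_of_real c \<odot>\<^bsub>F\<^esub> U1 (A1 x)"
      "A1 (T1 x) = U1 (A1 x)" "A2 (T1 x) = U1 (A2 x)"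
      using VT(1)[OF x] by (simp_all add: VA J1 Ac[OF x])
    show "A0 (T2 x) = U2 (A0 x) \<oplus>\<^bsub>F\<^esub> complex_of_real d \<odot>\<^bsub>F\<^esub> U2 (A2 x)"
      "A1 (T2 x) = U2 (A1 x)" "A2 (T2 x) = U2 (A2 x)"
      using VT(2)[OF x] by (simp_all add: VA J2 Ac[OF x])
  qed (fact A T12 c d inner)+
  show ?thesis by (rule Q_hat_factors[OF pencil_coeffs_coeff_op[OF T]])
qed

section \<open>Pencils with a factorization\<close>

text \<open>
The form of a Gram kernel at a list is the squared norm of the corresponding linear combination.
\<close>

lemma (in complex_pre_hilbert_space) positive_kernel_gram:
  assumes v: "\<And>p. v p \<in> carrier H"
  shows "positive_kernel (\<lambda>p q. ip H (v p) (v q))"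
proof
  fix p q
  show "ip H (v q) (v p) = cnj (ip H (v p) (v q))"
    by (rule inner_prod_commute[OF v v])
next
  fix xs
  define comb where "comb = foldr (\<lambda>x acc. fst x \<odot> v (snd x) \<oplus> acc)"
  have comb: "comb xs \<zero> \<in> carrier H" for xs
    by (induction xs) (simp_all add: comb_def v)
  have right: "(\<Sum>y\<leftarrow>ys. cnj (fst y) * ip H u (v (snd y))) = ip H u (comb ys \<zero>)"
    if u: "u \<in> carrier H" for u ys
  proof (induction ys)
    case (Cons y ys)
    then show ?case using u v comb[of ys] by (simp add: comb_def inner_simps)
  qed (use u in \<open>simp add: comb_def\<close>)
  have "kform (\<lambda>p q. ip H (v p) (v q)) xs ys = ip H (comb xs \<zero>) (comb ys \<zero>)" for ys
  proof (induction xs)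
    case (Cons x xs)
    then show ?case
      using v comb[of xs] comb[of ys] by (simp add: kform_def right comb_def inner_simps)
  qed (use comb[of ys] in \<open>simp add: kform_def comb_def\<close>)
  then show "0 \<le> Re (kform (\<lambda>p q. ip H (v p) (v q)) xs xs)"
    using inner_self[OF comb] by simp
qed

locale factored_pencil = complex_hilbert_space H for H :: "'h hilbert" (structure) +
  fixes T1 T2 V0 V1 V2 :: "'h \<Rightarrow> 'h" and c d :: real
  assumes T1: "bounded_op H H T1" and T2: "bounded_op H H T2" and T12: "commute_on H T1 T2"
    and coeffs: "pencil_coeffs H T1 T2 (coeff_op H T1 T2)"
    and V0: "bounded_op H H V0" and V1: "bounded_op H H V1" and V2: "bounded_op H H V2"
    and c: "c > 0" and d: "d > 0"
    and factor: "\<lbrakk>x \<in> carrier H; y \<in> carrier H\<rbrakk> \<Longrightarrow>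
      ip H (Q_hat c d H T1 T2 \<alpha> \<beta> x) y
      = ip H (V0 x \<oplus> complex_of_real \<alpha> \<odot> V1 x \<oplus> complex_of_real \<beta> \<odot> V2 x)
          (V0 y \<oplus> complex_of_real \<alpha> \<odot> V1 y \<oplus> complex_of_real \<beta> \<odot> V2 y)"
begin

lemmas TD = bounded_opD(1)[OF T1] bounded_opD(1)[OF T2]
lemmas VD = bounded_opD[OF V0] bounded_opD[OF V1] bounded_opD[OF V2]

definition coeff_form :: "nat \<Rightarrow> nat \<Rightarrow> 'h \<Rightarrow> 'h \<Rightarrow> complex" where
  "coeff_form i j x y = ip H (coeff_op H T1 T2 i j x) y"

definition hat_form :: "real \<Rightarrow> real \<Rightarrow> 'h \<Rightarrow> 'h \<Rightarrow> complex" where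
  "hat_form \<alpha> \<beta> x y = ip H (Q_hat c d H T1 T2 \<alpha> \<beta> x) y"

lemma coeff_op_bounded: "i + j \<le> 2 \<Longrightarrow> bounded_op H H (coeff_op H T1 T2 i j)"
  using coeffs by (simp add: pencil_coeffs_def)

lemma inner_pencil_coeff_form:
  assumes "x \<in> carrier H" "y \<in> carrier H"
  shows "ip H (pencil H (coeff_op H T1 T2) \<alpha> \<beta> x) y
    = coeff_form 0 0 x y + of_real \<beta> * coeff_form 0 1 x y + of_real \<beta> ^ 2 * coeff_form 0 2 x y
      + of_real \<alpha> * coeff_form 1 0 x y
      + of_real \<alpha> * of_real \<beta> * coeff_form 1 1 x y + of_real \<alpha> ^ 2 * coeff_form 2 0 x y"
  unfolding coeff_form_def by (rule inner_pencil(2)[OF coeff_op_bounded assms])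

lemma hat_form_expand:
  assumes "x \<in> carrier H" "y \<in> carrier H"
  shows "hat_form \<alpha> \<beta> x y = (coeff_form 0 0 x y - coeff_form 2 0 x y / of_real c ^ 2
    - coeff_form 0 2 x y / of_real d ^ 2)
      + of_real \<beta> * coeff_form 0 1 x y + of_real \<beta> ^ 2 * coeff_form 0 2 x y
        + of_real \<alpha> * coeff_form 1 0 x y
      + of_real \<alpha> * of_real \<beta> * coeff_form 1 1 x y + of_real \<alpha> ^ 2 * coeff_form 2 0 x y"
  unfolding hat_form_def inner_Q_hat(2)[OF coeffs assms] inner_pencil_coeff_form[OF assms]
    by (simp add: coeff_form_def)

lemma inner_T_pow_coeff_form:
  assumes "x \<in> carrier H" "y \<in> carrier H"
  shows "ip H ((T1 ^^ n) ((T2 ^^ m) x)) ((T1 ^^ n) ((T2 ^^ m) y))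
    = coeff_form 0 0 x y + of_nat m * coeff_form 0 1 x y + of_nat m ^ 2 * coeff_form 0 2 x y
      + of_nat n * coeff_form 1 0 x y
      + of_nat n * of_nat m * coeff_form 1 1 x y + of_nat n ^ 2 * coeff_form 2 0 x y"
proof -
  have "ip H (pencil H (coeff_op H T1 T2) (real n) (real m) x) y
    = ip H ((T1 ^^ n) ((T2 ^^ m) x)) ((T1 ^^ n) ((T2 ^^ m) y))"
    by (rule inner_pencil_nat[OF T1 T2 coeffs assms])
  then show ?thesis unfolding inner_pencil_coeff_form[OF assms] by simp
qed

lemma inner_eq_coeff_form: "\<lbrakk>x \<in> carrier H; y \<in> carrier H\<rbrakk> \<Longrightarrow> ip H x y = coeff_form 0 0 x y"
  using inner_T_pow_coeff_form[of x y 0 0] by simp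

lemma T2_pow_T1:
  assumes "x \<in> carrier H"
  shows "(T2 ^^ m) (T1 x) = T1 ((T2 ^^ m) x)"
proof (induction m)
  case (Suc m)
  then show ?case
    using T12 bounded_op_funpow_carrier[OF T2 assms] by (simp add: commute_on_def)
qed simp

text \<open>
The coefficients of the shifted polynomial \<open>Q(\<alpha> + 1, \<beta>)\<close>: replacing \<open>x, y\<close> by \<open>T1 x, T1 y\<close>
raises the exponent of \<open>T1\<close> by one.
\<close>

lemma coeff_form_T1:
  assumes x: "x \<in> carrier H" and y: "y \<in> carrier H"
  shows "coeff_form 0 0 (T1 x) (T1 y) = coeff_form 0 0 x y + coeff_form 1 0 x y + coeff_form 2 0 x y"
    "coeff_form 0 1 (T1 x) (T1 y) = coeff_form 0 1 x y + coeff_form 1 1 x y"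
    "coeff_form 0 2 (T1 x) (T1 y) = coeff_form 0 2 x y"
    "coeff_form 1 0 (T1 x) (T1 y) = coeff_form 1 0 x y + 2 * coeff_form 2 0 x y"
    "coeff_form 1 1 (T1 x) (T1 y) = coeff_form 1 1 x y"
    "coeff_form 2 0 (T1 x) (T1 y) = coeff_form 2 0 x y"
proof -
  have "ip H ((T1 ^^ n) ((T2 ^^ m) (T1 x))) ((T1 ^^ n) ((T2 ^^ m) (T1 y)))
    = (coeff_form 0 0 x y + coeff_form 1 0 x y + coeff_form 2 0 x y)
      + of_nat m * (coeff_form 0 1 x y + coeff_form 1 1 x y)
      + of_nat m ^ 2 * coeff_form 0 2 x y + of_nat n * (coeff_form 1 0 x y + 2 * coeff_form 2 0 x y)
      + of_nat n * of_nat m * coeff_form 1 1 x y + of_nat n ^ 2 * coeff_form 2 0 x y" for n m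
  proof -
    have "(T1 ^^ n) ((T2 ^^ m) (T1 z)) = (T1 ^^ Suc n) ((T2 ^^ m) z)" if "z \<in> carrier H" for z
      unfolding T2_pow_T1[OF that] by (simp add: funpow_swap1)
    then show ?thesis
      using inner_T_pow_coeff_form[OF x y, of "Suc n" m] x y
        by (simp add: algebra_simps power2_eq_square)
  qed
  note * = pencil_coeffs_eq[OF T1 T2 coeffs TD(1)[OF x] TD(1)[OF y] this, folded coeff_form_def]
  show "coeff_form 0 0 (T1 x) (T1 y) = coeff_form 0 0 x y + coeff_form 1 0 x y + coeff_form 2 0 x y"
    "coeff_form 0 1 (T1 x) (T1 y) = coeff_form 0 1 x y + coeff_form 1 1 x y"
    "coeff_form 0 2 (T1 x) (T1 y) = coeff_form 0 2 x y"
    "coeff_form 1 0 (T1 x) (T1 y) = coeff_form 1 0 x y + 2 * coeff_form 2 0 x y"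
    "coeff_form 1 1 (T1 x) (T1 y) = coeff_form 1 1 x y"
    "coeff_form 2 0 (T1 x) (T1 y) = coeff_form 2 0 x y" by (fact *)+
qed

lemma coeff_form_T2:
  assumes x: "x \<in> carrier H" and y: "y \<in> carrier H"
  shows "coeff_form 0 0 (T2 x) (T2 y) = coeff_form 0 0 x y + coeff_form 0 1 x y + coeff_form 0 2 x y"
    "coeff_form 0 1 (T2 x) (T2 y) = coeff_form 0 1 x y + 2 * coeff_form 0 2 x y"
    "coeff_form 0 2 (T2 x) (T2 y) = coeff_form 0 2 x y"
    "coeff_form 1 0 (T2 x) (T2 y) = coeff_form 1 0 x y + coeff_form 1 1 x y"
    "coeff_form 1 1 (T2 x) (T2 y) = coeff_form 1 1 x y"
    "coeff_form 2 0 (T2 x) (T2 y) = coeff_form 2 0 x y"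
proof -
  have "ip H ((T1 ^^ n) ((T2 ^^ m) (T2 x))) ((T1 ^^ n) ((T2 ^^ m) (T2 y)))
    = (coeff_form 0 0 x y + coeff_form 0 1 x y + coeff_form 0 2 x y)
      + of_nat m * (coeff_form 0 1 x y + 2 * coeff_form 0 2 x y)
      + of_nat m ^ 2 * coeff_form 0 2 x y + of_nat n * (coeff_form 1 0 x y + coeff_form 1 1 x y)
      + of_nat n * of_nat m * coeff_form 1 1 x y + of_nat n ^ 2 * coeff_form 2 0 x y" for n m
  proof -
    have "(T2 ^^ m) (T2 z) = (T2 ^^ Suc m) z" for z
      by (simp add: funpow_swap1)
    then show ?thesis
      using inner_T_pow_coeff_form[OF x y, of n "Suc m"] by (simp add: algebra_simps power2_eq_square)
  qed
  note * = pencil_coeffs_eq[OF T1 T2 coeffs TD(2)[OF x] TD(2)[OF y] this, folded coeff_form_def]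
  show "coeff_form 0 0 (T2 x) (T2 y) = coeff_form 0 0 x y + coeff_form 0 1 x y + coeff_form 0 2 x y"
    "coeff_form 0 1 (T2 x) (T2 y) = coeff_form 0 1 x y + 2 * coeff_form 0 2 x y"
    "coeff_form 0 2 (T2 x) (T2 y) = coeff_form 0 2 x y"
    "coeff_form 1 0 (T2 x) (T2 y) = coeff_form 1 0 x y + coeff_form 1 1 x y"
    "coeff_form 1 1 (T2 x) (T2 y) = coeff_form 1 1 x y"
    "coeff_form 2 0 (T2 x) (T2 y) = coeff_form 2 0 x y" by (fact *)+
qed

definition T_pow :: "nat \<Rightarrow> nat \<Rightarrow> 'h \<Rightarrow> 'h" where
  "T_pow a b x = (T1 ^^ a) ((T2 ^^ b) x)"

lemma T_pow_carrier: "x \<in> carrier H \<Longrightarrow> T_pow a b x \<in> carrier H"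
  by (simp add: T_pow_def bounded_op_funpow_carrier[OF T1] bounded_op_funpow_carrier[OF T2])

lemma T_pow_0 [simp]: "T_pow 0 0 x = x"
  by (simp add: T_pow_def)

lemma T_pow_T1: "x \<in> carrier H \<Longrightarrow> T_pow a b (T1 x) = T_pow (Suc a) b x"
  by (simp add: T_pow_def T2_pow_T1 funpow_swap1)

lemma T_pow_T2: "T_pow a b (T2 x) = T_pow a (Suc b) x"
  by (simp add: T_pow_def funpow_swap1)

lemma T_pow_Suc: "T_pow (Suc a) b x = T1 (T_pow a b x)" "T_pow 0 (Suc b) x = T2 (T_pow 0 b x)"
  by (simp_all add: T_pow_def)

lemma T_pow_induct:
  assumes "P 0 0 x y" and "x \<in> carrier H" "y \<in> carrier H"
    and "\<And>a b. P a b (T_pow a b x) (T_pow a b y) \<Longrightarrow> P (Suc a) b (T1 (T_pow a b x)) (T1 (T_pow a b y))"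
    and "\<And>a b. P a b (T_pow a b x) (T_pow a b y) \<Longrightarrow> P a (Suc b) (T2 (T_pow a b x)) (T2 (T_pow a b y))"
  shows "P a b (T_pow a b x) (T_pow a b y)"
proof (induction a)
  case 0
  show ?case using assms(1,5) by (induction b) (simp_all add: T_pow_Suc)
next
  case (Suc a)
  then show ?case using assms(4) by (simp add: T_pow_Suc)
qed

text \<open>
Each application of \<open>T1\<close> or \<open>T2\<close> moves the corresponding argument of the pencil forward by one.
\<close>

lemma hat_form_T_pow:
  assumes "x \<in> carrier H" "y \<in> carrier H"
  shows "hat_form (- real a) (- real b) (T_pow a b x) (T_pow a b y) = hat_form 0 0 x y"
proof -
  have "hat_form (\<alpha> - 1) \<beta> (T1 z) (T1 w) = hat_form \<alpha> \<beta> z w" "hat_form \<alpha> (\<beta> - 1) (T2 z) (T2 w)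
    = hat_form \<alpha> \<beta> z w"
    if "z \<in> carrier H" "w \<in> carrier H" for \<alpha> \<beta> z w
    using that by (simp_all add: hat_form_expand TD coeff_form_T1 coeff_form_T2 algebra_simps
      power2_eq_square del: One_nat_def)
  note shift = this
  have neg: "- real (Suc n) = - real n - 1" for n by simp
  show ?thesis
  proof (rule T_pow_induct[where P="\<lambda>a b z w. hat_form (- real a) (- real b) z w = hat_form 0 0 x y"])
    fix a b
    assume "hat_form (- real a) (- real b) (T_pow a b x) (T_pow a b y) = hat_form 0 0 x y"
    then show "hat_form (- real (Suc a)) (- real b) (T1 (T_pow a b x)) (T1 (T_pow a b y))
      = hat_form 0 0 x y"
      "hat_form (- real a) (- real (Suc b)) (T2 (T_pow a b x)) (T2 (T_pow a b y)) = hat_form 0 0 x y"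
      using shift(1)[of "T_pow a b x" "T_pow a b y" "- real a" "- real b"]
        shift(2)[of "T_pow a b x" "T_pow a b y" "- real a" "- real b"] assms
      by (simp_all add: T_pow_carrier neg del: of_nat_Suc)
  qed (use assms in simp_all)
qed

lemma coeff_form_T_pow:
  assumes "x \<in> carrier H" "y \<in> carrier H"
  shows "coeff_form 2 0 (T_pow a b x) (T_pow a b y) = coeff_form 2 0 x y"
    "coeff_form 0 2 (T_pow a b x) (T_pow a b y) = coeff_form 0 2 x y"
proof -
  have "coeff_form 2 0 (T_pow a b x) (T_pow a b y) = coeff_form 2 0 x y
    \<and> coeff_form 0 2 (T_pow a b x) (T_pow a b y) = coeff_form 0 2 x y"
    by (rule T_pow_induct[where P="\<lambda>a b z w. coeff_form 2 0 z w = coeff_form 2 0 x y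
      \<and> coeff_form 0 2 z w = coeff_form 0 2 x y"])
      (use assms in \<open>simp_all add: coeff_form_T1 coeff_form_T2 T_pow_carrier\<close>)
  then show "coeff_form 2 0 (T_pow a b x) (T_pow a b y) = coeff_form 2 0 x y"
    "coeff_form 0 2 (T_pow a b x) (T_pow a b y) = coeff_form 0 2 x y" by auto
qed

text \<open>
The parts of the factorization that are determined by the pencil: its value at the origin and
its pure second-order coefficients. The mixed products such as \<open>\<langle>V0 x, V1 y\<rangle>\<close> enter only through
their symmetrized sums.
\<close>

lemma inner_V:
  assumes x: "x \<in> carrier H" and y: "y \<in> carrier H"
  shows "ip H (V0 x) (V0 y) = hat_form 0 0 x y"
    and "ip H (V1 x) (V1 y) = coeff_form 2 0 x y"
    and "ip H (V2 x) (V2 y) = coeff_form 0 2 x y"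
proof -
  show "ip H (V0 x) (V0 y) = hat_form 0 0 x y"
    using x y by (simp add: hat_form_def factor VD inner_simps)
  let ?G = "\<lambda>A A'. ip H (A x) (A' y)"
  have "(coeff_form 0 0 x y - coeff_form 2 0 x y / of_real c ^ 2 - coeff_form 0 2 x y / of_real d ^ 2)
      + of_nat m * coeff_form 0 1 x y + of_nat m ^ 2 * coeff_form 0 2 x y
        + of_nat n * coeff_form 1 0 x y
      + of_nat n * of_nat m * coeff_form 1 1 x y + of_nat n ^ 2 * coeff_form 2 0 x y
    = ?G V0 V0 + of_nat m * (?G V0 V2 + ?G V2 V0) + of_nat m ^ 2 * ?G V2 V2
      + of_nat n * (?G V0 V1 + ?G V1 V0) + of_nat n * of_nat m * (?G V1 V2 + ?G V2 V1)
      + of_nat n ^ 2 * ?G V1 V1" for n m :: nat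
  proof -
    have "hat_form (real n) (real m) x y = ?G V0 V0 + of_nat m * (?G V0 V2 + ?G V2 V0)
      + of_nat m ^ 2 * ?G V2 V2
      + of_nat n * (?G V0 V1 + ?G V1 V0) + of_nat n * of_nat m * (?G V1 V2 + ?G V2 V1)
      + of_nat n ^ 2 * ?G V1 V1"
      using x y by (simp add: hat_form_def factor VD inner_simps algebra_simps power2_eq_square)
    then show ?thesis by (simp add: hat_form_expand[OF x y])
  qed
  from quadratic_coeffs_unique[OF this]
  show "ip H (V1 x) (V1 y) = coeff_form 2 0 x y" "ip H (V2 x) (V2 y) = coeff_form 0 2 x y" by simp_all
qed

lemma inner_eq_sum_V:
  assumes "x \<in> carrier H" "y \<in> carrier H"
  shows "ip H x y = ip H (V0 x) (V0 y)
    + ip H (V1 x) (V1 y) / of_real c ^ 2 + ip H (V2 x) (V2 y) / of_real d ^ 2"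
  using assms by (simp add: inner_eq_coeff_form inner_V hat_form_expand)

section \<open>Shifted factorizations\<close>

fun factor_coeff :: "nat \<Rightarrow> 'h \<Rightarrow> 'h" where
  "factor_coeff 0 x = V0 x"
| "factor_coeff (Suc 0) x = V1 x"
| "factor_coeff (Suc (Suc j)) x = V2 x"

text \<open>
The coefficients of \<open>1\<close>, \<open>\<alpha>\<close> and \<open>\<beta>\<close> in \<open>W(\<alpha> - a, \<beta> - b) T1\<^sup>a T2\<^sup>b\<close>, numbered \<open>0\<close>, \<open>1\<close> and at
least \<open>2\<close>; the last clause makes every number admissible.
\<close>

fun shifted_coeff :: "nat \<Rightarrow> nat \<Rightarrow> nat \<Rightarrow> 'h \<Rightarrow> 'h" where
  "shifted_coeff 0 a b x = V0 (T_pow a b x) \<oplus> complex_of_real (- real a) \<odot> V1 (T_pow a b x)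
    \<oplus> complex_of_real (- real b) \<odot> V2 (T_pow a b x)"
| "shifted_coeff (Suc 0) a b x = V1 (T_pow a b x)"
| "shifted_coeff (Suc (Suc j)) a b x = V2 (T_pow a b x)"

lemma T_pow_add: "\<lbrakk>x \<in> carrier H; y \<in> carrier H\<rbrakk> \<Longrightarrow> T_pow a b (x \<oplus> y) = T_pow a b x \<oplus> T_pow a b y"
proof -
  have 1: "(T ^^ n) (x \<oplus> y) = (T ^^ n) x \<oplus> (T ^^ n) y"
    if "bounded_op H H T" "x \<in> carrier H" "y \<in> carrier H" for T n x y
    using that(2,3) by (induction n) (simp_all add: bounded_opD(2)[OF that(1)]
      bounded_op_funpow_carrier[OF that(1)])
  show "\<lbrakk>x \<in> carrier H; y \<in> carrier H\<rbrakk> \<Longrightarrow> T_pow a b (x \<oplus> y) = T_pow a b x \<oplus> T_pow a b y"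
    by (simp add: T_pow_def 1[OF T1] 1[OF T2] bounded_op_funpow_carrier[OF T2])
qed

lemma T_pow_smult: "x \<in> carrier H \<Longrightarrow> T_pow a b (e \<odot> x) = e \<odot> T_pow a b x"
proof -
  have 1: "(T ^^ n) (e \<odot> x) = e \<odot> (T ^^ n) x"
    if "bounded_op H H T" "x \<in> carrier H" for T n x
    using that(2) by (induction n) (simp_all add: bounded_opD(3)[OF that(1)]
      bounded_op_funpow_carrier[OF that(1)])
  show "x \<in> carrier H \<Longrightarrow> T_pow a b (e \<odot> x) = e \<odot> T_pow a b x"
    by (simp add: T_pow_def 1[OF T1] 1[OF T2] bounded_op_funpow_carrier[OF T2])
qed

lemma shifted_coeff_carrier: "x \<in> carrier H \<Longrightarrow> shifted_coeff j a b x \<in> carrier H"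
  by (cases "(j, a, b, x)" rule: shifted_coeff.cases) (simp_all add: VD T_pow_carrier)

lemma shifted_coeff_add:
  assumes "x \<in> carrier H" "y \<in> carrier H"
  shows "shifted_coeff j a b (x \<oplus> y) = shifted_coeff j a b x \<oplus> shifted_coeff j a b y"
  using assms by (cases "(j, a, b, x)" rule: shifted_coeff.cases)
    (auto intro!: inner_ext simp: VD T_pow_carrier T_pow_add inner_simps algebra_simps)

lemma shifted_coeff_smult:
  assumes "x \<in> carrier H"
  shows "shifted_coeff j a b (e \<odot> x) = e \<odot> shifted_coeff j a b x"
  using assms by (cases "(j, a, b, x)" rule: shifted_coeff.cases)
    (auto intro!: inner_ext simp: VD T_pow_carrier T_pow_smult inner_simps algebra_simps)

text \<open>
The constant coefficient is \<open>W(- a, - b) T1\<^sup>a T2\<^sup>b\<close>, so for \<open>j = 0\<close> the product is a value of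
the modified pencil, which \<open>hat_form_T_pow\<close> moves to the origin; for the others the leading
coefficients of the pencil are invariant under \<open>T1, T2\<close>. Independence of \<open>a\<close> and \<open>b\<close> makes these
products survive averaging.
\<close>

lemma inner_shifted_coeff:
  assumes "x \<in> carrier H" "y \<in> carrier H"
  shows "ip H (shifted_coeff j a b x) (shifted_coeff j a b y)
    = ip H (factor_coeff j x) (factor_coeff j y)"
proof (cases "(j, a, b, x)" rule: shifted_coeff.cases)
  case (1 a' b' x')
  have "ip H (shifted_coeff 0 a b x) (shifted_coeff 0 a b y)
    = hat_form (- real a) (- real b) (T_pow a b x) (T_pow a b y)"
    using assms by (simp only: shifted_coeff.simps hat_form_def factor T_pow_carrier)
  then show ?thesis using 1 assms by (simp add: hat_form_T_pow inner_V del: shifted_coeff.simps)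
qed (use assms in \<open>simp_all add: inner_V coeff_form_T_pow T_pow_carrier\<close>)

text \<open>
Replacing \<open>x\<close> by \<open>T1 x\<close> amounts to replacing \<open>a\<close> by \<open>a + 1\<close>, corrected in the constant
coefficient by the relation that \<open>J1\<close> demands.
\<close>

lemma shifted_coeff_T1:
  assumes "x \<in> carrier H"
  shows "shifted_coeff 0 a b (T1 x) = shifted_coeff 0 (Suc a) b x \<oplus> shifted_coeff 1 (Suc a) b x"
    "shifted_coeff (Suc j) a b (T1 x) = shifted_coeff (Suc j) (Suc a) b x"
proof -
  show "shifted_coeff 0 a b (T1 x) = shifted_coeff 0 (Suc a) b x \<oplus> shifted_coeff 1 (Suc a) b x"
    using assms by (intro inner_ext)
      (simp_all add: T_pow_T1 VD TD T_pow_carrier inner_simps algebra_simps)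
  show "shifted_coeff (Suc j) a b (T1 x) = shifted_coeff (Suc j) (Suc a) b x"
    using assms by (cases j) (simp_all add: T_pow_T1)
qed

lemma shifted_coeff_T2:
  assumes "x \<in> carrier H"
  shows "shifted_coeff 0 a b (T2 x) = shifted_coeff 0 a (Suc b) x \<oplus> shifted_coeff 2 a (Suc b) x"
    "shifted_coeff (Suc j) a b (T2 x) = shifted_coeff (Suc j) a (Suc b) x"
proof -
  show "shifted_coeff 0 a b (T2 x) = shifted_coeff 0 a (Suc b) x \<oplus> shifted_coeff 2 a (Suc b) x"
    using assms by (intro inner_ext)
      (simp_all add: numeral_2_eq_2 T_pow_T2 VD TD T_pow_carrier inner_simps algebra_simps)
  show "shifted_coeff (Suc j) a b (T2 x) = shifted_coeff (Suc j) a (Suc b) x"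
    using assms by (cases j) (simp_all add: T_pow_T2)
qed

section \<open>From a factorization to a lifting\<close>

text \<open>
The points of the kernel are triples consisting of a position in the integer lattice and the
number of a coefficient, together with a vector. The triples are enumerated by a bijection with
the natural numbers because the functions on \<open>nat \<times> 'h\<close> are what the universe provides.
\<close>

definition decode :: "nat \<Rightarrow> int \<times> int \<times> nat" where
  "decode = from_nat_into UNIV"

definition point :: "int \<Rightarrow> int \<Rightarrow> nat \<Rightarrow> 'h \<Rightarrow> nat \<times> 'h" where
  "point s t j x = (inv_into UNIV decode (s, t, j), x)"

text \<open>
The position \<open>(s, t)\<close> shifts the averaging variable \<open>(n, m)\<close>. Positions in the whole integer
lattice make the shifts bijective. Where \<open>n + s\<close> or \<open>m + t\<close> is negative, \<open>nat\<close> puts \<open>0\<close> in its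
place; the relation between shifting \<open>(n, m)\<close> and shifting \<open>(s, t)\<close> is exact nevertheless
(\<open>orbit_vec_translate\<close>). Points whose vector lies outside the carrier are sent to zero.
\<close>

definition orbit_vec :: "nat \<Rightarrow> nat \<Rightarrow> nat \<times> 'h \<Rightarrow> 'h" where
  "orbit_vec n m p = (case decode (fst p) of (s, t, j) \<Rightarrow>
    if snd p \<in> carrier H then shifted_coeff j (nat (int n + s)) (nat (int m + t)) (snd p) else \<zero>)"

definition translate :: "int \<Rightarrow> int \<Rightarrow> nat \<times> 'h \<Rightarrow> nat \<times> 'h" where
  "translate s0 t0 p = (case decode (fst p) of (s, t, j) \<Rightarrow> point (s + s0) (t + t0) j (snd p))"

lemma bij_decode: "bij decode"
proof -
  have "infinite (UNIV :: (int \<times> int \<times> nat) set)" by (simp add: finite_prod)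
  then show ?thesis unfolding decode_def by (intro bij_betw_from_nat_into) auto
qed

lemma decode_point [simp]: "decode (fst (point s t j x)) = (s, t, j)" "snd (point s t j x) = x"
  using bij_is_surj[OF bij_decode] by (simp_all add: point_def surj_f_inv_f)

lemma point_decode:
  assumes "decode (fst p) = (s, t, j)"
  shows "point s t j (snd p) = p"
proof -
  have "inv_into UNIV decode (s, t, j) = fst p"
    using inv_f_f[OF bij_is_inj[OF bij_decode], of "fst p"] unfolding assms .
  then show ?thesis by (simp add: point_def)
qed

lemma translate_point [simp]: "translate s0 t0 (point s t j x) = point (s + s0) (t + t0) j x"
  by (simp add: translate_def)

lemma point_cases: obtains s t j x where "p = point s t j x"
  using point_decode[of p] by (metis prod_cases3)

lemma translate_translate: "translate s0 t0 (translate s1 t1 p) = translate (s1 + s0) (t1 + t0) p"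
  by (cases p rule: point_cases) (simp add: add.assoc)

lemma bij_translate: "bij (translate s0 t0)"
proof (rule o_bij)
  have 0: "translate 0 0 p = p" for p by (cases p rule: point_cases) simp
  show "translate (- s0) (- t0) \<circ> translate s0 t0 = id" "translate s0 t0 \<circ> translate (- s0) (- t0) = id"
    by (simp_all add: fun_eq_iff translate_translate 0)
qed

lemma orbit_vec_point: "x \<in> carrier H \<Longrightarrow> orbit_vec n m (point s t j x)
  = shifted_coeff j (nat (int n + s)) (nat (int m + t)) x"
  by (simp add: orbit_vec_def)

lemma orbit_vec_carrier: "orbit_vec n m p \<in> carrier H"
  by (simp add: orbit_vec_def shifted_coeff_carrier split: prod.split)

lemma orbit_vec_translate: "orbit_vec (Suc n) m p
  = orbit_vec n m (translate 1 0 p)" "orbit_vec n (Suc m) p = orbit_vec n m (translate 0 1 p)"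
proof -
  have "int (Suc k) + s = int k + (s + 1)" for k s by simp
  note eq = this
  show "orbit_vec (Suc n) m p = orbit_vec n m (translate 1 0 p)" "orbit_vec n (Suc m) p
    = orbit_vec n m (translate 0 1 p)"
    by (cases p rule: point_cases; simp add: orbit_vec_def eq del: of_nat_Suc)+
qed

lemma hnorm_orbit_vec: "hnorm H (orbit_vec n m p) = hnorm H (orbit_vec 0 0 p)"
proof (cases p rule: point_cases)
  case (1 s t j x)
  then show ?thesis by (simp add: orbit_vec_def hnorm_def inner_shifted_coeff)
qed

text \<open>
The components of the lifting send \<open>x\<close> to multiples, by \<open>1\<close>, \<open>1/c\<close> and \<open>1/d\<close>, of the kernel
functions at \<open>point 0 0 j x\<close>, and \<open>U1, U2\<close> are the lattice shifts. Linearity and the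
intertwining relations are linear relations between kernel functions, inherited from \<open>orbit_vec\<close>
by the mean; the norm identity only involves products that do not depend on \<open>n, m\<close>.
\<close>

theorem ex_lifting:
  "\<exists>(K :: (('f, 'h) universe \<times> ('f, 'h) universe \<times> ('f, 'h) universe) hilbert) J1 J2.
    class_J c d K J1 J2 \<and> lifts_to H T1 T2 K J1 J2"
proof -
  let ?k = "\<lambda>n m p q. ip H (orbit_vec n m p) (orbit_vec n m q)"
  obtain K where K: "positive_kernel K"
    and rel: "\<And>xs ys. (\<And>n m. kform (?k n m) xs ys = 0) \<Longrightarrow> kform K xs ys = 0"
    and const: "\<And>p q c. (\<And>n m. ?k n m p q = c) \<Longrightarrow> K p q = c"
    and inv1: "\<And>p q p' q'. (\<And>n m. ?k (Suc n) m p q = ?k n m p' q') \<Longrightarrow> K p' q' = K p q"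
    and inv2: "\<And>p q p' q'. (\<And>n m. ?k n (Suc m) p q = ?k n m p' q') \<Longrightarrow> K p' q' = K p q"
  proof (rule ex_invariant_mean_kernel[of ?k "\<lambda>p q. hnorm H (orbit_vec 0 0 p) * hnorm H (orbit_vec 0
    0 q)"])
    show "positive_kernel (?k n m)" for n m by (rule positive_kernel_gram) (rule orbit_vec_carrier)
    show "cmod (?k n m p q) \<le> hnorm H (orbit_vec 0 0 p) * hnorm H (orbit_vec 0 0 q)" for n m p q
      using cauchy_schwarz[OF orbit_vec_carrier[of n m p] orbit_vec_carrier[of n m q]]
        hnorm_orbit_vec[of n m p] hnorm_orbit_vec[of n m q] by simp
  qed blast
  interpret K: positive_kernel K by (rule K)
  interpret K: tagged_kernel K "Inr :: (nat \<times> 'h \<Rightarrow> complex) \<Rightarrow> ('f, 'h) universe"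
    by unfold_locales simp
  define F where "F = K.kernel_space"
  interpret F: complex_hilbert_space F unfolding F_def by (rule K.kernel_space_hilbert)
  define k where "k = K.kfun"
  have kc: "k p \<in> carrier F" for p unfolding F_def k_def by (rule K.kfun_carrier)
  have kk: "ip F (k p) (k q) = K p q" for p q unfolding F_def k_def by (rule K.inner_kfun)
  \<comment> \<open>a relation between the vectors at every stage is a relation between the kernel functions\<close>
  have k_comb: "k p = a \<odot>\<^bsub>F\<^esub> k p1 \<oplus>\<^bsub>F\<^esub> b \<odot>\<^bsub>F\<^esub> k p2"
    if v: "\<And>n m. orbit_vec n m p = a \<odot> orbit_vec n m p1 \<oplus> b \<odot> orbit_vec n m p2" for p a p1 b p2
  proof -
    have "K p q = a * K p1 q + b * K p2 q" for q
    proof -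
      have "kform (?k n m) [(1, p), (- a, p1), (- b, p2)] [(1, q)] = 0" for n m
        using v[of n m] orbit_vec_carrier by (simp add: kform_def inner_simps)
      from rel[OF this] show ?thesis by (simp add: kform_def algebra_simps)
    qed
    then show ?thesis by (simp add: F_def k_def K.kfun_def K.tag_eq_iff fun_eq_iff)
  qed
  define U1 where "U1 = K.shift_op (translate 1 0)"
  define U2 where "U2 = K.shift_op (translate 0 1)"
  have inv: "K (translate 1 0 p) (translate 1 0 q) = K p q" "K (translate 0 1 p) (translate 0 1 q)
    = K p q" for p q
    by (rule inv1, simp add: orbit_vec_translate) (rule inv2, simp add: orbit_vec_translate)
  have U: "unitary_op F U1" "unitary_op F U2"
    unfolding F_def U1_def U2_def by (intro K.unitary_shift_op bij_translate inv)+
  have U_comm: "commute_on F U1 U2"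
    unfolding commute_on_def U1_def U2_def
    by (intro ballI K.shift_op_commute bij_translate) (simp add: translate_translate)
  have Uk: "U1 (k (point s t j x)) = k (point (s + 1) t j x)" "U2 (k (point s t j x))
    = k (point s (t + 1) j x)" for s t j x
    unfolding U1_def U2_def k_def using inv by (simp_all add: K.shift_op_kfun bij_translate)
  have iso: "isometry_op F F U1" "isometry_op F F U2" using U by (auto simp: unitary_op_def)
  note U1D = bounded_opD[OF isometry_opD(1)[OF iso(1)]]
  note U2D = bounded_opD[OF isometry_opD(1)[OF iso(2)]]
  define A where "A j x = k (point 0 0 j x)" for j x
  have Ac: "A j x \<in> carrier F" for j x unfolding A_def by (rule kc)
  have one: "1 \<odot>\<^bsub>F\<^esub> u = u" "u \<oplus>\<^bsub>F\<^esub> 0 \<odot>\<^bsub>F\<^esub> u = u" if "u \<in> carrier F" for u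
    using that by (auto intro!: F.inner_ext simp: F.inner_simps)
  have oneH: "1 \<odot> u = u" "u \<oplus> 0 \<odot> v = u" if "u \<in> carrier H" "v \<in> carrier H" for u v
    using that by (auto intro!: inner_ext simp: inner_simps)
  have A_add: "A j (x \<oplus> y) = A j x \<oplus>\<^bsub>F\<^esub> A j y" if "x \<in> carrier H" "y \<in> carrier H" for j x y
  proof -
    have "A j (x \<oplus> y) = 1 \<odot>\<^bsub>F\<^esub> A j x \<oplus>\<^bsub>F\<^esub> 1 \<odot>\<^bsub>F\<^esub> A j y"
      unfolding A_def by (rule k_comb) (use that in \<open>simp add: orbit_vec_point shifted_coeff_add
        shifted_coeff_carrier oneH\<close>)
    then show ?thesis by (simp add: one Ac)
  qed
  have A_smult: "A j (e \<odot> x) = e \<odot>\<^bsub>F\<^esub> A j x" if "x \<in> carrier H" for j e x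
  proof -
    have "A j (e \<odot> x) = e \<odot>\<^bsub>F\<^esub> A j x \<oplus>\<^bsub>F\<^esub> 0 \<odot>\<^bsub>F\<^esub> A j x"
      unfolding A_def by (rule k_comb) (use that in \<open>simp add: orbit_vec_point shifted_coeff_smult
        shifted_coeff_carrier oneH\<close>)
    then show ?thesis by (simp add: Ac) (auto intro!: F.inner_ext simp: Ac F.inner_simps)
  qed
  have A_T1: "A 0 (T1 x) = U1 (A 0 x) \<oplus>\<^bsub>F\<^esub> U1 (A 1 x)" if "x \<in> carrier H" for x
  proof -
    have "A 0 (T1 x) = 1 \<odot>\<^bsub>F\<^esub> k (point 1 0 0 x) \<oplus>\<^bsub>F\<^esub> 1 \<odot>\<^bsub>F\<^esub> k (point 1 0 1 x)"
      unfolding A_def by (rule k_comb)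
        (use that in \<open>simp add: orbit_vec_point TD shifted_coeff_T1 shifted_coeff_carrier oneH
          nat_add_distrib del: shifted_coeff.simps One_nat_def\<close>)
    then show ?thesis by (simp add: one kc A_def Uk)
  qed
  have A_T1': "A (Suc j) (T1 x) = U1 (A (Suc j) x)" if "x \<in> carrier H" for j x
  proof -
    have "A (Suc j) (T1 x) = 1 \<odot>\<^bsub>F\<^esub> k (point 1 0 (Suc j) x) \<oplus>\<^bsub>F\<^esub> 0 \<odot>\<^bsub>F\<^esub> k (point 1 0 (Suc j) x)"
      unfolding A_def by (rule k_comb)
        (use that in \<open>simp add: orbit_vec_point TD shifted_coeff_T1 shifted_coeff_carrier oneH
          nat_add_distrib del: shifted_coeff.simps\<close>)
    then show ?thesis by (simp add: one kc A_def Uk)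
  qed
  have A_T2: "A 0 (T2 x) = U2 (A 0 x) \<oplus>\<^bsub>F\<^esub> U2 (A 2 x)" if "x \<in> carrier H" for x
  proof -
    have "A 0 (T2 x) = 1 \<odot>\<^bsub>F\<^esub> k (point 0 1 0 x) \<oplus>\<^bsub>F\<^esub> 1 \<odot>\<^bsub>F\<^esub> k (point 0 1 2 x)"
      unfolding A_def by (rule k_comb)
        (use that in \<open>simp add: orbit_vec_point TD shifted_coeff_T2 shifted_coeff_carrier oneH
          nat_add_distrib del: shifted_coeff.simps\<close>)
    then show ?thesis by (simp add: one kc A_def Uk)
  qed
  have A_T2': "A (Suc j) (T2 x) = U2 (A (Suc j) x)" if "x \<in> carrier H" for j x
  proof -
    have "A (Suc j) (T2 x) = 1 \<odot>\<^bsub>F\<^esub> k (point 0 1 (Suc j) x) \<oplus>\<^bsub>F\<^esub> 0 \<odot>\<^bsub>F\<^esub> k (point 0 1 (Suc j) x)"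
      unfolding A_def by (rule k_comb)
        (use that in \<open>simp add: orbit_vec_point TD shifted_coeff_T2 shifted_coeff_carrier oneH
          nat_add_distrib del: shifted_coeff.simps\<close>)
    then show ?thesis by (simp add: one kc A_def Uk)
  qed
  have inner_A: "ip F (A j x) (A j x) = ip H (factor_coeff j x) (factor_coeff j x)"
    if "x \<in> carrier H" for j x
    unfolding A_def kk by (rule const) (use that in \<open>simp add: orbit_vec_point inner_shifted_coeff\<close>)
  define L where "L x = (A 0 x, complex_of_real (1 / c) \<odot>\<^bsub>F\<^esub> A 1 x,
    complex_of_real (1 / d) \<odot>\<^bsub>F\<^esub> A 2 x)" for x
  define J1 where "J1 = (\<lambda>(x, y, z). (U1 x \<oplus>\<^bsub>F\<^esub> complex_of_real c \<odot>\<^bsub>F\<^esub> U1 y, U1 y, U1 z))"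
  define J2 where "J2 = (\<lambda>(x, y, z). (U2 x \<oplus>\<^bsub>F\<^esub> complex_of_real d \<odot>\<^bsub>F\<^esub> U2 z, U2 y, U2 z))"
  let ?FFF = "F \<oplus>\<^sub>H F \<oplus>\<^sub>H F"
  have "class_J c d ?FFF J1 J2"
    unfolding class_J_def
    by (intro exI[of _ F] exI[of _ U1] exI[of _ U2])
      (simp add: F.complex_hilbert_space_axioms U U_comm J1_def J2_def)
  moreover have "lifts_to H T1 T2 ?FFF J1 J2"
    unfolding lifts_to_def
  proof (intro exI[of _ L] conjI ballI)
    have norm: "hnorm ?FFF (L x) = hnorm H x" if "x \<in> carrier H" for x
    proof -
      have "inner_prod ?FFF (L x) (L x) = ip H x x"
        using that c d Ac inner_A[of x 0] inner_A[of x 1] inner_A[of x 2]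
        by (simp add: L_def F.inner_simps inner_eq_sum_V numeral_2_eq_2 power2_eq_square)
      then show ?thesis by (simp add: hnorm_def)
    qed
    have "bounded_op H ?FFF L"
    proof (rule bounded_opI[where M=1])
      show "L (x \<oplus> y) = L x \<oplus>\<^bsub>?FFF\<^esub> L y" if "x \<in> carrier H" "y \<in> carrier H" for x y
        using that by (auto intro!: F.inner_ext simp: L_def A_add Ac F.inner_simps algebra_simps)
      show "L (e \<odot> x) = e \<odot>\<^bsub>?FFF\<^esub> L x" if "x \<in> carrier H" for e x
        using that by (auto intro!: F.inner_ext simp: L_def A_smult Ac F.inner_simps algebra_simps)
    qed (use norm in \<open>auto simp: L_def Ac\<close>)
    with norm show "isometry_op H ?FFF L" by (simp add: isometry_op_def)
    fix x assume x: "x \<in> carrier H"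
    have cancel: "complex_of_real e \<odot>\<^bsub>F\<^esub> (complex_of_real (1 / e) \<odot>\<^bsub>F\<^esub> u) = u"
      if "u \<in> carrier F" "e > 0" for u and e :: real
      using that by (intro F.inner_ext) (simp_all add: F.inner_simps)
    show "L (T1 x) = J1 (L x)" "L (T2 x) = J2 (L x)"
      using x A_T1'[of x 0] A_T1'[of x 1] A_T2'[of x 0] A_T2'[of x 1] cancel c d
      by (simp_all add: L_def J1_def J2_def A_T1 A_T2 U1D U2D Ac numeral_2_eq_2 del: of_real_divide)
  qed
  ultimately show ?thesis by blast
qed

end

lemma Q_hat_factors_imp_lifting:
  fixes H :: "'h hilbert"
  assumes H: "complex_hilbert_space H" and c: "c > 0" and d: "d > 0"
    and T: "three_isometric_pair H T1 T2"
    and V: "bounded_op H H V0" "bounded_op H H V1" "bounded_op H H V2"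
    and Q: "\<And>\<alpha> \<beta> x. x \<in> carrier H \<Longrightarrow>
      let W = (\<lambda>y. V0 y \<oplus>\<^bsub>H\<^esub> complex_of_real \<alpha> \<odot>\<^bsub>H\<^esub> V1 y \<oplus>\<^bsub>H\<^esub> complex_of_real \<beta> \<odot>\<^bsub>H\<^esub> V2 y)
      in Q_hat c d H T1 T2 \<alpha> \<beta> x = adj H H W (W x)"
  shows "\<exists>(K :: (('f, 'h) universe \<times> ('f, 'h) universe \<times> ('f, 'h) universe) hilbert) J1 J2.
    class_J c d K J1 J2 \<and> lifts_to H T1 T2 K J1 J2"
proof -
  interpret H: complex_hilbert_space H by fact
  have T12: "bounded_op H H T1" "bounded_op H H T2" "commute_on H T1 T2"
    using T by (auto simp: three_isometric_pair_def)
  interpret factored_pencil H T1 T2 V0 V1 V2 c d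
  proof
    fix x y \<alpha> \<beta> assume x: "x \<in> carrier H" and y: "y \<in> carrier H"
    let ?W = "\<lambda>y. V0 y \<oplus>\<^bsub>H\<^esub> complex_of_real \<alpha> \<odot>\<^bsub>H\<^esub> V1 y \<oplus>\<^bsub>H\<^esub> complex_of_real \<beta> \<odot>\<^bsub>H\<^esub> V2 y"
    have W: "bounded_op H H ?W"
      by (intro bounded_op_add bounded_op_smult H V)
    have Wc: "?W z \<in> carrier H" if "z \<in> carrier H" for z using bounded_opD(1)[OF W that] .
    have "ip H (Q_hat c d H T1 T2 \<alpha> \<beta> x) y = ip H (adj H H ?W (?W x)) y"
      using Q[OF x, of \<alpha> \<beta>] by (simp add: Let_def)
    also have "\<dots> = cnj (ip H y (adj H H ?W (?W x)))"
      by (rule H.inner_prod_commute[OF adj_carrier_inner(1)[OF H H W Wc[OF x]] y])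
    also have "\<dots> = cnj (ip H (?W y) (?W x))"
      unfolding adj_carrier_inner(2)[OF H H W Wc[OF x] y] ..
    also have "\<dots> = ip H (?W x) (?W y)"
      by (rule H.inner_prod_commute[OF Wc[OF x] Wc[OF y], symmetric])
    finally show "ip H (Q_hat c d H T1 T2 \<alpha> \<beta> x) y = ip H (?W x) (?W y)" .
  qed (fact T12 c d V pencil_coeffs_coeff_op[OF T])+
  show ?thesis by (rule ex_lifting)
qed

theorem theorem3:
  fixes H :: "'h hilbert"
    and T1 T2 :: "'h \<Rightarrow> 'h"
    and c d :: real
  assumes "complex_hilbert_space H"
    and "c > 0" and "d > 0"
    and "three_isometric_pair H T1 T2"
    and "class_F c d H T1 T2"
  shows
    "(\<exists>(K :: (('f, 'h) universe \<times> ('f, 'h) universe \<times> ('f, 'h) universe) hilbert) J1 J2.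
        class_J c d K J1 J2 \<and> lifts_to H T1 T2 K J1 J2)
     \<longleftrightarrow>
     (\<exists>V0 V1 V2.
        bounded_op H H V0 \<and> bounded_op H H V1 \<and> bounded_op H H V2 \<and>
        (\<forall>\<alpha> \<beta> :: real. \<forall>x\<in>carrier H.
          let W = (\<lambda>y. V0 y \<oplus>\<^bsub>H\<^esub> complex_of_real \<alpha> \<odot>\<^bsub>H\<^esub> V1 y \<oplus>\<^bsub>H\<^esub> complex_of_real \<beta> \<odot>\<^bsub>H\<^esub> V2 y)
          in Q_hat c d H T1 T2 \<alpha> \<beta> x = adj H H W (W x)))"
    (is "?lifts \<longleftrightarrow> ?factors")
proof
  assume ?lifts
  then show ?factors using lifting_imp_Q_hat_factors[OF assms(1-4)] by blast
next
  assume ?factors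
  then obtain V0 V1 V2 where V: "bounded_op H H V0" "bounded_op H H V1" "bounded_op H H V2"
    and Q: "\<forall>\<alpha> \<beta> :: real. \<forall>x\<in>carrier H.
      let W = (\<lambda>y. V0 y \<oplus>\<^bsub>H\<^esub> complex_of_real \<alpha> \<odot>\<^bsub>H\<^esub> V1 y \<oplus>\<^bsub>H\<^esub> complex_of_real \<beta> \<odot>\<^bsub>H\<^esub> V2 y)
      in Q_hat c d H T1 T2 \<alpha> \<beta> x = adj H H W (W x)"
    by (elim exE conjE)
  show ?lifts
    by (rule Q_hat_factors_imp_lifting[OF assms(1-4) V]) (use Q in blast)
qed

end
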